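(* Let $V$ be a real vector space of dimension $2n$, $n\geq 1$, let $\Omega\in\wedge^{2}V^{\ast}$ be a non-degenerate skew-symmetric bilinear form, and let $N_{2n}$ be the number of functionally independent $Sp(\Omega)$-invariant functions defined on the dense open subset $\mathcal{O}\subset\wedge^{3}V^{\ast}$ specified in the context. Then $$N_{2n}=\begin{cases}0,&1\leq n\leq2,\\ 2,&n=3,\\ \dfrac{n(4n^{2}-12n-1)}{3},&n\geq4.\end{cases}$$
   Context: $GL(V)$ acts on $\wedge^{3}V^{\ast}$ by $A\cdot\theta=(A^{-1})^{\ast}\theta$; $Sp(\Omega)\subset GL(V)$ is the symplectic group of $\Omega$, with Lie algebra $\mathfrak{sp}(2n,\mathbb{R})$. For $\theta\in\wedge^{3}V^{\ast}$, let $\mathcal{D}_{\theta}\subset T_{\theta}(\wedge^{3}V^{\ast})$ be the image of the differential at the identity of the orbit map $\mu_{\theta}\colon Sp(\Omega)\to\wedge^{3}V^{\ast}$, $\mu_{\theta}(U)=U\cdot\theta$ (i.e., the span at $\theta$ of the fundamental vector fields of the action). The dense open set $\mathcal{O}\subset\wedge^{3}V^{\ast}$ consists of the points $\theta$ admitting an open neighbourhood $N$ such that $\dim\mathcal{D}_{\theta}=\max_{\theta'\in N}\dim\mathcal{D}_{\theta'}$. A function $I$ is $Sp(\Omega)$-invariant if $I(\Lambda\cdot\theta)=I(\theta)$ for all $\Lambda\in Sp(\Omega)$ and all $\theta$ in its domain. $N_{2n}$ is the maximum number of functionally independent smooth $Sp(\Omega)$-invariant functions on $\mathcal{O}$, where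 functions are functionally independent if their differentials are linearly independent at every point of some dense open subset. *)

theory Defs
  imports "HOL-Analysis.Analysis"
begin

subsection \<open>Smooth maps\<close>

primrec Ck_on :: "nat \<Rightarrow> 'a::real_normed_vector set \<Rightarrow> ('a \<Rightarrow> 'b::real_normed_vector) \<Rightarrow> bool" where
  "Ck_on 0 S f \<longleftrightarrow> continuous_on S f"
| "Ck_on (Suc k) S f \<longleftrightarrow> (\<forall>x\<in>S. f differentiable (at x)) \<and>
     (\<forall>v. Ck_on k S (\<lambda>x. frechet_derivative f (at x) v))"

text \<open>Only used for open \<^term>\<open>S\<close> in finite-dimensional spaces, where continuity of all iterated
  directional derivatives is the same as being of class \<open>C\<^sup>\<infinity>\<close>.\<close>

definition smooth_on :: "'a::real_normed_vector set \<Rightarrow> ('a \<Rightarrow> 'b::real_normed_vector) \<Rightarrow> bool" where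
  "smooth_on S f \<longleftrightarrow> (\<forall>k. Ck_on k S f)"


subsection \<open>The space of alternating 3-forms\<close>

definition trilinear :: "('a::real_vector \<Rightarrow> 'a \<Rightarrow> 'a \<Rightarrow> real) \<Rightarrow> bool" where
  "trilinear f \<longleftrightarrow> (\<forall>v w. linear (\<lambda>u. f u v w)) \<and> (\<forall>u w. linear (\<lambda>v. f u v w)) \<and>
     (\<forall>u v. linear (\<lambda>w. f u v w))"

definition alternating3 :: "('a \<Rightarrow> 'a \<Rightarrow> 'a \<Rightarrow> real) \<Rightarrow> bool" where
  "alternating3 f \<longleftrightarrow> (\<forall>u v w. f v u w = - f u v w \<and> f u w v = - f u v w)"

lemma alternating3D:
  assumes "alternating3 f"
  shows "f v u w = - f u v w" "f u w v = - f u v w"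
  using assms unfolding alternating3_def by blast+

lemma alternating3I:
  assumes "\<And>u v w. f v u w = - f u v w" "\<And>u v w. f u w v = - f u v w"
  shows "alternating3 f"
  unfolding alternating3_def by (intro allI conjI assms)

lemma trilinear_add: "trilinear f \<Longrightarrow> trilinear g \<Longrightarrow> trilinear (\<lambda>u v w. f u v w + g u v w)"
  by (simp add: trilinear_def linear_iff algebra_simps)

lemma trilinear_scale: "trilinear f \<Longrightarrow> trilinear (\<lambda>u v w. c * f u v w)"
  by (simp add: trilinear_def linear_iff algebra_simps)

lemma trilinear_compose:
  "trilinear f \<Longrightarrow> linear B \<Longrightarrow> trilinear (\<lambda>u v w. f (B u) (B v) (B w))"
  by (simp add: trilinear_def linear_iff)

lemma alternating3_add:
  assumes "alternating3 f" "alternating3 g"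
  shows "alternating3 (\<lambda>u v w. f u v w + g u v w)"
proof (rule alternating3I)
  fix u v w
  show "f v u w + g v u w = - (f u v w + g u v w)" "f u w v + g u w v = - (f u v w + g u v w)"
    using alternating3D[OF assms(1), of v u w] alternating3D[OF assms(2), of v u w]
      alternating3D[OF assms(1), of u w v] alternating3D[OF assms(2), of u w v] by linarith+
qed

lemma alternating3_scale:
  assumes "alternating3 f"
  shows "alternating3 (\<lambda>u v w. c * f u v w)"
proof (rule alternating3I)
  fix u v w
  show "c * f v u w = - (c * f u v w)"
    by (simp only: alternating3D(1)[OF assms, of v u w] mult_minus_right)
  show "c * f u w v = - (c * f u v w)"
    by (simp only: alternating3D(2)[OF assms, of u w v] mult_minus_right)
qed

lemma alternating3_compose:
  "alternating3 f \<Longrightarrow> alternating3 (\<lambda>u v w. f (B u) (B v) (B w))"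
  by (rule alternating3I) (rule alternating3D; assumption)+

lemma L2_set_abs_scale: "L2_set (\<lambda>x. c * f x) A = \<bar>c\<bar> * L2_set f A"
proof -
  have "(\<Sum>x\<in>A. (c * f x)\<^sup>2) = c\<^sup>2 * (\<Sum>x\<in>A. (f x)\<^sup>2)"
    by (simp only: power_mult_distrib sum_distrib_left)
  then show ?thesis
    by (simp only: L2_set_def real_sqrt_mult real_sqrt_abs)
qed

typedef (overloaded) ('a::euclidean_space) alt3 =
  "{f :: 'a \<Rightarrow> 'a \<Rightarrow> 'a \<Rightarrow> real. trilinear f \<and> alternating3 f}"
  morphisms alt3_apply Alt3
  by (rule exI[of _ "\<lambda>_ _ _. 0"])
    (simp add: trilinear_def alternating3_def linear_iff)

setup_lifting type_definition_alt3

text \<open>The norm below is auxiliary: the space is finite-dimensional, so open sets, derivatives and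
  smoothness do not depend on it.\<close>

instantiation alt3 :: (euclidean_space) real_normed_vector
begin

lift_definition zero_alt3 :: "'a alt3" is "\<lambda>_ _ _. 0"
  by (simp add: trilinear_def alternating3_def linear_iff)

lift_definition plus_alt3 :: "'a alt3 \<Rightarrow> 'a alt3 \<Rightarrow> 'a alt3" is
  "\<lambda>f g u v w. f u v w + g u v w"
  by (simp add: trilinear_add alternating3_add)

lift_definition uminus_alt3 :: "'a alt3 \<Rightarrow> 'a alt3" is "\<lambda>f u v w. - f u v w"
proof -
  fix f :: "'a \<Rightarrow> 'a \<Rightarrow> 'a \<Rightarrow> real"
  assume "trilinear f \<and> alternating3 f"
  then show "trilinear (\<lambda>u v w. - f u v w) \<and> alternating3 (\<lambda>u v w. - f u v w)"
    using trilinear_scale[of f "- 1"] alternating3_scale[of f "- 1"] by simp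
qed

lift_definition minus_alt3 :: "'a alt3 \<Rightarrow> 'a alt3 \<Rightarrow> 'a alt3" is
  "\<lambda>f g u v w. f u v w - g u v w"
proof -
  fix f g :: "'a \<Rightarrow> 'a \<Rightarrow> 'a \<Rightarrow> real"
  assume "trilinear f \<and> alternating3 f" "trilinear g \<and> alternating3 g"
  then show "trilinear (\<lambda>u v w. f u v w - g u v w) \<and> alternating3 (\<lambda>u v w. f u v w - g u v w)"
    using trilinear_add[of f "\<lambda>u v w. - 1 * g u v w"] trilinear_scale[of g "- 1"]
      alternating3_add[of f "\<lambda>u v w. - 1 * g u v w"] alternating3_scale[of g "- 1"] by simp
qed

lift_definition scaleR_alt3 :: "real \<Rightarrow> 'a alt3 \<Rightarrow> 'a alt3" is "\<lambda>c f u v w. c * f u v w"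
  by (simp add: trilinear_scale alternating3_scale)

definition norm_alt3 :: "'a alt3 \<Rightarrow> real" where
  "norm_alt3 \<theta> = L2_set (\<lambda>(u, v, w). alt3_apply \<theta> u v w) (Basis \<times> Basis \<times> Basis)"

definition sgn_alt3 :: "'a alt3 \<Rightarrow> 'a alt3" where
  "sgn_alt3 \<theta> = inverse (norm \<theta>) *\<^sub>R \<theta>"

definition dist_alt3 :: "'a alt3 \<Rightarrow> 'a alt3 \<Rightarrow> real" where
  "dist_alt3 \<theta> \<eta> = norm (\<theta> - \<eta>)"

definition uniformity_alt3 :: "('a alt3 \<times> 'a alt3) filter" where
  "uniformity_alt3 = (INF e\<in>{0<..}. principal {(x, y). dist x y < e})"

definition open_alt3 :: "'a alt3 set \<Rightarrow> bool" where
  "open_alt3 S = (\<forall>x\<in>S. \<forall>\<^sub>F (x', y) in uniformity. x' = x \<longrightarrow> y \<in> S)"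

lemma alt3_eq_0_if_Basis:
  fixes \<theta> :: "'a alt3"
  assumes "\<And>u v w. u \<in> Basis \<Longrightarrow> v \<in> Basis \<Longrightarrow> w \<in> Basis \<Longrightarrow> alt3_apply \<theta> u v w = 0"
  shows "\<theta> = 0"
proof -
  have lin: "linear (\<lambda>u. alt3_apply \<theta> u v w)" "linear (\<lambda>v. alt3_apply \<theta> u v w)"
    "linear (\<lambda>w. alt3_apply \<theta> u v w)" for u v w
    using alt3_apply[of \<theta>] by (simp_all add: trilinear_def)
  have zero: "linear (\<lambda>_::'a. 0::real)"
    by (simp add: linear_iff)
  have 1: "alt3_apply \<theta> u v w = 0" if "u \<in> Basis" "v \<in> Basis" for u v w
    by (rule fun_cong[OF linear_eq_stdbasis[OF lin(3) zero]]) (simp add: assms that)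
  have 2: "alt3_apply \<theta> u v w = 0" if "u \<in> Basis" for u v w
    by (rule fun_cong[OF linear_eq_stdbasis[OF lin(2) zero]]) (simp add: 1 that)
  have "alt3_apply \<theta> u v w = 0" for u v w
    by (rule fun_cong[OF linear_eq_stdbasis[OF lin(1) zero]]) (simp add: 2)
  then show ?thesis
    by (simp add: zero_alt3.rep_eq fun_eq_iff flip: alt3_apply_inject)
qed

instance
proof
  fix x y z :: "'a alt3" and a b :: real and U :: "'a alt3 set"
  show "x + y + z = x + (y + z)" "x + y = y + x" "0 + x = x" "- x + x = 0" "x - y = x + - y"
    by (transfer; simp add: algebra_simps)+
  show "a *\<^sub>R (x + y) = a *\<^sub>R x + a *\<^sub>R y" "(a + b) *\<^sub>R x = a *\<^sub>R x + b *\<^sub>R x"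
    "a *\<^sub>R b *\<^sub>R x = (a * b) *\<^sub>R x" "1 *\<^sub>R x = x"
    by (transfer; simp add: algebra_simps)+
  show "sgn x = inverse (norm x) *\<^sub>R x" "dist x y = norm (x - y)"
    "(uniformity :: ('a alt3 \<times> 'a alt3) filter) = (INF e\<in>{0<..}. principal {(x, y). dist x y < e})"
    "open U = (\<forall>x\<in>U. \<forall>\<^sub>F (x', y) in uniformity. x' = x \<longrightarrow> y \<in> U)"
    by (rule sgn_alt3_def dist_alt3_def uniformity_alt3_def open_alt3_def)+
  have fin: "finite (Basis \<times> Basis \<times> Basis :: ('a \<times> 'a \<times> 'a) set)"
    by simp
  show "norm x = 0 \<longleftrightarrow> x = 0"
  proof
    assume "norm x = 0"
    then have "\<forall>t\<in>Basis \<times> Basis \<times> Basis. (\<lambda>(u, v, w). alt3_apply x u v w) t = 0"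
      using L2_set_eq_0_iff[OF fin] unfolding norm_alt3_def by blast
    then show "x = 0"
      by (intro alt3_eq_0_if_Basis) auto
  next
    assume "x = 0"
    then show "norm x = 0"
      by (simp add: norm_alt3_def zero_alt3.rep_eq L2_set_eq_0_iff[OF fin])
  qed
  show "norm (x + y) \<le> norm x + norm y"
    using L2_set_triangle_ineq[of "\<lambda>(u, v, w). alt3_apply x u v w" "\<lambda>(u, v, w). alt3_apply y u v w"]
    by (simp add: norm_alt3_def plus_alt3.rep_eq case_prod_unfold)
  have "(\<lambda>(u, v, w). alt3_apply (a *\<^sub>R x) u v w) = (\<lambda>t. a * (case t of (u, v, w) \<Rightarrow> alt3_apply x u v w))"
    by (simp add: fun_eq_iff scaleR_alt3.rep_eq)
  then show "norm (a *\<^sub>R x) = \<bar>a\<bar> * norm x"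
    by (simp add: norm_alt3_def L2_set_abs_scale)
qed

end


subsection \<open>The action of the symplectic group\<close>

definition symplectic_form :: "('a::real_vector \<Rightarrow> 'a \<Rightarrow> real) \<Rightarrow> bool" where
  "symplectic_form \<Omega> \<longleftrightarrow> (\<forall>v. linear (\<lambda>u. \<Omega> u v)) \<and> (\<forall>u. linear (\<lambda>v. \<Omega> u v)) \<and>
     (\<forall>u v. \<Omega> v u = - \<Omega> u v) \<and> (\<forall>u. (\<forall>v. \<Omega> u v = 0) \<longrightarrow> u = 0)"

definition GL :: "('a::euclidean_space \<Rightarrow>\<^sub>L 'a) set" where
  "GL = {A. bij (blinfun_apply A)}"

definition Sp :: "('a::euclidean_space \<Rightarrow> 'a \<Rightarrow> real) \<Rightarrow> ('a \<Rightarrow>\<^sub>L 'a) set" where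
  "Sp \<Omega> = {A \<in> GL. \<forall>u v. \<Omega> (A u) (A v) = \<Omega> u v}"

text \<open>Pull-back along the inverse; meaningful only for \<^term>\<open>A \<in> GL\<close>.\<close>

definition act :: "('a::euclidean_space \<Rightarrow>\<^sub>L 'a) \<Rightarrow> 'a alt3 \<Rightarrow> 'a alt3" where
  "act A \<theta> = Alt3 (\<lambda>u v w. alt3_apply \<theta> (inv (blinfun_apply A) u)
     (inv (blinfun_apply A) v) (inv (blinfun_apply A) w))"

lemma alt3_apply_act:
  assumes "A \<in> GL"
  shows "alt3_apply (act A \<theta>) u v w = alt3_apply \<theta> (inv (blinfun_apply A) u)
     (inv (blinfun_apply A) v) (inv (blinfun_apply A) w)"
proof -
  define B where "B = inv (blinfun_apply A)"
  have bij: "bij (blinfun_apply A)"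
    using assms by (simp add: GL_def)
  then have AB: "A (B x) = x" for x
    by (simp add: B_def bij_is_surj surj_f_inv_f)
  have eq: "B x = y" if "A y = x" for x y
    using that bij by (simp add: B_def bij_is_inj inv_f_eq)
  have "linear B"
    by (intro linearI eq) (simp_all add: blinfun.add_right blinfun.scaleR_right AB)
  then have "trilinear (\<lambda>u v w. alt3_apply \<theta> (B u) (B v) (B w)) \<and>
      alternating3 (\<lambda>u v w. alt3_apply \<theta> (B u) (B v) (B w))"
    using alt3_apply[of \<theta>] by (simp add: trilinear_compose alternating3_compose)
  then show ?thesis
    by (simp add: act_def Alt3_inverse flip: B_def)
qed

text \<open>The image of the differential at the identity of the orbit map \<open>U \<mapsto> act U \<theta>\<close> on
  \<^term>\<open>Sp \<Omega>\<close>: tangent vectors of the group at the identity are velocities of smooth curves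
  in the group, and the differential maps the velocity of \<^term>\<open>\<gamma>\<close> to that of the image curve.
  The tangent space of the vector space of 3-forms at \<^term>\<open>\<theta>\<close> is that space itself.\<close>

definition orbit_tangent :: "('a::euclidean_space \<Rightarrow> 'a \<Rightarrow> real) \<Rightarrow> 'a alt3 \<Rightarrow> 'a alt3 set" where
  "orbit_tangent \<Omega> \<theta> = {\<eta>. \<exists>\<gamma> :: real \<Rightarrow> 'a \<Rightarrow>\<^sub>L 'a.
     (\<forall>t. \<gamma> t \<in> Sp \<Omega>) \<and> smooth_on UNIV \<gamma> \<and> \<gamma> 0 = id_blinfun \<and>
     ((\<lambda>t. act (\<gamma> t) \<theta>) has_vector_derivative \<eta>) (at 0)}"

definition regular_set :: "('a::euclidean_space \<Rightarrow> 'a \<Rightarrow> real) \<Rightarrow> 'a alt3 set" where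
  "regular_set \<Omega> = {\<theta>. \<exists>N. open N \<and> \<theta> \<in> N \<and>
     (\<forall>\<theta>'\<in>N. dim (orbit_tangent \<Omega> \<theta>') \<le> dim (orbit_tangent \<Omega> \<theta>))}"


subsection \<open>Functionally independent invariants\<close>

text \<open>Functions on \<^term>\<open>regular_set \<Omega>\<close> are represented by total functions, whose values outside
  that set play no role: the set is open and stable under the action.\<close>

definition Sp_invariant :: "('a::euclidean_space \<Rightarrow> 'a \<Rightarrow> real) \<Rightarrow> ('a alt3 \<Rightarrow> real) \<Rightarrow> bool" where
  "Sp_invariant \<Omega> I \<longleftrightarrow> (\<forall>A\<in>Sp \<Omega>. \<forall>\<theta>\<in>regular_set \<Omega>. I (act A \<theta>) = I \<theta>)"

text \<open>Independence of the family \<open>I 0, \<dots>, I (k - 1)\<close> of functions that are differentiable on the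
  open set \<^term>\<open>S\<close>.\<close>

definition functionally_independent ::
    "'a::real_normed_vector set \<Rightarrow> nat \<Rightarrow> (nat \<Rightarrow> 'a \<Rightarrow> real) \<Rightarrow> bool" where
  "functionally_independent S k I \<longleftrightarrow> (\<exists>U. open U \<and> U \<subseteq> S \<and> S \<subseteq> closure U \<and>
     (\<forall>x\<in>U. \<forall>c :: nat \<Rightarrow> real.
        (\<forall>v. (\<Sum>i<k. c i * frechet_derivative (I i) (at x) v) = 0) \<longrightarrow> (\<forall>i<k. c i = 0)))"

definition invariant_counts :: "('a::euclidean_space \<Rightarrow> 'a \<Rightarrow> real) \<Rightarrow> nat set" where
  "invariant_counts \<Omega> = {k. \<exists>I. (\<forall>i<k. smooth_on (regular_set \<Omega>) (I i) \<and> Sp_invariant \<Omega> (I i)) \<and>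
     functionally_independent (regular_set \<Omega>) k I}"

text \<open>\<^const>\<open>Max\<close> is meaningful only for a finite set; \<open>0\<close> always belongs to the set.\<close>

definition num_invariants :: "('a::euclidean_space \<Rightarrow> 'a \<Rightarrow> real) \<Rightarrow> nat" where
  "num_invariants \<Omega> = Max (invariant_counts \<Omega>)"

end

theory Submission
  imports Defs
begin

text \<open>
  The number of independent invariants is the codimension of the generic orbit, and both inequalities
  between these numbers come from finitely many explicit objects.

  \<^emph>\<open>Upper bound.\<close> The differential of an invariant kills the directions tangent to the orbits.
  If \<open>m\<close> elements of the Lie algebra give independent tangent directions at one 3-form, then they do so
  on a dense open set, because independence is the nonvanishing of a polynomial. Hence
  \<open>k + m \<le> dim \<and>\<^sup>3 V* = (2n choose 3)\<close> for every family of \<open>k\<close> independent invariants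
  (\<open>invariant_counts_upper\<close>). The Lie algebra is spanned by symmetric products of basis vectors, so
  its dimension is \<open>n (2n + 1)\<close>; a product \<open>a a\<close> generates a one-parameter group of transvections, which
  is affine in the parameter and therefore replaces the exponential map.

  \<^emph>\<open>Lower bound.\<close> Polynomial invariants whose differentials are independent at a single 3-form have
  independent differentials on a dense open set (\<open>invariant_counts_lower\<close>). Enough of them exist as soon
  as there are polynomial equivariant maps \<open>f\<^sub>0, \<dots>, f\<^sub>2\<^sub>n\<^sub>-\<^sub>1\<close> from 3-forms to \<open>V\<close> whose values at
  some \<open>\<theta>\<close> form a basis of \<open>V\<close>. Consider the invariants
  \<open>\<Omega> (f\<^sub>i \<theta>) (f\<^sub>j \<theta>)\<close> and \<open>\<theta> (f\<^sub>i \<theta>) (f\<^sub>j \<theta>) (f\<^sub>k \<theta>)\<close>. If all their differentials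
  vanish on a direction \<open>\<eta>\<close>, let \<open>A\<close> be the linear map that sends each \<open>f\<^sub>i \<theta>\<close> to its derivative in
  direction \<open>\<eta>\<close>. The first family says that \<open>A\<close> lies in the Lie algebra, the second that \<open>\<eta>\<close> is
  the infinitesimal action of \<open>A\<close> on \<open>\<theta>\<close>. So the common kernel consists of orbit directions, and
  the differentials have rank at least the codimension of the orbit (\<open>frame_invariants_kernel\<close>,
  \<open>frame_lower\<close>). The same frame shows that no nonzero element of the Lie algebra annihilates \<open>\<theta>\<close>
  (\<open>frame_upper\<close>).

  \<^emph>\<open>The frame.\<close> Contracting \<open>\<theta>\<close> with \<open>\<Omega>\<close> gives a vector \<open>v\<close>, and subtracting a suitable
  multiple of \<open>\<Omega> \<and> \<Omega> v\<close> from \<open>\<theta>\<close> gives its primitive part. Contracting two copies of the primitive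
  part in two slots gives a symmetric bilinear form, hence an endomorphism \<open>Q\<close>; take
  \<open>f\<^sub>i = Q\<^sup>i v\<close>. For \<open>n \<ge> 4\<close> the primitive form
  \<open>\<Sum>\<^sub>i \<mu>\<^sub>i p\<^sub>i \<and> p\<^sub>i\<^sub>+\<^sub>1 \<and> q\<^sub>i\<^sub>+\<^sub>2 + q\<^sub>i \<and> q\<^sub>i\<^sub>+\<^sub>1 \<and> p\<^sub>i\<^sub>+\<^sub>2\<close>, written with the covectors
  of a symplectic basis, has a diagonal \<open>Q\<close>, and \<open>\<mu>\<^sub>i = 4\<^sup>i\<close> makes all \<open>2n\<close> eigenvalues distinct.
  Adding \<open>\<Omega> \<and> \<Omega> a\<close> with all coordinates of \<open>a\<close> nonzero makes \<open>v\<close> a cyclic vector.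

  \<^emph>\<open>Small cases.\<close> For \<open>n = 3\<close> the sum above has a single term. With \<open>a = p\<^sub>0 + q\<^sub>0\<close> the
  resulting form has a stabiliser of dimension at most three in the 21-dimensional Lie algebra, so there are
  at most \<open>20 - 18 = 2\<close> invariants, and \<open>\<Omega> v (Q v)\<close> and \<open>\<Omega> v (Q\<^sup>3 v)\<close> are independent.
  For \<open>n = 2\<close> some orbit is open, and for \<open>n = 1\<close> there are no nonzero 3-forms.
\<close>

section \<open>Finite families of vectors and functionals\<close>

text \<open>Families rather than sets, so that a repeated member makes a family dependent.\<close>

definition independent_family :: "nat \<Rightarrow> (nat \<Rightarrow> 'w::real_vector) \<Rightarrow> bool" where
  "independent_family k w \<longleftrightarrow> (\<forall>c. (\<Sum>i<k. c i *\<^sub>R w i) = 0 \<longrightarrow> (\<forall>i<k. c i = 0))"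

lemma independent_familyD:
  "independent_family k w \<Longrightarrow> (\<Sum>i<k. c i *\<^sub>R w i) = 0 \<Longrightarrow> i < k \<Longrightarrow> c i = 0"
  unfolding independent_family_def by blast

lemma independent_family_image:
  assumes "independent_family k w"
  shows "inj_on w {..<k}" "independent (w ` {..<k})"
proof -
  show inj: "inj_on w {..<k}"
  proof (rule inj_onI, rule ccontr)
    fix i j assume ij: "i \<in> {..<k}" "j \<in> {..<k}" "w i = w j" "i \<noteq> j"
    define c :: "nat \<Rightarrow> real" where "c l = (if l = i then 1 else 0) - (if l = j then 1 else 0)" for l
    have "(\<Sum>l<k. c l *\<^sub>R w l) = w i - w j"
      using ij by (simp add: c_def scaleR_diff_left sum_subtractf if_distrib[of "\<lambda>x. x *\<^sub>R _"] cong: if_cong)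
    then have "c i = 0" using independent_familyD[OF assms, of c i] ij by simp
    then show False using ij by (simp add: c_def)
  qed
  show "independent (w ` {..<k})"
  proof (rule independent_if_scalars_zero)
    fix f x assume s: "(\<Sum>x\<in>w ` {..<k}. f x *\<^sub>R x) = 0" and x: "x \<in> w ` {..<k}"
    then obtain i where i: "i < k" "x = w i" by auto
    have "(\<Sum>i<k. f (w i) *\<^sub>R w i) = 0" using s by (simp add: sum.reindex[OF inj])
    from independent_familyD[OF assms this i(1)] show "f x = 0" using i by simp
  qed simp
qed

lemma independent_family_le_card:
  assumes "independent_family k w" "finite T" "\<And>i. i < k \<Longrightarrow> w i \<in> span T"
  shows "k \<le> card T"
  using independent_span_bound[OF assms(2) independent_family_image(2)[OF assms(1)]]
    card_image[OF independent_family_image(1)[OF assms(1)]] assms(3) by auto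

lemma independent_family_in_basis:
  fixes S T :: "'w::real_vector set"
  assumes T: "finite T" "span T = UNIV"
  shows "\<exists>w. independent_family (dim S) w \<and> (\<forall>i<dim S. w i \<in> S)"
proof -
  obtain B where B: "B \<subseteq> S" "independent B" "S \<subseteq> span B" "card B = dim S"
    using basis_exists[of S] by blast
  have "finite B" using independent_span_bound[of T B] T B(2) by auto
  then obtain w where w: "bij_betw w {..<dim S} B"
    using B(4) by (metis atLeast0LessThan ex_bij_betw_nat_finite)
  have "independent_family (dim S) w"
    unfolding independent_family_def
  proof (intro allI impI)
    fix c :: "nat \<Rightarrow> real" and i
    assume s: "(\<Sum>i<dim S. c i *\<^sub>R w i) = 0" and i: "i < dim S"
    define g where "g = inv_into {..<dim S} w"
    have g: "g (w j) = j" if "j < dim S" for j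
      using w that by (simp add: g_def bij_betw_def inv_into_f_f)
    have "(\<Sum>b\<in>B. c (g b) *\<^sub>R b) = (\<Sum>i<dim S. c i *\<^sub>R w i)"
      using sum.reindex_bij_betw[OF w, of "\<lambda>b. c (g b) *\<^sub>R b", symmetric] g by (auto intro: sum.cong)
    then have "c (g (w i)) = 0"
      using independentD[OF B(2) \<open>finite B\<close>, of "\<lambda>b. c (g b)" "w i"] s w i
      by (auto simp: bij_betw_def)
    then show "c i = 0" using g[OF i] by simp
  qed
  moreover have "\<forall>i<dim S. w i \<in> S"
    using w B(1) by (auto simp: bij_betw_def)
  ultimately show ?thesis by blast
qed

lemma independent_family_le_dim:
  fixes S T :: "'w::real_vector set"
  assumes T: "finite T" "span T = UNIV" and w: "independent_family k w" "\<And>i. i < k \<Longrightarrow> w i \<in> S"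
  shows "k \<le> dim S"
proof -
  obtain B where B: "B \<subseteq> S" "independent B" "S \<subseteq> span B" "card B = dim S"
    using basis_exists[of S] by blast
  have "finite B" using independent_span_bound[of T B] T B(2) by auto
  then show ?thesis using independent_family_le_card[OF w(1), of B] w(2) B by auto
qed

text \<open>A functional is selected exactly when it does not vanish on the common kernel of those selected
  before it. A vector on which it does not vanish, but they do, is normalised to be its dual vector and
  used to correct the earlier dual vectors.\<close>

lemma dual_vectors:
  fixes \<phi> :: "'i \<Rightarrow> 'w::real_vector \<Rightarrow> real"
  assumes "finite F" "\<And>i. i \<in> F \<Longrightarrow> linear (\<phi> i)"
  shows "\<exists>B \<psi>. B \<subseteq> F \<and> (\<forall>i\<in>B. \<forall>j\<in>B. \<phi> i (\<psi> j) = (if i = j then 1 else 0)) \<and>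
     (\<forall>x. (\<forall>i\<in>B. \<phi> i x = 0) \<longrightarrow> (\<forall>i\<in>F. \<phi> i x = 0))"
  using assms
proof (induction F rule: finite_induct)
  case empty
  then show ?case by auto
next
  case (insert a F)
  have "\<exists>B \<psi>. B \<subseteq> F \<and> (\<forall>i\<in>B. \<forall>j\<in>B. \<phi> i (\<psi> j) = (if i = j then 1 else 0)) \<and>
     (\<forall>x. (\<forall>i\<in>B. \<phi> i x = 0) \<longrightarrow> (\<forall>i\<in>F. \<phi> i x = 0))"
    by (rule insert.IH) (rule insert.prems, simp)
  then obtain B \<psi> where B: "B \<subseteq> F"
    "\<forall>i\<in>B. \<forall>j\<in>B. \<phi> i (\<psi> j) = (if i = j then 1 else 0)"
    "\<forall>x. (\<forall>i\<in>B. \<phi> i x = 0) \<longrightarrow> (\<forall>i\<in>F. \<phi> i x = 0)"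
    by (elim exE conjE)
  show ?case
  proof (cases "\<forall>x. (\<forall>i\<in>B. \<phi> i x = 0) \<longrightarrow> \<phi> a x = 0")
    case True
    then show ?thesis
      using B by (intro exI[of _ B] exI[of _ \<psi>]) auto
  next
    case False
    then obtain x where x: "\<And>i. i \<in> B \<Longrightarrow> \<phi> i x = 0" "\<phi> a x \<noteq> 0" by blast
    have lin: "linear (\<phi> i)" if "i \<in> insert a B" for i
      using insert.prems B(1) that by auto
    have aB: "a \<notin> B" using insert.hyps B(1) by auto
    define \<psi>' where "\<psi>' j = (if j = a then (1 / \<phi> a x) *\<^sub>R x else \<psi> j - (\<phi> a (\<psi> j) / \<phi> a x) *\<^sub>R x)" for j
    have "\<phi> i (\<psi>' j) = (if i = j then 1 else 0)" if ij: "i \<in> insert a B" "j \<in> insert a B" for i j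
    proof -
      have "i = a \<or> i \<in> B" "j = a \<or> j \<in> B" using ij by auto
      then show ?thesis
        using x B(2) aB
        by (auto simp: \<psi>'_def linear_diff[OF lin] linear_scale[OF lin])
    qed
    moreover have "\<phi> i y = 0" if "\<And>i. i \<in> insert a B \<Longrightarrow> \<phi> i y = 0" "i \<in> insert a F" for y i
      using that B(3) by auto
    ultimately show ?thesis
      using B(1) by (intro exI[of _ "insert a B"] exI[of _ \<psi>']) blast
  qed
qed

text \<open>Vectors dual to the functionals are independent modulo the common kernel, so together with
  independent members of that kernel they form an independent family.\<close>

lemma independent_functionals_kernel_bound:
  fixes \<phi> :: "nat \<Rightarrow> 'w::real_vector \<Rightarrow> real" and T :: "'w set"
  assumes lin: "\<And>i. i < k \<Longrightarrow> linear (\<phi> i)"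
    and ind: "\<And>c. (\<forall>v. (\<Sum>i<k. c i * \<phi> i v) = 0) \<Longrightarrow> \<forall>i<k. c i = 0"
    and w: "independent_family m w" "\<And>i j. i < k \<Longrightarrow> j < m \<Longrightarrow> \<phi> i (w j) = 0"
    and T: "finite T" "span T = UNIV"
  shows "k + m \<le> card T"
proof -
  have "\<exists>B \<psi>. B \<subseteq> {..<k} \<and> (\<forall>i\<in>B. \<forall>j\<in>B. \<phi> i (\<psi> j) = (if i = j then 1 else 0)) \<and>
     (\<forall>x. (\<forall>i\<in>B. \<phi> i x = 0) \<longrightarrow> (\<forall>i\<in>{..<k}. \<phi> i x = 0))"
    by (rule dual_vectors) (use lin in auto)
  then obtain B \<psi> where B: "B \<subseteq> {..<k}"
    "\<forall>i\<in>B. \<forall>j\<in>B. \<phi> i (\<psi> j) = (if i = j then 1 else 0)"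
    "\<forall>x. (\<forall>i\<in>B. \<phi> i x = 0) \<longrightarrow> (\<forall>i\<in>{..<k}. \<phi> i x = 0)"
    by (elim exE conjE)
  have fB: "finite B" using B(1) finite_subset by blast
  have Bk: "B = {..<k}"
  proof (rule ccontr)
    assume "B \<noteq> {..<k}"
    then obtain a where a: "a < k" "a \<notin> B" using B(1) by auto
    (* Modulo the common kernel of B, a vector is recovered from the dual vectors. *)
    define c where "c i = (if i = a then 1 else if i \<in> B then - \<phi> a (\<psi> i) else 0)" for i
    have "(\<Sum>i<k. c i * \<phi> i v) = 0" for v
    proof -
      define y where "y = v - (\<Sum>j\<in>B. \<phi> j v *\<^sub>R \<psi> j)"
      have \<phi>y: "\<phi> i y = \<phi> i v - (\<Sum>j\<in>B. \<phi> j v * \<phi> i (\<psi> j))" if "i < k" for i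
        using lin[OF that] by (simp add: y_def linear_diff linear_sum linear_scale)
      have "\<phi> i y = 0" if "i \<in> B" for i
      proof -
        have "(\<Sum>j\<in>B. \<phi> j v * \<phi> i (\<psi> j)) = (\<Sum>j\<in>B. if i = j then \<phi> j v else 0)"
          by (rule sum.cong) (auto simp: B(2) that)
        then show ?thesis using \<phi>y[of i] that B(1) fB by auto
      qed
      then have "\<phi> a y = 0" using B(3) a by auto
      then have *: "\<phi> a v = (\<Sum>j\<in>B. \<phi> j v * \<phi> a (\<psi> j))" using \<phi>y[OF a(1)] by simp
      have "(\<Sum>i<k. c i * \<phi> i v) = (\<Sum>i\<in>insert a B. c i * \<phi> i v)"
        by (rule sum.mono_neutral_right) (use B(1) a in \<open>auto simp: c_def\<close>)
      also have "\<dots> = \<phi> a v + (\<Sum>i\<in>B. c i * \<phi> i v)"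
        using a fB by (simp add: c_def)
      also have "(\<Sum>i\<in>B. c i * \<phi> i v) = - (\<Sum>j\<in>B. \<phi> j v * \<phi> a (\<psi> j))"
        unfolding sum_negf[symmetric] by (rule sum.cong) (use a in \<open>auto simp: c_def\<close>)
      finally show ?thesis using * by simp
    qed
    then have "c a = 0" using ind a by blast
    then show False by (simp add: c_def)
  qed
  define z where "z i = (if i < k then \<psi> i else w (i - k))" for i
  have "independent_family (k + m) z"
    unfolding independent_family_def
  proof (intro allI impI)
    fix c i assume s0: "(\<Sum>i<k + m. c i *\<^sub>R z i) = 0" and i: "i < k + m"
    have split: "(\<Sum>i<k + m. g i) = (\<Sum>i<k. g i) + (\<Sum>j<m. g (k + j))" for g :: "nat \<Rightarrow> 'w"
      by (induction m) (simp_all add: add.assoc)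
    have s: "(\<Sum>i<k. c i *\<^sub>R \<psi> i) + (\<Sum>j<m. c (k + j) *\<^sub>R w j) = 0"
      using s0 unfolding split by (simp add: z_def)
    have ck: "c l = 0" if l: "l < k" for l
    proof -
      have "\<phi> l ((\<Sum>i<k. c i *\<^sub>R \<psi> i) + (\<Sum>j<m. c (k + j) *\<^sub>R w j)) = 0"
        using s linear_0[OF lin[OF l]] by simp
      moreover have "(\<Sum>i<k. c i * \<phi> l (\<psi> i)) = (\<Sum>i<k. if l = i then c i else 0)"
        by (rule sum.cong) (use B(2) Bk l in auto)
      ultimately show ?thesis
        using l w(2) by (simp add: linear_add[OF lin[OF l]] linear_sum[OF lin[OF l]] linear_scale[OF lin[OF l]])
    qed
    then have "(\<Sum>j<m. c (k + j) *\<^sub>R w j) = 0" using s by simp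
    from independent_familyD[OF w(1) this] have "c (k + j) = 0" if "j < m" for j
      using that by simp
    then show "c i = 0"
    proof (cases "i < k")
      case False
      then show ?thesis using i \<open>\<And>j. j < m \<Longrightarrow> c (k + j) = 0\<close>[of "i - k"] by simp
    qed (use ck in auto)
  qed
  then show ?thesis
    using independent_family_le_card[of "k + m" z T] T by auto
qed

section \<open>Polynomial functions\<close>

lemma real_polynomial_function_has_derivative:
  fixes f :: "'w::real_normed_vector \<Rightarrow> real"
  assumes "real_polynomial_function f"
  shows "\<exists>f'. (\<forall>v. real_polynomial_function (\<lambda>x. f' x v)) \<and> (\<forall>x. (f has_derivative f' x) (at x))"
  using assms
proof induction
  case (linear f)
  then show ?case
    by (intro exI[of _ "\<lambda>x. f"]) (auto intro: bounded_linear_imp_has_derivative)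
next
  case (const c)
  show ?case by (intro exI[of _ "\<lambda>x v. 0"]) auto
next
  case (add f g)
  then obtain f' g' where "\<And>v. real_polynomial_function (\<lambda>x. f' x v)" "\<And>x. (f has_derivative f' x) (at x)"
    "\<And>v. real_polynomial_function (\<lambda>x. g' x v)" "\<And>x. (g has_derivative g' x) (at x)" by blast
  then show ?case
    by (intro exI[of _ "\<lambda>x v. f' x v + g' x v"]) (auto intro: has_derivative_add)
next
  case (mult f g)
  then obtain f' g' where "\<And>v. real_polynomial_function (\<lambda>x. f' x v)" "\<And>x. (f has_derivative f' x) (at x)"
    "\<And>v. real_polynomial_function (\<lambda>x. g' x v)" "\<And>x. (g has_derivative g' x) (at x)" by blast
  then show ?case
    using mult.hyps
    by (intro exI[of _ "\<lambda>x v. f x * g' x v + f' x v * g x"])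
      (intro conjI allI has_derivative_mult real_polynomial_function.intros(3)
        real_polynomial_function.intros(4); simp)
qed

lemma
  fixes f :: "'w::real_normed_vector \<Rightarrow> real"
  assumes "real_polynomial_function f"
  shows real_polynomial_function_differentiable: "f differentiable (at x)"
    and real_polynomial_function_frechet: "real_polynomial_function (\<lambda>x. frechet_derivative f (at x) v)"
proof -
  obtain f' where f': "\<And>v. real_polynomial_function (\<lambda>x. f' x v)" "\<And>x. (f has_derivative f' x) (at x)"
    using real_polynomial_function_has_derivative[OF assms] by blast
  show "f differentiable (at x)" using f'(2) by (auto simp: differentiable_def)
  have "frechet_derivative f (at x) = f' x" for x using frechet_derivative_at[OF f'(2)] by simp
  then show "real_polynomial_function (\<lambda>x. frechet_derivative f (at x) v)" using f'(1) by simp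
qed

text \<open>Directional derivatives of polynomial functions are polynomial, so all orders of
  differentiability follow by induction.\<close>

lemma smooth_on_real_polynomial_function:
  fixes f :: "'w::real_normed_vector \<Rightarrow> real"
  assumes "real_polynomial_function f"
  shows "smooth_on S f"
proof -
  have "Ck_on k S f" for k
    using assms
  proof (induction k arbitrary: f)
    case 0
    then show ?case
      by (simp add: continuous_at_imp_continuous_on continuous_real_polymonial_function)
  next
    case (Suc k)
    then show ?case
      by (simp add: real_polynomial_function_differentiable real_polynomial_function_frechet)
  qed
  then show ?thesis by (simp add: smooth_on_def)
qed

text \<open>On the segment from an arbitrary point to \<^term>\<open>x0\<close> the function is a polynomial in one variable
  that does not vanish at the far end, so its finitely many zeros do not accumulate at the near end.\<close>

lemma real_polynomial_function_nonzero_dense: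
  fixes D :: "'w::real_normed_vector \<Rightarrow> real"
  assumes D: "real_polynomial_function D" "D x0 \<noteq> 0"
  shows "open {x. D x \<noteq> 0}" "closure {x. D x \<noteq> 0} = UNIV"
proof -
  have "continuous_on UNIV D"
    by (simp add: D(1) continuous_at_imp_continuous_on continuous_real_polymonial_function)
  then show "open {x. D x \<noteq> 0}"
    by (intro open_Collect_neq) auto
  have "x \<in> closure {x. D x \<noteq> 0}" for x
    unfolding closure_approachable
  proof (intro allI impI)
    fix r :: real assume r: "r > 0"
    define l where "l = (\<lambda>t::real. x + t *\<^sub>R (x0 - x))"
    have "polynomial_function l"
      unfolding l_def
      by (intro polynomial_function_add polynomial_function_const polynomial_function_mult polynomial_function_id)
    from real_polynomial_function_compose[OF this D(1)]
    obtain a N where aN: "\<And>t. D (l t) = (\<Sum>i\<le>N. a i * t ^ i)"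
      unfolding real_polynomial_function_iff_sum o_def by metis
    have "\<exists>i\<le>N. a i \<noteq> 0"
    proof (rule ccontr)
      assume "\<not> (\<exists>i\<le>N. a i \<noteq> 0)"
      then have "D (l 1) = 0" by (simp add: aN)
      then show False using D(2) by (simp add: l_def)
    qed
    then have "finite {t. (\<Sum>i\<le>N. a i * t ^ i) = 0}" by (rule polyfun_rootbound_finite[of N a] ; blast)
    define \<delta> where "\<delta> = r / (norm (x0 - x) + 1)"
    have \<delta>: "\<delta> > 0" using r by (simp add: \<delta>_def add_nonneg_pos)
    have "infinite {0<..<\<delta>}" using \<delta> by (simp add: infinite_Ioo)
    then have "\<not> {0<..<\<delta>} \<subseteq> {t. (\<Sum>i\<le>N. a i * t ^ i) = 0}"
      using \<open>finite {t. (\<Sum>i\<le>N. a i * t ^ i) = 0}\<close> finite_subset by blast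
    then obtain t where t: "t \<in> {0<..<\<delta>}" "D (l t) \<noteq> 0"
      unfolding aN by blast
    have "dist (l t) x = t * norm (x0 - x)" using t by (simp add: l_def dist_norm)
    also have "\<dots> \<le> t * (norm (x0 - x) + 1)" using t by (simp add: mult_left_mono)
    also have "\<dots> < \<delta> * (norm (x0 - x) + 1)" using t by (intro mult_strict_right_mono) (auto intro: add_nonneg_pos)
    also have "\<dots> = r" by (simp add: \<delta>_def add_nonneg_eq_0_iff)
    finally show "\<exists>y\<in>{x. D x \<noteq> 0}. dist y x < r" using t(2) by blast
  qed
  then show "closure {x. D x \<noteq> 0} = UNIV" by blast
qed

text \<open>Independence of polynomial rows at one point is certified by a single polynomial: fraction-free
  elimination of one row at a time, whose pivots are nonzero at that point, and the product of the
  pivots is the certificate. The rows may have arbitrarily many columns, for instance one for each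
  tangent vector.\<close>

lemma real_polynomial_rows_generically_independent:
  fixes M :: "nat \<Rightarrow> 'j \<Rightarrow> 'w::real_normed_vector \<Rightarrow> real"
  assumes "\<And>i j. i < k \<Longrightarrow> real_polynomial_function (M i j)"
    and "\<And>c. (\<forall>j. (\<Sum>i<k. c i * M i j x0) = 0) \<Longrightarrow> \<forall>i<k. c i = 0"
  shows "\<exists>D. real_polynomial_function D \<and> D x0 \<noteq> 0 \<and>
    (\<forall>x c. D x \<noteq> 0 \<longrightarrow> (\<forall>j. (\<Sum>i<k. c i * M i j x) = 0) \<longrightarrow> (\<forall>i<k. c i = 0))"
  using assms
proof (induction k arbitrary: M)
  case 0
  show ?case by (intro exI[of _ "\<lambda>_. 1"]) (auto intro: real_polynomial_function.intros)
next
  case (Suc k)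
  have "\<exists>j. M k j x0 \<noteq> 0"
  proof (rule ccontr)
    assume "\<not> ?thesis"
    then have "\<forall>j. (\<Sum>i<Suc k. (if i = k then 1 else 0) * M i j x0) = 0" by simp
    from Suc.prems(2)[OF this] show False by auto
  qed
  then obtain b where b: "M k b x0 \<noteq> 0" by blast
  (* Eliminate row k against its pivot column b; column b of the reduced matrix vanishes. *)
  define M' where "M' i j x = M k b x * M i j x - M i b x * M k j x" for i j x
  have poly: "real_polynomial_function (M' i j)" if "i < k" for i j
    unfolding M'_def using that Suc.prems(1) by (intro real_polynomial_function_diff real_polynomial_function.intros(4)) auto
  have red: "(\<Sum>i<k. c i * M' i j x) = M k b x * (\<Sum>i<k. c i * M i j x) - M k j x * (\<Sum>i<k. c i * M i b x)"
    for c j x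
    unfolding M'_def sum_distrib_left sum_subtractf[symmetric] by (rule sum.cong) (auto simp: algebra_simps)
  have nons: "\<forall>i<k. c i = 0" if c: "\<forall>j. (\<Sum>i<k. c i * M' i j x0) = 0" for c
  proof -
    define c' where "c' i = (if i = k then - (\<Sum>i<k. c i * M i b x0) else M k b x0 * c i)" for i
    have lower: "(\<Sum>i<k. c' i * M i j x0) = M k b x0 * (\<Sum>i<k. c i * M i j x0)" for j
      unfolding sum_distrib_left by (rule sum.cong) (auto simp: c'_def)
    have last: "c' k = - (\<Sum>i<k. c i * M i b x0)" by (simp add: c'_def)
    have eq: "(\<Sum>i<Suc k. c' i * M i j x0) = (\<Sum>i<k. c i * M' i j x0)" for j
      by (simp add: lower last red[of c j x0])
    have "\<forall>i<Suc k. c' i = 0"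
      by (rule Suc.prems(2)) (simp only: eq c simp_thms)
    then show ?thesis using b by (auto simp: c'_def less_Suc_eq split: if_splits)
  qed
  obtain D where D: "real_polynomial_function D" "D x0 \<noteq> 0"
    "\<And>x c. D x \<noteq> 0 \<Longrightarrow> (\<forall>j. (\<Sum>i<k. c i * M' i j x) = 0) \<Longrightarrow> (\<forall>i<k. c i = 0)"
    using Suc.IH[of M', OF poly nons] by blast
  show ?case
  proof (intro exI[of _ "\<lambda>x. D x * M k b x"] conjI allI impI)
    show "real_polynomial_function (\<lambda>x. D x * M k b x)" using D(1) Suc.prems(1) by blast
    show "D x0 * M k b x0 \<noteq> 0" using D(2) b by simp
    fix x c i
    assume x: "D x * M k b x \<noteq> 0" and c: "\<forall>j. (\<Sum>i<Suc k. c i * M i j x) = 0" and i: "i < Suc k"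
    have s: "(\<Sum>i<k. c i * M i j x) = - (c k * M k j x)" for j using c[rule_format, of j] by simp
    have "\<forall>j. (\<Sum>i<k. c i * M' i j x) = 0" by (simp add: red s)
    then have 0: "c i = 0" if "i < k" for i using D(3)[of x c] x that by auto
    then have "c k * M k b x = 0" using s[of b] by (simp add: 0)
    then show "c i = 0" using 0 i x by (auto simp: less_Suc_eq)
  qed
qed

lemma frechet_along_line:
  fixes I :: "'b::real_normed_vector \<Rightarrow> real"
  assumes d: "I differentiable (at (x + s *\<^sub>R v))"
    and l: "((\<lambda>s. I (x + s *\<^sub>R v)) has_real_derivative r) (at s)"
  shows "frechet_derivative I (at (x + s *\<^sub>R v)) v = r"
proof -
  let ?D = "frechet_derivative I (at (x + s *\<^sub>R v))"
  have "((\<lambda>s. x + s *\<^sub>R v) has_derivative (\<lambda>h. h *\<^sub>R v)) (at s)" by (auto intro!: derivative_eq_intros)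
  moreover have "(I has_derivative ?D) (at (x + s *\<^sub>R v))" using d frechet_derivative_works by blast
  ultimately have "((\<lambda>s. I (x + s *\<^sub>R v)) has_derivative (\<lambda>h. ?D (h *\<^sub>R v))) (at s)"
    by (rule has_derivative_compose[where f = "\<lambda>s. x + s *\<^sub>R v" and g = I])
  from has_derivative_unique[OF this l[unfolded has_field_derivative_def]]
  have "?D (1 *\<^sub>R v) = r * 1" by (rule fun_cong)
  then show ?thesis by simp
qed

section \<open>Alternating 3-forms\<close>

lemma alt3_linear:
  "linear (\<lambda>u. alt3_apply \<theta> u v w)" "linear (\<lambda>v. alt3_apply \<theta> u v w)" "linear (\<lambda>w. alt3_apply \<theta> u v w)"
  using alt3_apply[of \<theta>] by (simp_all add: trilinear_def)

lemmas alt3_lin [simp] =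
  linear_add[OF alt3_linear(1)] linear_add[OF alt3_linear(2)] linear_add[OF alt3_linear(3)]
  linear_diff[OF alt3_linear(1)] linear_diff[OF alt3_linear(2)] linear_diff[OF alt3_linear(3)]
  linear_neg[OF alt3_linear(1)] linear_neg[OF alt3_linear(2)] linear_neg[OF alt3_linear(3)]
  linear_scale[OF alt3_linear(1), simplified] linear_scale[OF alt3_linear(2), simplified]
  linear_scale[OF alt3_linear(3), simplified]
  linear_0[OF alt3_linear(1)] linear_0[OF alt3_linear(2)] linear_0[OF alt3_linear(3)]

lemma alt3_swap: "alt3_apply \<theta> v u w = - alt3_apply \<theta> u v w" "alt3_apply \<theta> u w v = - alt3_apply \<theta> u v w"
proof -
  have "alternating3 (alt3_apply \<theta>)" using alt3_apply[of \<theta>] by simp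
  then show "alt3_apply \<theta> v u w = - alt3_apply \<theta> u v w" "alt3_apply \<theta> u w v = - alt3_apply \<theta> u v w"
    by (rule alternating3D)+
qed

lemma alt3_same [simp]:
  "alt3_apply \<theta> u u w = 0" "alt3_apply \<theta> u w w = 0" "alt3_apply \<theta> u w u = 0"
  using alt3_swap[of \<theta> u u w] alt3_swap[of \<theta> u w w] alt3_swap(2)[of \<theta> u u w] by linarith+

lemma alt3_eqI: "(\<And>u v w. alt3_apply \<theta> u v w = alt3_apply \<eta> u v w) \<Longrightarrow> \<theta> = \<eta>"
  by (simp add: fun_eq_iff flip: alt3_apply_inject)

lemma alt3_apply_linear: "linear (\<lambda>\<theta>. alt3_apply \<theta> u v w)"
  by (rule linearI) (simp_all add: plus_alt3.rep_eq scaleR_alt3.rep_eq)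

lemmas alt3_apply_lin [simp] =
  linear_add[OF alt3_apply_linear] linear_diff[OF alt3_apply_linear] linear_neg[OF alt3_apply_linear]
  linear_scale[OF alt3_apply_linear, simplified] linear_0[OF alt3_apply_linear]

lemmas alt3_apply_sum = linear_sum[OF alt3_apply_linear]

lemma alt3_expand:
  fixes u v w :: "'a::euclidean_space"
  shows "alt3_apply \<theta> u v w = (\<Sum>a\<in>Basis. \<Sum>b\<in>Basis. \<Sum>c\<in>Basis. (u \<bullet> a) * ((v \<bullet> b) * ((w \<bullet> c) * alt3_apply \<theta> a b c)))"
proof -
  have rep: "f u = (\<Sum>a\<in>Basis. (u \<bullet> a) * f a)" if "linear f" for f :: "'a \<Rightarrow> real" and u
  proof -
    have "f u = f (\<Sum>a\<in>Basis. (u \<bullet> a) *\<^sub>R a)" by (simp only: euclidean_representation)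
    also have "\<dots> = (\<Sum>a\<in>Basis. (u \<bullet> a) * f a)"
      using that by (simp only: linear_sum linear_scale real_scaleR_def)
    finally show ?thesis .
  qed
  have "alt3_apply \<theta> u v w = (\<Sum>a\<in>Basis. (u \<bullet> a) * alt3_apply \<theta> a v w)"
    by (rule rep[OF alt3_linear(1)])
  also have "\<dots> = (\<Sum>a\<in>Basis. (u \<bullet> a) * (\<Sum>b\<in>Basis. (v \<bullet> b) * alt3_apply \<theta> a b w))"
    by (intro sum.cong refl arg_cong[where f = "(*) _"] rep[OF alt3_linear(2)])
  also have "\<dots> = (\<Sum>a\<in>Basis. (u \<bullet> a) * (\<Sum>b\<in>Basis. (v \<bullet> b) * (\<Sum>c\<in>Basis. (w \<bullet> c) * alt3_apply \<theta> a b c)))"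
    by (intro sum.cong refl arg_cong[where f = "(*) _"] rep[OF alt3_linear(3)])
  finally show ?thesis by (simp only: sum_distrib_left)
qed

lemma bounded_linear_alt3_Basis:
  fixes a b c :: "'a::euclidean_space"
  assumes "a \<in> Basis" "b \<in> Basis" "c \<in> Basis"
  shows "bounded_linear (\<lambda>\<theta>. alt3_apply \<theta> a b c)"
proof (rule bounded_linear_intro[where K = 1])
  fix \<theta> :: "'a alt3"
  have "\<bar>alt3_apply \<theta> a b c\<bar> \<le> L2_set (\<lambda>t. \<bar>case t of (u, v, w) \<Rightarrow> alt3_apply \<theta> u v w\<bar>) (Basis \<times> Basis \<times> Basis)"
    using member_le_L2_set[of "Basis \<times> Basis \<times> Basis" "(a, b, c)" "\<lambda>t. \<bar>case t of (u, v, w) \<Rightarrow> alt3_apply \<theta> u v w\<bar>"] assms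
    by simp
  also have "\<dots> = norm \<theta>"
    by (simp add: norm_alt3_def L2_set_def)
  finally show "norm (alt3_apply \<theta> a b c) \<le> norm \<theta> * 1" by simp
qed (simp_all add: plus_alt3.rep_eq scaleR_alt3.rep_eq)

text \<open>The product rule for evaluating a varying form at varying vectors; it covers both curves of forms
  and equivariant maps.\<close>

lemma has_derivative_alt3_apply:
  fixes f g h :: "'w::real_normed_vector \<Rightarrow> 'a::euclidean_space"
  assumes "(\<Theta> has_derivative \<Theta>') (at x)" "(f has_derivative f') (at x)"
    "(g has_derivative g') (at x)" "(h has_derivative h') (at x)"
  shows "((\<lambda>x. alt3_apply (\<Theta> x) (f x) (g x) (h x)) has_derivative
    (\<lambda>y. alt3_apply (\<Theta>' y) (f x) (g x) (h x) + alt3_apply (\<Theta> x) (f' y) (g x) (h x) +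
      alt3_apply (\<Theta> x) (f x) (g' y) (h x) + alt3_apply (\<Theta> x) (f x) (g x) (h' y))) (at x)"
proof -
  have 1: "((\<lambda>x. alt3_apply (\<Theta> x) a b c) has_derivative (\<lambda>y. alt3_apply (\<Theta>' y) a b c)) (at x)"
    if "a \<in> Basis" "b \<in> Basis" "c \<in> Basis" for a b c
    using bounded_linear.has_derivative[OF bounded_linear_alt3_Basis[OF that] assms(1)] .
  have "((\<lambda>x. \<Sum>a\<in>Basis. \<Sum>b\<in>Basis. \<Sum>c\<in>Basis. (f x \<bullet> a) * ((g x \<bullet> b) * ((h x \<bullet> c) * alt3_apply (\<Theta> x) a b c)))
    has_derivative (\<lambda>y. \<Sum>a\<in>Basis. \<Sum>b\<in>Basis. \<Sum>c\<in>Basis.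
      (f x \<bullet> a) * ((g x \<bullet> b) * ((h x \<bullet> c) * alt3_apply (\<Theta>' y) a b c)) +
      (f' y \<bullet> a) * ((g x \<bullet> b) * ((h x \<bullet> c) * alt3_apply (\<Theta> x) a b c)) +
      (f x \<bullet> a) * ((g' y \<bullet> b) * ((h x \<bullet> c) * alt3_apply (\<Theta> x) a b c)) +
      (f x \<bullet> a) * ((g x \<bullet> b) * ((h' y \<bullet> c) * alt3_apply (\<Theta> x) a b c)))) (at x)"
    by (rule has_derivative_eq_rhs,
        (rule has_derivative_sum has_derivative_mult has_derivative_inner_left assms 1 | assumption)+)
      (simp add: algebra_simps)
  then show ?thesis
    by (simp only: sum.distrib flip: alt3_expand)
qed

lemma real_polynomial_function_alt3_apply:
  fixes f g h :: "'w::real_normed_vector \<Rightarrow> 'a::euclidean_space"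
  assumes "polynomial_function \<Theta>" "polynomial_function f" "polynomial_function g" "polynomial_function h"
  shows "real_polynomial_function (\<lambda>x. alt3_apply (\<Theta> x) (f x) (g x) (h x))"
proof -
  have 1: "real_polynomial_function (\<lambda>x. alt3_apply (\<Theta> x) a b c)"
    if "a \<in> Basis" "b \<in> Basis" "c \<in> Basis" for a b c :: 'a
    using assms(1) bounded_linear_alt3_Basis[OF that] by (auto simp: polynomial_function_def o_def)
  have 2: "real_polynomial_function (\<lambda>x. p x \<bullet> a)" if "polynomial_function p" "a \<in> Basis"
    for p :: "'w \<Rightarrow> 'a" and a
    using that polynomial_function_iff_Basis_inner by blast
  show ?thesis
    unfolding alt3_expand[of _ "f _"]
    by (intro real_polynomial_function_sum finite_Basis real_polynomial_function.intros(4) 1 2 assms)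
qed

lemma bounded_linear_alt3_apply: "bounded_linear (\<lambda>\<theta>. alt3_apply \<theta> u v w)"
  unfolding alt3_expand[of _ u v w]
  by (intro bounded_linear_sum bounded_linear_const_mult bounded_linear_alt3_Basis)

text \<open>The norm is at most the sum of the absolute values of the components.\<close>

lemma tendsto_alt3:
  fixes F :: "'t \<Rightarrow> 'a::euclidean_space alt3"
  assumes "\<And>u v w. ((\<lambda>t. alt3_apply (F t) u v w) \<longlongrightarrow> alt3_apply L u v w) G"
  shows "(F \<longlongrightarrow> L) G"
proof -
  have "norm \<theta> \<le> (\<Sum>(u, v, w)\<in>Basis \<times> Basis \<times> Basis. \<bar>alt3_apply \<theta> u v w\<bar>)" for \<theta> :: "'a alt3"
    using L2_set_le_sum_abs[of "\<lambda>(u, v, w). alt3_apply \<theta> u v w"]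
    by (simp add: norm_alt3_def case_prod_unfold)
  moreover have "((\<lambda>t. \<Sum>(u, v, w)\<in>Basis \<times> Basis \<times> Basis. \<bar>alt3_apply (F t - L) u v w\<bar>) \<longlongrightarrow> 0) G"
  proof (intro tendsto_null_sum)
    fix i :: "'a \<times> 'a \<times> 'a"
    obtain u v w where i: "i = (u, v, w)" by (cases i)
    show "((\<lambda>t. case i of (u, v, w) \<Rightarrow> \<bar>alt3_apply (F t - L) u v w\<bar>) \<longlongrightarrow> 0) G"
      unfolding i using tendsto_rabs_zero[OF LIM_zero[OF assms[of u v w]]] by simp
  qed
  ultimately have "((\<lambda>t. F t - L) \<longlongrightarrow> 0) G"
    by (rule Lim_null_comparison[OF always_eventually[OF allI]])
  then show ?thesis by (rule LIM_zero_cancel)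
qed

lemma has_vector_derivative_alt3:
  fixes F :: "real \<Rightarrow> 'a::euclidean_space alt3"
  assumes "\<And>u v w. ((\<lambda>t. alt3_apply (F t) u v w) has_real_derivative alt3_apply L u v w) (at x)"
  shows "(F has_vector_derivative L) (at x)"
proof -
  have "((\<lambda>h. (1 / h) *\<^sub>R (F (x + h) - F x)) \<longlongrightarrow> L) (at 0)"
    using assms by (intro tendsto_alt3) (simp add: DERIV_def)
  then have "((\<lambda>h. (1 / h) *\<^sub>R (F (x + h) - F x) - L) \<longlongrightarrow> 0) (at 0)"
    by (rule LIM_zero)
  then have "((\<lambda>h. norm ((1 / h) *\<^sub>R (F (x + h) - F x) - L)) \<longlongrightarrow> 0) (at 0)"
    by (rule tendsto_norm_zero)
  moreover have "norm ((1 / h) *\<^sub>R (F (x + h) - F x) - L) = norm (F (x + h) - F x - h *\<^sub>R L) / norm h" if "h \<noteq> 0" for h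
  proof -
    have "(1 / h) *\<^sub>R (F (x + h) - F x) - L = (1 / h) *\<^sub>R (F (x + h) - F x - h *\<^sub>R L)"
      using that by (simp add: scaleR_diff_right)
    then show ?thesis using that by (simp add: divide_inverse)
  qed
  ultimately have "((\<lambda>h. norm (F (x + h) - F x - h *\<^sub>R L) / norm h) \<longlongrightarrow> 0) (at 0)"
    by (subst (asm) tendsto_cong[OF eventually_at_filter[THEN iffD2, OF always_eventually]]) auto
  then show ?thesis
    unfolding has_vector_derivative_def has_derivative_at by (simp add: bounded_linear_scaleR_left)
qed

text \<open>The wedge product of the covectors dual to \<^term>\<open>a\<close>, \<^term>\<open>b\<close>, \<^term>\<open>c\<close> under the inner product,
  with the determinant expanded along the first column.\<close>

lift_definition wedge3 :: "'a::euclidean_space \<Rightarrow> 'a \<Rightarrow> 'a \<Rightarrow> 'a alt3" is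
  "\<lambda>a b c x y z. (a \<bullet> x) * ((b \<bullet> y) * (c \<bullet> z) - (b \<bullet> z) * (c \<bullet> y)) +
     (b \<bullet> x) * ((c \<bullet> y) * (a \<bullet> z) - (c \<bullet> z) * (a \<bullet> y)) +
     (c \<bullet> x) * ((a \<bullet> y) * (b \<bullet> z) - (a \<bullet> z) * (b \<bullet> y))"
  by (simp add: trilinear_def alternating3_def linear_iff inner_add_right algebra_simps)

text \<open>The derivative at the identity of the action, in the direction \<open>A\<close>; the sign comes from pulling
  back along the inverse.\<close>

lift_definition infinitesimal_act :: "('a::euclidean_space \<Rightarrow>\<^sub>L 'a) \<Rightarrow> 'a alt3 \<Rightarrow> 'a alt3" is
  "\<lambda>A f u v w. - (f (A u) v w + f u (A v) w + f u v (A w))"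
proof -
  fix A :: "'a::euclidean_space \<Rightarrow> 'a" and f :: "'a \<Rightarrow> 'a \<Rightarrow> 'a \<Rightarrow> real"
  assume A: "bounded_linear A" and f: "trilinear f \<and> alternating3 f"
  have "trilinear (\<lambda>u v w. - (f (A u) v w + f u (A v) w + f u v (A w)))"
    using f bounded_linear.linear[OF A] by (simp add: trilinear_def linear_iff algebra_simps)
  moreover have "alternating3 (\<lambda>u v w. - (f (A u) v w + f u (A v) w + f u v (A w)))"
  proof (rule alternating3I)
    fix u v w
    note sw = alternating3D[OF conjunct2[OF f]]
    show "- (f (A v) u w + f v (A u) w + f v u (A w)) = - (- (f (A u) v w + f u (A v) w + f u v (A w)))"
      using sw(1)[of u "A v" w] sw(1)[of "A u" v w] sw(1)[of u v "A w"] by linarith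
    show "- (f (A u) w v + f u (A w) v + f u w (A v)) = - (- (f (A u) v w + f u (A v) w + f u v (A w)))"
      using sw(2)[of "A u" v w] sw(2)[of u "A v" w] sw(2)[of u v "A w"] by linarith
  qed
  ultimately show "trilinear (\<lambda>u v w. - (f (A u) v w + f u (A v) w + f u v (A w))) \<and>
    alternating3 (\<lambda>u v w. - (f (A u) v w + f u (A v) w + f u v (A w)))" ..
qed

lemma infinitesimal_act_linear_left: "linear (\<lambda>A. infinitesimal_act A \<theta>)"
  by (rule linearI) (auto intro!: alt3_eqI simp: infinitesimal_act.rep_eq blinfun.add_left blinfun.scaleR_left algebra_simps)

lemma infinitesimal_act_linear_right: "linear (infinitesimal_act A)"
  by (rule linearI) (auto intro!: alt3_eqI simp: infinitesimal_act.rep_eq algebra_simps)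

subsection \<open>Dimension\<close>

lemma card_increasing_triples: "card {(i, j, k). i < j \<and> j < k \<and> k < (d::nat)} = d choose 3"
  and finite_increasing_triples: "finite {(i, j, k). i < j \<and> j < k \<and> k < (d::nat)}"
proof -
  have pairs: "finite {(i, j). i < j \<and> j < (d::nat)} \<and> card {(i, j). i < j \<and> j < d} = d choose 2" for d
  proof (induction d)
    case (Suc d)
    have "{(i, j). i < j \<and> j < Suc d} = {(i, j). i < j \<and> j < d} \<union> (\<lambda>i. (i, d)) ` {..<d}"
      by auto
    moreover have "card ((\<lambda>i. (i, d)) ` {..<d}) = d" by (subst card_image) (auto simp: inj_on_def)
    moreover have "{(i, j). i < j \<and> j < d} \<inter> (\<lambda>i. (i, d)) ` {..<d} = {}" by auto
    ultimately show ?case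
      using Suc by (simp add: card_Un_disjoint numeral_2_eq_2)
  qed auto
  have "finite {(i, j, k). i < j \<and> j < k \<and> k < (d::nat)} \<and> card {(i, j, k). i < j \<and> j < k \<and> k < d} = d choose 3"
  proof (induction d)
    case (Suc d)
    have "{(i, j, k). i < j \<and> j < k \<and> k < Suc d} =
      {(i, j, k). i < j \<and> j < k \<and> k < d} \<union> (\<lambda>(i, j). (i, j, d)) ` {(i, j). i < j \<and> j < d}"
      by (auto simp: less_Suc_eq)
    moreover have "card ((\<lambda>(i, j). (i, j, d)) ` {(i, j). i < j \<and> j < d}) = d choose 2"
      using pairs[of d] by (subst card_image) (auto simp: inj_on_def)
    moreover have "{(i, j, k). i < j \<and> j < k \<and> k < d} \<inter> (\<lambda>(i, j). (i, j, d)) ` {(i, j). i < j \<and> j < d} = {}"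
      by auto
    ultimately show ?case
      using Suc pairs[of d] by (simp add: card_Un_disjoint numeral_3_eq_3 numeral_2_eq_2)
  qed auto
  then show "card {(i, j, k). i < j \<and> j < k \<and> k < (d::nat)} = d choose 3"
    "finite {(i, j, k). i < j \<and> j < k \<and> k < (d::nat)}" by auto
qed

text \<open>Wedge products over increasing triples of basis vectors are dual to evaluation at such triples, and
  a form that vanishes at all increasing triples is zero.\<close>

lemma alt3_basis:
  obtains T :: "'a::euclidean_space alt3 set"
  where "finite T" "span T = UNIV" "independent T" "card T = DIM('a) choose 3"
proof -
  define d where "d = DIM('a)"
  obtain h :: "nat \<Rightarrow> 'a" where h: "bij_betw h {..<d} Basis"
    using ex_bij_betw_nat_finite[OF finite_Basis] unfolding d_def atLeast0LessThan by blast
  have hB: "h i \<in> Basis" if "i < d" for i using h that by (auto simp: bij_betw_def)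
  have hh: "h i \<bullet> h j = (if i = j then 1 else 0)" if "i < d" "j < d" for i j
    using h that hB by (auto simp: inner_Basis bij_betw_def inj_on_def)
  define I where "I = {(i, j, k). i < j \<and> j < k \<and> k < d}"
  have I: "finite I" "card I = d choose 3"
    unfolding I_def by (rule finite_increasing_triples card_increasing_triples)+
  define E where "E = (\<lambda>(i, j, k). wedge3 (h i) (h j) (h k))"
  have E: "alt3_apply (E \<tau>) (h i) (h j) (h k) = (if \<tau> = (i, j, k) then 1 else 0)"
    if "\<tau> \<in> I" "(i, j, k) \<in> I" for \<tau> i j k
    using that by (cases \<tau>) (auto simp: E_def I_def wedge3.rep_eq hh)
  have zero: "\<theta> = 0" if \<theta>: "\<And>i j k. (i, j, k) \<in> I \<Longrightarrow> alt3_apply \<theta> (h i) (h j) (h k) = 0" for \<theta> :: "'a alt3"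
  proof (rule alt3_eq_0_if_Basis)
    have 1: "alt3_apply \<theta> (h i) (h j) (h k) = 0" if "i < j" "k < d" "j < d" for i j k
    proof -
      consider "k < i" | "i < k" "k < j" | "j < k" | "k = i" | "k = j" by linarith
      then show ?thesis
        using \<theta>[of k i j] \<theta>[of i k j] \<theta>[of i j k] that
          alt3_swap[of \<theta> "h i" "h k" "h j"] alt3_swap[of \<theta> "h i" "h j" "h k"]
        by cases (auto simp: I_def)
    qed
    have 2: "alt3_apply \<theta> (h i) (h j) (h k) = 0" if "i < d" "j < d" "k < d" for i j k
    proof (cases i j rule: linorder_cases)
      case greater
      have "alt3_apply \<theta> (h i) (h j) (h k) = - alt3_apply \<theta> (h j) (h i) (h k)" by (rule alt3_swap)
      also have "alt3_apply \<theta> (h j) (h i) (h k) = 0" by (rule 1) (use greater that in auto)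
      finally show ?thesis by simp
    next
      case less
      then show ?thesis using that by (intro 1)
    next
      case equal
      then show ?thesis by simp
    qed
    fix u v w :: 'a assume uvw: "u \<in> Basis" "v \<in> Basis" "w \<in> Basis"
    have "\<exists>i<d. x = h i" if "x \<in> Basis" for x using h that by (auto simp: bij_betw_def)
    then obtain i j k where "i < d" "u = h i" "j < d" "v = h j" "k < d" "w = h k" using uvw by meson
    then show "alt3_apply \<theta> u v w = 0" using 2 by simp
  qed
  have ev: "alt3_apply (\<Sum>\<tau>\<in>I. c \<tau> *\<^sub>R E \<tau>) (h i) (h j) (h k) = c (i, j, k)" if "(i, j, k) \<in> I" for c i j k
  proof -
    have "alt3_apply (\<Sum>\<tau>\<in>I. c \<tau> *\<^sub>R E \<tau>) (h i) (h j) (h k) = (\<Sum>\<tau>\<in>I. if \<tau> = (i, j, k) then c \<tau> else 0)"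
      unfolding alt3_apply_sum by (rule sum.cong) (auto simp: E that)
    then show ?thesis using that I by simp
  qed
  have inj: "inj_on E I"
  proof (rule inj_onI)
    fix \<sigma> \<tau> assume st: "\<sigma> \<in> I" "\<tau> \<in> I" "E \<sigma> = E \<tau>"
    obtain i j k where "\<sigma> = (i, j, k)" by (cases \<sigma>)
    then have "alt3_apply (E \<tau>) (h i) (h j) (h k) = 1" "(i, j, k) \<in> I"
      using E[of \<sigma> i j k] st by auto
    then show "\<sigma> = \<tau>" using E[OF st(2)] \<open>\<sigma> = (i, j, k)\<close> by (metis zero_neq_one)
  qed
  show ?thesis
  proof
    show "finite (E ` I)" using I by simp
    show "card (E ` I) = DIM('a) choose 3" using I card_image[OF inj] by (simp add: d_def)
    show "independent (E ` I)"
    proof (rule independent_if_scalars_zero)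
      fix f x assume s: "(\<Sum>x\<in>E ` I. f x *\<^sub>R x) = 0" and x: "x \<in> E ` I"
      then obtain i j k where t: "(i, j, k) \<in> I" "x = E (i, j, k)" by auto
      show "f x = 0" using ev[OF t(1), of "\<lambda>\<tau>. f (E \<tau>)"] s t by (simp add: sum.reindex[OF inj])
    qed (use I in simp)
    have "\<theta> \<in> span (E ` I)" for \<theta>
    proof -
      define c where "c = (\<lambda>(i, j, k). alt3_apply \<theta> (h i) (h j) (h k))"
      have "\<theta> - (\<Sum>\<tau>\<in>I. c \<tau> *\<^sub>R E \<tau>) = 0"
        by (rule zero) (simp add: ev, simp add: c_def)
      then have "\<theta> = (\<Sum>\<tau>\<in>I. c \<tau> *\<^sub>R E \<tau>)" by simp
      also have "\<dots> \<in> span (E ` I)" by (intro span_sum span_scale span_base) auto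
      finally show ?thesis .
    qed
    then show "span (E ` I) = UNIV" by auto
  qed
qed

subsection \<open>Independence of orbit directions\<close>

text \<open>The components of the infinitesimal action are linear in the form, so independence at one form
  spreads to the complement of the zeros of a polynomial.\<close>

lemma infinitesimal_act_generically_independent:
  fixes \<theta> :: "'a::euclidean_space alt3"
  assumes "independent_family m (\<lambda>j. infinitesimal_act (A j) \<theta>)"
  shows "\<exists>D. real_polynomial_function D \<and> D \<theta> \<noteq> 0 \<and>
    (\<forall>x. D x \<noteq> 0 \<longrightarrow> independent_family m (\<lambda>j. infinitesimal_act (A j) x))"
proof -
  define M where "M j t x = (case t of (u, v, w) \<Rightarrow> alt3_apply (infinitesimal_act (A j) x) u v w)" for j t x
  have eq: "(\<forall>t. (\<Sum>j<m. c j * M j t x) = 0) \<longleftrightarrow> (\<Sum>j<m. c j *\<^sub>R infinitesimal_act (A j) x) = 0" for c x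
  proof
    assume l: "\<forall>t. (\<Sum>j<m. c j * M j t x) = 0"
    show "(\<Sum>j<m. c j *\<^sub>R infinitesimal_act (A j) x) = 0"
    proof (rule alt3_eqI)
      fix u v w
      show "alt3_apply (\<Sum>j<m. c j *\<^sub>R infinitesimal_act (A j) x) u v w = alt3_apply 0 u v w"
        using l[rule_format, of "(u, v, w)"] by (simp add: M_def alt3_apply_sum)
    qed
  next
    assume r: "(\<Sum>j<m. c j *\<^sub>R infinitesimal_act (A j) x) = 0"
    show "\<forall>t. (\<Sum>j<m. c j * M j t x) = 0"
    proof
      fix t :: "'a \<times> 'a \<times> 'a"
      obtain u v w where t: "t = (u, v, w)" by (cases t)
      have "(\<Sum>j<m. c j * M j t x) = alt3_apply (\<Sum>j<m. c j *\<^sub>R infinitesimal_act (A j) x) u v w"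
        by (simp add: t M_def alt3_apply_sum)
      then show "(\<Sum>j<m. c j * M j t x) = 0" by (simp add: r)
    qed
  qed
  have "real_polynomial_function (M j t)" for j t
  proof -
    obtain u v w where t: "t = (u, v, w)" by (cases t)
    show ?thesis
      unfolding M_def t prod.case infinitesimal_act.rep_eq
      by (intro real_polynomial_function.intros(1) bounded_linear_minus bounded_linear_add bounded_linear_alt3_apply)
  qed
  then have "\<exists>D. real_polynomial_function D \<and> D \<theta> \<noteq> 0 \<and>
    (\<forall>x c. D x \<noteq> 0 \<longrightarrow> (\<forall>t. (\<Sum>i<m. c i * M i t x) = 0) \<longrightarrow> (\<forall>i<m. c i = 0))"
  proof (rule real_polynomial_rows_generically_independent)
    show "\<forall>i<m. c i = 0" if "\<forall>t. (\<Sum>i<m. c i * M i t \<theta>) = 0" for c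
      using that assms unfolding eq independent_family_def by (elim allE[of _ c] mp)
  qed
  then show ?thesis unfolding eq independent_family_def by blast
qed

section \<open>Symplectic bases\<close>

lemma symplectic_formD:
  assumes "symplectic_form \<Omega>"
  shows "linear (\<lambda>u. \<Omega> u v)" "linear (\<lambda>v. \<Omega> u v)" "\<Omega> v u = - \<Omega> u v"
    "(\<And>v. \<Omega> u v = 0) \<Longrightarrow> u = 0"
  using assms unfolding symplectic_form_def by blast+

lemma symplectic_form_self: "symplectic_form \<Omega> \<Longrightarrow> \<Omega> u u = 0"
  using symplectic_formD(3)[of \<Omega> u u] by simp

lemma symplectic_form_lin:
  assumes "symplectic_form \<Omega>"
  shows "\<Omega> (u + u') v = \<Omega> u v + \<Omega> u' v" "\<Omega> v (u + u') = \<Omega> v u + \<Omega> v u'"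
    "\<Omega> (u - u') v = \<Omega> u v - \<Omega> u' v" "\<Omega> v (u - u') = \<Omega> v u - \<Omega> v u'"
    "\<Omega> (- u) v = - \<Omega> u v" "\<Omega> v (- u) = - \<Omega> v u"
    "\<Omega> (c *\<^sub>R u) v = c * \<Omega> u v" "\<Omega> v (c *\<^sub>R u) = c * \<Omega> v u" "\<Omega> 0 v = 0" "\<Omega> v 0 = 0"
    "\<Omega> (\<Sum>i\<in>X. f i) v = (\<Sum>i\<in>X. \<Omega> (f i) v)" "\<Omega> v (\<Sum>i\<in>X. f i) = (\<Sum>i\<in>X. \<Omega> v (f i))"
proof -
  note l = symplectic_formD(1)[OF assms] and r = symplectic_formD(2)[OF assms]
  show "\<Omega> (u + u') v = \<Omega> u v + \<Omega> u' v" "\<Omega> (u - u') v = \<Omega> u v - \<Omega> u' v" "\<Omega> (- u) v = - \<Omega> u v"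
    "\<Omega> (c *\<^sub>R u) v = c * \<Omega> u v" "\<Omega> 0 v = 0" "\<Omega> (\<Sum>i\<in>X. f i) v = (\<Sum>i\<in>X. \<Omega> (f i) v)"
    using linear_add[OF l] linear_diff[OF l] linear_neg[OF l] linear_scale[OF l] linear_0[OF l] linear_sum[OF l]
    by simp_all
  show "\<Omega> v (u + u') = \<Omega> v u + \<Omega> v u'" "\<Omega> v (u - u') = \<Omega> v u - \<Omega> v u'" "\<Omega> v (- u) = - \<Omega> v u"
    "\<Omega> v (c *\<^sub>R u) = c * \<Omega> v u" "\<Omega> v 0 = 0" "\<Omega> v (\<Sum>i\<in>X. f i) = (\<Sum>i\<in>X. \<Omega> v (f i))"
    using linear_add[OF r] linear_diff[OF r] linear_neg[OF r] linear_scale[OF r] linear_0[OF r] linear_sum[OF r]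
    by simp_all
qed

lemma linear_mult_left: "linear f \<Longrightarrow> linear (\<lambda>x. f x * c)" and linear_mult_right: "linear f \<Longrightarrow> linear (\<lambda>x. c * f x)"
  for f :: "'b::real_vector \<Rightarrow> real"
  by (simp_all add: linear_iff algebra_simps)

lemma sum_if_eq_less [simp]:
  "(\<Sum>i<n. if i = j then f i else 0) = (if j < n then f j else 0)" for f :: "nat \<Rightarrow> 'b::comm_monoid_add"
  by simp

locale symplectic_basis =
  fixes \<Omega> :: "'a::euclidean_space \<Rightarrow> 'a \<Rightarrow> real" and n :: nat and p q :: "nat \<Rightarrow> 'a"
  assumes symp: "symplectic_form \<Omega>" and dim2n: "DIM('a) = 2 * n"
    and pp: "i < n \<Longrightarrow> j < n \<Longrightarrow> \<Omega> (p i) (p j) = 0"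
    and qq: "i < n \<Longrightarrow> j < n \<Longrightarrow> \<Omega> (q i) (q j) = 0"
    and pq: "i < n \<Longrightarrow> j < n \<Longrightarrow> \<Omega> (p i) (q j) = (if i = j then 1 else 0)"

text \<open>Symplectic Gram--Schmidt: a vector outside the span of the pairs found so far is made orthogonal to
  them, nondegeneracy provides a partner for it, and the partner is made orthogonal as well.\<close>

lemma symplectic_basis_exists:
  fixes \<Omega> :: "'a::euclidean_space \<Rightarrow> 'a \<Rightarrow> real"
  assumes symp: "symplectic_form \<Omega>" and dim: "DIM('a) = 2 * n"
  shows "\<exists>p q. symplectic_basis \<Omega> n p q"
proof -
  note lin = symplectic_form_lin[OF symp] and skew = symplectic_formD(3)[OF symp]
  have "m \<le> n \<Longrightarrow> \<exists>p q. \<forall>i<m. \<forall>j<m. \<Omega> (p i) (p j) = 0 \<and> \<Omega> (q i) (q j) = 0 \<and>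
    \<Omega> (p i) (q j) = (if i = j then 1 else 0)" for m
  proof (induction m)
    case (Suc m)
    then obtain p q :: "nat \<Rightarrow> 'a" where *: "\<forall>i<m. \<forall>j<m. \<Omega> (p i) (p j) = 0 \<and> \<Omega> (q i) (q j) = 0 \<and>
      \<Omega> (p i) (q j) = (if i = j then 1 else 0)" by auto
    have qp: "\<Omega> (q i) (p j) = (if i = j then - 1 else 0)" if "i < m" "j < m" for i j
      using * that skew[of "q i" "p j"] by auto
    \<comment> \<open>The component of a vector that is orthogonal to all pairs found so far.\<close>
    define proj where "proj x = x - (\<Sum>i<m. \<Omega> x (q i) *\<^sub>R p i - \<Omega> x (p i) *\<^sub>R q i)" for x
    have orth: "\<Omega> (proj x) (p j) = 0" "\<Omega> (proj x) (q j) = 0" if j: "j < m" for x j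
    proof -
      have "(\<Sum>i<m. \<Omega> x (q i) * \<Omega> (p i) (p j) - \<Omega> x (p i) * \<Omega> (q i) (p j)) = (\<Sum>i<m. if i = j then \<Omega> x (p j) else 0)"
        by (rule sum.cong) (use * qp j in auto)
      then show "\<Omega> (proj x) (p j) = 0" using j by (simp add: proj_def lin)
      have "(\<Sum>i<m. \<Omega> x (q i) * \<Omega> (p i) (q j) - \<Omega> x (p i) * \<Omega> (q i) (q j)) = (\<Sum>i<m. if i = j then \<Omega> x (q j) else 0)"
        by (rule sum.cong) (use * j in auto)
      then show "\<Omega> (proj x) (q j) = 0" using j by (simp add: proj_def lin)
    qed
    define B where "B = p ` {..<m} \<union> q ` {..<m}"
    have "card B \<le> card (p ` {..<m}) + card (q ` {..<m})" unfolding B_def by (rule card_Un_le)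
    also have "\<dots> \<le> m + m" by (intro add_mono) (metis card_image_le card_lessThan finite_lessThan)+
    also have "\<dots> < DIM('a)" using Suc.prems dim by simp
    finally have "card B < DIM('a)" .
    moreover have "dim (span B) \<le> card B" unfolding dim_span by (rule dim_le_card') (simp add: B_def)
    ultimately have "span B \<noteq> UNIV" by (metis dim_UNIV not_le)
    then obtain v where v: "v \<notin> span B" by blast
    have "(\<Sum>i<m. \<Omega> v (q i) *\<^sub>R p i - \<Omega> v (p i) *\<^sub>R q i) \<in> span B"
      by (intro span_sum span_diff span_scale span_base) (auto simp: B_def)
    then have "proj v \<noteq> 0" using v by (auto simp: proj_def)
    then obtain w where w: "\<Omega> (proj v) w \<noteq> 0" using symplectic_formD(4)[OF symp] by blast
    have vw: "\<Omega> (proj v) (proj w) = \<Omega> (proj v) w"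
      by (simp add: proj_def[of w] lin orth)
    define w' where "w' = (1 / \<Omega> (proj v) w) *\<^sub>R proj w"
    have w': "\<Omega> w' (p j) = 0" "\<Omega> w' (q j) = 0" if "j < m" for j
      using orth[OF that] by (simp_all add: w'_def lin)
    have vw': "\<Omega> (proj v) w' = 1" using w by (simp add: w'_def lin vw)
    have flip: "\<Omega> (p j) (proj v) = 0" "\<Omega> (q j) (proj v) = 0" "\<Omega> (p j) w' = 0" "\<Omega> (q j) w' = 0" if "j < m" for j
      using orth[OF that, of v] w'[OF that] skew[of "p j" "proj v"] skew[of "q j" "proj v"] skew[of "p j" w'] skew[of "q j" w']
      by simp_all
    show ?case
      by (rule exI[of _ "p(m := proj v)"], rule exI[of _ "q(m := w')"])
        (auto simp: less_Suc_eq symplectic_form_self[OF symp] vw' * orth w' flip)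
  qed auto
  from this[of n] show ?thesis
    using symp dim unfolding symplectic_basis_def by blast
qed

definition sp :: "('a::euclidean_space \<Rightarrow> 'a \<Rightarrow> real) \<Rightarrow> ('a \<Rightarrow>\<^sub>L 'a) set" where
  "sp \<Omega> = {A. \<forall>u v. \<Omega> (blinfun_apply A u) v = - \<Omega> u (blinfun_apply A v)}"

context symplectic_basis
begin

lemmas Om_lin = symplectic_form_lin[OF symp]
lemmas Om_skew = symplectic_formD(3)[OF symp]
lemmas Om_self = symplectic_form_self[OF symp]
lemmas Om_linear = symplectic_formD(1,2)[OF symp]
declare Om_lin [simp] Om_self [simp]

lemma qp: "i < n \<Longrightarrow> j < n \<Longrightarrow> \<Omega> (q i) (p j) = (if i = j then - 1 else 0)"
  using pq[of j i] Om_skew[of "q i" "p j"] by auto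

text \<open>A single numbering of the basis \<open>p\<^sub>0, \<dots>, q\<^sub>0, \<dots>\<close>; the order on the indices selects one
  representative of each symmetric product of two basis vectors.\<close>

definition e :: "nat \<Rightarrow> 'a" where "e x = (if x < n then p x else q (x - n))"

definition dual_index :: "nat \<Rightarrow> nat" where "dual_index x = (if x < n then x + n else x - n)"

definition orientation :: "nat \<Rightarrow> real" where "orientation x = (if x < n then 1 else - 1)"

lemma dual_index_less: "x < 2 * n \<Longrightarrow> dual_index x < 2 * n" and dual_index_dual_index: "x < 2 * n \<Longrightarrow> dual_index (dual_index x) = x"
  and orientation_nonzero: "orientation x \<noteq> 0"
  by (auto simp: dual_index_def orientation_def)

lemma Om_e: "x < 2 * n \<Longrightarrow> y < 2 * n \<Longrightarrow> \<Omega> (e x) (e y) = (if y = dual_index x then orientation x else 0)"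
  by (auto simp: e_def dual_index_def orientation_def pp qq pq qp)

lemma independent_e: "independent_family (2 * n) e"
  unfolding independent_family_def
proof (intro allI impI)
  fix c x assume s: "(\<Sum>x<2 * n. c x *\<^sub>R e x) = 0" and x: "x < 2 * n"
  have "0 = \<Omega> (e (dual_index x)) (\<Sum>x<2 * n. c x *\<^sub>R e x)" by (simp add: s)
  also have "\<dots> = (\<Sum>y<2 * n. if y = x then c x * orientation (dual_index x) else 0)"
    unfolding Om_lin by (rule sum.cong) (use x dual_index_less dual_index_dual_index in \<open>auto simp: Om_e\<close>)
  finally show "c x = 0" using x orientation_nonzero by simp
qed

lemma span_e: "span (e ` {..<2 * n}) = UNIV"
  using card_ge_dim_independent[of "e ` {..<2 * n}" UNIV] independent_family_image[OF independent_e]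
  by (auto simp: dim2n card_image)

lemma Om_eqI:
  assumes "\<And>x. x < 2 * n \<Longrightarrow> \<Omega> u (e x) = \<Omega> v (e x)"
  shows "u = v"
proof -
  have "\<Omega> (u - v) z = 0" for z
    by (rule linear_eq_0_on_span[OF Om_linear(2), of "e ` {..<2 * n}"]) (use assms span_e in auto)
  then show ?thesis using symplectic_formD(4)[OF symp, of "u - v"] by simp
qed

text \<open>The \<open>p\<close>-coordinates are read off by pairing with the \<open>q\<close>'s and conversely, with the sign
  forced by skew symmetry.\<close>

lemma expand: "v = (\<Sum>i<n. \<Omega> v (q i) *\<^sub>R p i - \<Omega> v (p i) *\<^sub>R q i)"
proof (rule Om_eqI)
  fix x assume x: "x < 2 * n"
  show "\<Omega> v (e x) = \<Omega> (\<Sum>i<n. \<Omega> v (q i) *\<^sub>R p i - \<Omega> v (p i) *\<^sub>R q i) (e x)"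
  proof (cases "x < n")
    case True
    have "(\<Sum>i<n. \<Omega> v (q i) * \<Omega> (p i) (p x) - \<Omega> v (p i) * \<Omega> (q i) (p x)) = (\<Sum>i<n. if i = x then \<Omega> v (p x) else 0)"
      by (rule sum.cong) (use True in \<open>auto simp: pp qp\<close>)
    then show ?thesis using True by (simp add: e_def)
  next
    case False
    have "(\<Sum>i<n. \<Omega> v (q i) * \<Omega> (p i) (q (x - n)) - \<Omega> v (p i) * \<Omega> (q i) (q (x - n))) =
        (\<Sum>i<n. if i = x - n then \<Omega> v (q (x - n)) else 0)"
      by (rule sum.cong) (use False x in \<open>auto simp: qq pq\<close>)
    then show ?thesis using False x by (simp add: e_def)
  qed
qed

lemma linear_expand:
  assumes "linear f"
  shows "f v = (\<Sum>i<n. \<Omega> v (q i) *\<^sub>R f (p i) - \<Omega> v (p i) *\<^sub>R f (q i))"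
  by (subst expand[of v]) (simp add: linear_sum[OF assms] linear_diff[OF assms] linear_scale[OF assms])

lemma bounded_linear_Om: "bounded_linear (\<Omega> u)" "bounded_linear (\<lambda>u. \<Omega> u v)"
  using Om_linear linear_conv_bounded_linear by auto

lemma bounded_bilinear_Om: "bounded_bilinear \<Omega>"
  using Om_linear by (simp add: bilinear_def flip: bilinear_conv_bounded_bilinear)

subsection \<open>Curves in the symplectic group\<close>

text \<open>The inverse of a symplectic map is its adjoint with respect to \<^term>\<open>\<Omega>\<close>. In the symplectic basis
  this is a formula that is linear in the map, so inverses of curves can be differentiated.\<close>

lemma Sp_inv:
  assumes "A \<in> Sp \<Omega>"
  shows "linear (inv (blinfun_apply A))" "\<Omega> (inv (blinfun_apply A) u) (inv (blinfun_apply A) v) = \<Omega> u v"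
    "A (inv (blinfun_apply A) u) = u"
    "inv (blinfun_apply A) u = (\<Sum>i<n. \<Omega> u (A (q i)) *\<^sub>R p i - \<Omega> u (A (p i)) *\<^sub>R q i)"
proof -
  have bij: "bij (blinfun_apply A)" and pres: "\<And>u v. \<Omega> (A u) (A v) = \<Omega> u v"
    using assms by (auto simp: Sp_def GL_def)
  show AB: "A (inv (blinfun_apply A) u) = u" for u using bij by (simp add: bij_is_surj surj_f_inv_f)
  show "\<Omega> (inv (blinfun_apply A) u) (inv (blinfun_apply A) v) = \<Omega> u v"
    by (subst pres[symmetric]) (simp only: AB)
  have 1: "\<Omega> (inv (blinfun_apply A) u) v = \<Omega> u (A v)" for u v by (subst pres[symmetric]) (simp only: AB)
  show 2: "inv (blinfun_apply A) u = (\<Sum>i<n. \<Omega> u (A (q i)) *\<^sub>R p i - \<Omega> u (A (p i)) *\<^sub>R q i)" for u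
    by (subst expand) (simp only: 1)
  show "linear (inv (blinfun_apply A))"
  proof -
    have "linear (\<lambda>u. \<Sum>i<n. \<Omega> u (A (q i)) *\<^sub>R p i - \<Omega> u (A (p i)) *\<^sub>R q i)"
      by (rule linearI) (simp_all add: scaleR_add_left scaleR_diff_right sum.distrib sum_subtractf scaleR_sum_right)
    moreover have "inv (blinfun_apply A) = (\<lambda>u. \<Sum>i<n. \<Omega> u (A (q i)) *\<^sub>R p i - \<Omega> u (A (p i)) *\<^sub>R q i)"
      by (rule ext) (rule 2)
    ultimately show ?thesis by (simp only:)
  qed
qed

text \<open>Differentiating the invariance of \<^term>\<open>\<Omega>\<close> along the curve puts its velocity into the Lie algebra,
  and the product rule gives the velocity of the orbit curve.\<close>

lemma curve_derivative:
  assumes Sp: "\<And>t. \<gamma> t \<in> Sp \<Omega>" and id: "\<gamma> 0 = id_blinfun" and d: "(\<gamma> has_vector_derivative A) (at 0)"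
  shows "A \<in> sp \<Omega>" "((\<lambda>t. act (\<gamma> t) \<theta>) has_vector_derivative infinitesimal_act A \<theta>) (at 0)"
proof -
  have \<gamma>: "((\<lambda>t. \<gamma> t u) has_derivative (\<lambda>t. t *\<^sub>R A u)) (at 0)" for u
    using bounded_linear.has_derivative[OF blinfun.bounded_linear_left d[unfolded has_vector_derivative_def]]
    by (simp add: blinfun.scaleR_left)
  have Om: "((\<lambda>t. \<Omega> (\<gamma> t u) v) has_derivative (\<lambda>t. t * \<Omega> (A u) v)) (at 0)"
    "((\<lambda>t. \<Omega> v (\<gamma> t u)) has_derivative (\<lambda>t. t * \<Omega> v (A u))) (at 0)" for u v
    using bounded_linear.has_derivative[OF bounded_linear_Om(1) \<gamma>, of v u]
      bounded_linear.has_derivative[OF bounded_linear_Om(2) \<gamma>, of u v] by simp_all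
  have inv: "((\<lambda>t. inv (blinfun_apply (\<gamma> t)) u) has_derivative
    (\<lambda>t. t *\<^sub>R (\<Sum>i<n. \<Omega> u (A (q i)) *\<^sub>R p i - \<Omega> u (A (p i)) *\<^sub>R q i))) (at 0)" for u
    unfolding Sp_inv(4)[OF Sp]
    by (rule has_derivative_eq_rhs, (rule has_derivative_sum has_derivative_diff has_derivative_scaleR_left Om)+)
      (simp add: scaleR_sum_right algebra_simps)
  have inv0: "inv (blinfun_apply (\<gamma> 0)) u = u" for u
    using Sp_inv(3)[OF Sp[of 0]] by (simp add: id)
  have "\<Omega> (A u) v = - \<Omega> u (A v)" for u v
  proof -
    have "((\<lambda>t. \<Omega> (\<gamma> t u) (\<gamma> t v)) has_derivative
      (\<lambda>t. \<Omega> (\<gamma> 0 u) (t *\<^sub>R A v) + \<Omega> (t *\<^sub>R A u) (\<gamma> 0 v))) (at 0)"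
      by (rule bounded_bilinear.FDERIV[OF bounded_bilinear_Om \<gamma> \<gamma>])
    moreover have "\<Omega> (\<gamma> t u) (\<gamma> t v) = \<Omega> u v" for t using Sp[of t] by (simp add: Sp_def)
    ultimately have "((\<lambda>t::real. \<Omega> u v) has_derivative (\<lambda>t. t * (\<Omega> u (A v) + \<Omega> (A u) v))) (at 0)"
      by (simp add: id algebra_simps)
    from has_derivative_unique[OF has_derivative_const this]
    have "0 = 1 * (\<Omega> u (A v) + \<Omega> (A u) v)" by (rule fun_cong)
    then show ?thesis by simp
  qed
  then show sp: "A \<in> sp \<Omega>" by (simp add: sp_def)
  have GL: "\<gamma> t \<in> GL" for t using Sp[of t] by (simp add: Sp_def)
  have inv_sp: "(\<Sum>i<n. \<Omega> u (A (q i)) *\<^sub>R p i - \<Omega> u (A (p i)) *\<^sub>R q i) = - A u" for u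
  proof -
    have "\<Omega> u (A v) = \<Omega> (- A u) v" for v using sp by (simp add: sp_def)
    then show ?thesis using expand[of "- A u"] by simp
  qed
  show "((\<lambda>t. act (\<gamma> t) \<theta>) has_vector_derivative infinitesimal_act A \<theta>) (at 0)" for \<theta>
  proof (rule has_vector_derivative_alt3)
    fix u v w
    show "((\<lambda>t. alt3_apply (act (\<gamma> t) \<theta>) u v w) has_real_derivative alt3_apply (infinitesimal_act A \<theta>) u v w) (at 0)"
      unfolding has_field_derivative_def alt3_apply_act[OF GL]
      by (rule has_derivative_eq_rhs[OF has_derivative_alt3_apply[OF has_derivative_const inv inv inv]])
        (simp add: fun_eq_iff inv0 inv_sp infinitesimal_act.rep_eq algebra_simps)
  qed
qed

text \<open>The curve that realises a tangent direction at one form realises the corresponding direction at every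
  other form. This is how tangent directions are transported between forms.\<close>

lemma orbit_tangent_cases:
  assumes "\<eta> \<in> orbit_tangent \<Omega> \<theta>"
  obtains A where "A \<in> sp \<Omega>" "\<eta> = infinitesimal_act A \<theta>" "\<And>\<theta>'. infinitesimal_act A \<theta>' \<in> orbit_tangent \<Omega> \<theta>'"
proof -
  obtain \<gamma> :: "real \<Rightarrow> 'a \<Rightarrow>\<^sub>L 'a" where \<gamma>: "\<And>t. \<gamma> t \<in> Sp \<Omega>" "smooth_on UNIV \<gamma>" "\<gamma> 0 = id_blinfun"
    "((\<lambda>t. act (\<gamma> t) \<theta>) has_vector_derivative \<eta>) (at 0)"
    using assms unfolding orbit_tangent_def by blast
  have "Ck_on (Suc 0) UNIV \<gamma>" using \<gamma>(2) unfolding smooth_on_def by blast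
  then have "\<gamma> differentiable (at 0)" by simp
  then have d: "(\<gamma> has_vector_derivative vector_derivative \<gamma> (at 0)) (at 0)"
    by (simp add: vector_derivative_works)
  note c = curve_derivative[OF \<gamma>(1,3) d]
  show ?thesis
  proof (rule that)
    show "vector_derivative \<gamma> (at 0) \<in> sp \<Omega>" by (rule c)
    show "\<eta> = infinitesimal_act (vector_derivative \<gamma> (at 0)) \<theta>" by (rule vector_derivative_unique_at[OF \<gamma>(4) c(2)])
    show "infinitesimal_act (vector_derivative \<gamma> (at 0)) \<theta>' \<in> orbit_tangent \<Omega> \<theta>'" for \<theta>'
      unfolding orbit_tangent_def using \<gamma> c(2)[of \<theta>'] by blast
  qed
qed

text \<open>The element of the Lie algebra that corresponds to the product \<open>a b\<close> under its identification with
  the symmetric square of \<open>V\<close>.\<close>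

definition sym2 :: "'a \<Rightarrow> 'a \<Rightarrow> 'a \<Rightarrow>\<^sub>L 'a" where
  "sym2 a b = Blinfun (\<lambda>x. \<Omega> a x *\<^sub>R b + \<Omega> b x *\<^sub>R a)"

lemma sym2_apply: "sym2 a b x = \<Omega> a x *\<^sub>R b + \<Omega> b x *\<^sub>R a"
proof -
  have "linear (\<lambda>x. \<Omega> a x *\<^sub>R b + \<Omega> b x *\<^sub>R a)"
    by (rule linearI) (simp_all add: algebra_simps)
  then show ?thesis
    unfolding sym2_def by (subst bounded_linear_Blinfun_apply) (simp_all add: linear_conv_bounded_linear)
qed

lemma sym2_commute: "sym2 a b = sym2 b a"
  by (rule blinfun_eqI) (simp add: sym2_apply)

lemma sym2_polarize: "sym2 a b = (1 / 2) *\<^sub>R (sym2 (a + b) (a + b) - sym2 a a - sym2 b b)"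
proof (rule blinfun_eqI)
  fix x
  have "sym2 (a + b) (a + b) x - sym2 a a x - sym2 b b x = 2 *\<^sub>R sym2 a b x"
    unfolding scaleR_2 by (simp add: sym2_apply algebra_simps)
  then show "sym2 a b x = ((1 / 2) *\<^sub>R (sym2 (a + b) (a + b) - sym2 a a - sym2 b b)) x"
    by (simp only: blinfun.scaleR_left blinfun.diff_left) simp
qed

text \<open>The square of \<^term>\<open>sym2 a a\<close> is zero, so its exponential is affine in \<^term>\<open>t\<close>.\<close>

lemma transvection_Sp: "id_blinfun + t *\<^sub>R sym2 a a \<in> Sp \<Omega>"
proof -
  have app: "(id_blinfun + t *\<^sub>R sym2 a a) x = x + (2 * t * \<Omega> a x) *\<^sub>R a" for t x
    by (simp add: sym2_apply blinfun.add_left blinfun.scaleR_left mult.assoc flip: scaleR_2)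
  have "(id_blinfun + t *\<^sub>R sym2 a a) ((id_blinfun + (- t) *\<^sub>R sym2 a a) x) = x"
    "(id_blinfun + (- t) *\<^sub>R sym2 a a) ((id_blinfun + t *\<^sub>R sym2 a a) x) = x" for x
    unfolding app by (simp_all add: algebra_simps)
  then have "bij (blinfun_apply (id_blinfun + t *\<^sub>R sym2 a a))"
    by (intro o_bij[of "blinfun_apply (id_blinfun + (- t) *\<^sub>R sym2 a a)"] ext) (simp_all add: o_def)
  then show ?thesis
    using Om_skew[of a] by (simp add: Sp_def GL_def app algebra_simps)
qed

lemma transvection_derivative:
  "((\<lambda>t. id_blinfun + t *\<^sub>R sym2 a a) has_vector_derivative sym2 a a) (at 0)"
  by (auto intro!: derivative_eq_intros simp: has_vector_derivative_def)

lemma transvection_act_derivative: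
  "((\<lambda>t. act (id_blinfun + t *\<^sub>R sym2 a a) \<theta>) has_vector_derivative infinitesimal_act (sym2 a a) \<theta>) (at 0)"
  using curve_derivative(2)[OF transvection_Sp _ transvection_derivative] by simp

lemma derivative_along_transvection:
  assumes "(f has_derivative f') (at \<theta>)"
  shows "((\<lambda>t. f (act (id_blinfun + t *\<^sub>R sym2 a a) \<theta>)) has_derivative (\<lambda>t. f' (t *\<^sub>R infinitesimal_act (sym2 a a) \<theta>))) (at 0)"
proof (rule has_derivative_compose[where f = "\<lambda>t. act (id_blinfun + t *\<^sub>R sym2 a a) \<theta>" and g = f])
  let ?c = "\<lambda>t. act (id_blinfun + t *\<^sub>R sym2 a a) \<theta>"
  show "(?c has_derivative (\<lambda>t. t *\<^sub>R infinitesimal_act (sym2 a a) \<theta>)) (at 0)"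
    using transvection_act_derivative by (simp only: has_vector_derivative_def)
  have "id_blinfun \<in> (GL :: ('a \<Rightarrow>\<^sub>L 'a) set)" by (simp add: GL_def id_def[symmetric])
  then have c0: "?c 0 = \<theta>" by (auto intro!: alt3_eqI simp: alt3_apply_act id_def[symmetric])
  show "(f has_derivative f') (at (?c 0))" unfolding c0 by (rule assms)
qed

lemma infinitesimal_act_sym2_polarize:
  "infinitesimal_act (sym2 a b) \<theta> = (1 / 2) *\<^sub>R (infinitesimal_act (sym2 (a + b) (a + b)) \<theta> - infinitesimal_act (sym2 a a) \<theta> - infinitesimal_act (sym2 b b) \<theta>)"
  by (subst sym2_polarize)
    (simp add: linear_scale[OF infinitesimal_act_linear_left] linear_diff[OF infinitesimal_act_linear_left])

text \<open>An invariant is constant along the orbit of a group of transvections, which settles the squares;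
  polarisation gives all symmetric products.\<close>

lemma invariant_derivative_zero:
  fixes I :: "'a alt3 \<Rightarrow> real"
  assumes d: "I differentiable (at \<theta>)" and inv: "\<And>A. A \<in> Sp \<Omega> \<Longrightarrow> I (act A \<theta>) = I \<theta>"
  shows "frechet_derivative I (at \<theta>) (infinitesimal_act (sym2 a b) \<theta>) = 0"
proof -
  note D = frechet_derivative_works[THEN iffD1, OF d]
  have sq: "frechet_derivative I (at \<theta>) (infinitesimal_act (sym2 a a) \<theta>) = 0" for a
  proof -
    let ?c = "\<lambda>t. act (id_blinfun + t *\<^sub>R sym2 a a) \<theta>"
    have "((\<lambda>t. I (?c t)) has_derivative (\<lambda>t. frechet_derivative I (at \<theta>) (t *\<^sub>R infinitesimal_act (sym2 a a) \<theta>))) (at 0)"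
      by (rule derivative_along_transvection) (rule D)
    moreover have "I (?c t) = I \<theta>" for t by (rule inv) (rule transvection_Sp)
    ultimately have "((\<lambda>t::real. I \<theta>) has_derivative (\<lambda>t. frechet_derivative I (at \<theta>) (t *\<^sub>R infinitesimal_act (sym2 a a) \<theta>))) (at 0)"
      by simp
    from has_derivative_unique[OF has_derivative_const this]
    have "0 = frechet_derivative I (at \<theta>) (1 *\<^sub>R infinitesimal_act (sym2 a a) \<theta>)" by (rule fun_cong)
    then show ?thesis by simp
  qed
  have lin: "linear (frechet_derivative I (at \<theta>))" using D by (rule has_derivative_linear)
  show ?thesis
    unfolding infinitesimal_act_sym2_polarize[of a b] linear_scale[OF lin] linear_diff[OF lin] by (simp add: sq)
qed

section \<open>Counting invariants\<close>

text \<open>At a form whose orbit tangent has the largest dimension, a maximal independent family of tangent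
  directions stays independent on a dense open set, where the dimension is then also the largest.\<close>

lemma regular_set_generic:
  "\<exists>D \<theta>. real_polynomial_function D \<and> D \<theta> \<noteq> 0 \<and> {x. D x \<noteq> 0} \<subseteq> regular_set \<Omega>"
proof -
  obtain T :: "'a alt3 set" where T: "finite T" "span T = UNIV" "independent T"
    "card T = DIM('a) choose 3" by (rule alt3_basis)
  let ?d = "\<lambda>\<theta>. dim (orbit_tangent \<Omega> \<theta>)"
  have "?d \<theta> \<le> card T" for \<theta>
  proof -
    obtain w :: "nat \<Rightarrow> 'a alt3" where "independent_family (?d \<theta>) w"
      using independent_family_in_basis[OF T(1,2), of "orbit_tangent \<Omega> \<theta>"] by (elim exE conjE)
    then show ?thesis by (rule independent_family_le_card[OF _ T(1)]) (simp add: T(2))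
  qed
  then have "\<exists>\<theta>. True \<and> (\<forall>\<theta>'. True \<longrightarrow> ?d \<theta>' \<le> ?d \<theta>)"
    by (intro ex_has_greatest_nat[of "\<lambda>_. True" 0 ?d "Suc (card T)"] TrueI allI impI le_imp_less_Suc)
  then obtain \<theta> where max: "\<And>\<theta>'. ?d \<theta>' \<le> ?d \<theta>" by blast
  obtain w :: "nat \<Rightarrow> 'a alt3" where w: "independent_family (?d \<theta>) w" "\<forall>i<?d \<theta>. w i \<in> orbit_tangent \<Omega> \<theta>"
    using independent_family_in_basis[OF T(1,2), of "orbit_tangent \<Omega> \<theta>"] by (elim exE conjE)
  have "\<exists>A. w i = infinitesimal_act A \<theta> \<and> (\<forall>\<theta>'. infinitesimal_act A \<theta>' \<in> orbit_tangent \<Omega> \<theta>')" if "i < ?d \<theta>" for i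
    using orbit_tangent_cases[OF w(2)[rule_format, OF that]] by metis
  then obtain A where A: "\<And>i. i < ?d \<theta> \<Longrightarrow> w i = infinitesimal_act (A i) \<theta>"
    "\<And>i \<theta>'. i < ?d \<theta> \<Longrightarrow> infinitesimal_act (A i) \<theta>' \<in> orbit_tangent \<Omega> \<theta>'"
    by metis
  have "independent_family (?d \<theta>) (\<lambda>i. infinitesimal_act (A i) \<theta>)"
    using w(1) A(1) by (simp add: independent_family_def)
  from infinitesimal_act_generically_independent[OF this] obtain D where D: "real_polynomial_function D" "D \<theta> \<noteq> 0"
    "\<And>x. D x \<noteq> 0 \<Longrightarrow> independent_family (?d \<theta>) (\<lambda>j. infinitesimal_act (A j) x)" by blast
  have "x \<in> regular_set \<Omega>" if "D x \<noteq> 0" for x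
  proof -
    have "?d \<theta> \<le> ?d x" using independent_family_le_dim[OF T(1,2) D(3)[OF that]] A(2) by blast
    then have "\<forall>\<theta>'\<in>UNIV. ?d \<theta>' \<le> ?d x" using max order_trans by blast
    then show ?thesis unfolding regular_set_def by blast
  qed
  then show ?thesis using D(1,2) by blast
qed

text \<open>The dense open set on which the invariants are independent meets the one on which the orbit
  directions are. At a common point the differentials of the invariants kill the orbit directions.\<close>

lemma invariant_counts_upper:
  assumes k: "k \<in> invariant_counts \<Omega>" and ind: "independent_family m (\<lambda>j. infinitesimal_act (sym2 (a j) (b j)) \<theta>)"
  shows "k + m \<le> DIM('a) choose 3"
proof -
  obtain T :: "'a alt3 set" where T: "finite T" "span T = UNIV" "independent T"
    "card T = DIM('a) choose 3" by (rule alt3_basis)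
  obtain I U where I: "\<And>i. i < k \<Longrightarrow> smooth_on (regular_set \<Omega>) (I i)" "\<And>i. i < k \<Longrightarrow> Sp_invariant \<Omega> (I i)"
    and U: "open U" "U \<subseteq> regular_set \<Omega>" "regular_set \<Omega> \<subseteq> closure U"
    "\<And>x c. x \<in> U \<Longrightarrow> \<forall>v. (\<Sum>i<k. c i * frechet_derivative (I i) (at x) v) = 0 \<Longrightarrow> \<forall>i<k. c i = 0"
    using k unfolding invariant_counts_def functionally_independent_def by blast
  have "regular_set \<Omega> \<noteq> {}" using regular_set_generic by blast
  then have "U \<noteq> {}" using U(3) by auto
  obtain D where D: "real_polynomial_function D" "D \<theta> \<noteq> 0"
    "\<And>x. D x \<noteq> 0 \<Longrightarrow> independent_family m (\<lambda>j. infinitesimal_act (sym2 (a j) (b j)) x)"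
    using infinitesimal_act_generically_independent[OF ind] by blast
  have "U \<inter> {x. D x \<noteq> 0} \<noteq> {}"
    using open_Int_closure_eq_empty[OF U(1), of "{x. D x \<noteq> 0}"] real_polynomial_function_nonzero_dense[OF D(1,2)]
      \<open>U \<noteq> {}\<close> by auto
  then obtain x where x: "x \<in> U" "D x \<noteq> 0" by blast
  have diff: "I i differentiable (at x)" if "i < k" for i
  proof -
    have "Ck_on (Suc 0) (regular_set \<Omega>) (I i)" using I(1)[OF that] unfolding smooth_on_def by blast
    then show ?thesis using x(1) U(2) by auto
  qed
  have "k + m \<le> card T"
  proof (rule independent_functionals_kernel_bound[where \<phi> = "\<lambda>i. frechet_derivative (I i) (at x)"])
    show "linear (frechet_derivative (I i) (at x))" if "i < k" for i
      using diff[OF that] by (meson frechet_derivative_works has_derivative_linear)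
    show "independent_family m (\<lambda>j. infinitesimal_act (sym2 (a j) (b j)) x)" by (rule D(3)) (rule x(2))
    show "frechet_derivative (I i) (at x) (infinitesimal_act (sym2 (a j) (b j)) x) = 0" if "i < k" for i j
      using I(2)[OF that] x(1) U(2) by (intro invariant_derivative_zero diff[OF that]) (auto simp: Sp_invariant_def)
  qed (use U(4)[OF x(1)] T in auto)
  then show ?thesis using T by simp
qed

text \<open>Both the independence of the differentials and regularity of the form are guaranteed off the zeros of
  a polynomial; the complement of the zeros of their product is the required dense open set.\<close>

lemma invariant_counts_lower:
  fixes I :: "nat \<Rightarrow> 'a alt3 \<Rightarrow> real"
  assumes poly: "\<And>i. i < k \<Longrightarrow> real_polynomial_function (I i)"
    and inv: "\<And>i A \<theta>. i < k \<Longrightarrow> A \<in> Sp \<Omega> \<Longrightarrow> I i (act A \<theta>) = I i \<theta>"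
    and ind: "\<And>c. \<forall>v. (\<Sum>i<k. c i * frechet_derivative (I i) (at x0) v) = 0 \<Longrightarrow> \<forall>i<k. c i = 0"
  shows "k \<in> invariant_counts \<Omega>"
proof -
  obtain D0 \<theta> where D0: "real_polynomial_function D0" "D0 \<theta> \<noteq> 0" "{x. D0 x \<noteq> 0} \<subseteq> regular_set \<Omega>"
    using regular_set_generic by blast
  have "\<exists>D. real_polynomial_function D \<and> D x0 \<noteq> 0 \<and> (\<forall>x c. D x \<noteq> 0 \<longrightarrow>
    (\<forall>v. (\<Sum>i<k. c i * frechet_derivative (I i) (at x) v) = 0) \<longrightarrow> (\<forall>i<k. c i = 0))"
    using real_polynomial_rows_generically_independent[of k "\<lambda>i v x. frechet_derivative (I i) (at x) v" x0]
      real_polynomial_function_frechet[OF poly] ind by blast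
  then obtain D where D: "real_polynomial_function D" "D x0 \<noteq> 0"
    "\<And>x c. D x \<noteq> 0 \<Longrightarrow> \<forall>v. (\<Sum>i<k. c i * frechet_derivative (I i) (at x) v) = 0 \<Longrightarrow> \<forall>i<k. c i = 0" by blast
  have P: "real_polynomial_function (\<lambda>x. D x * D0 x)" using D(1) D0(1) by (rule real_polynomial_function.intros(4))
  have "{x. D x \<noteq> 0} \<inter> {x. D0 x \<noteq> 0} \<noteq> {}"
    using open_Int_closure_eq_empty[OF real_polynomial_function_nonzero_dense(1)[OF D(1,2)], of "{x. D0 x \<noteq> 0}"]
      real_polynomial_function_nonzero_dense(2)[OF D0(1,2)] D(2) by auto
  then obtain y where "D y * D0 y \<noteq> 0" by auto
  note dense = real_polynomial_function_nonzero_dense[OF P this]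
  have "functionally_independent (regular_set \<Omega>) k I"
    unfolding functionally_independent_def
  proof (intro exI[of _ "{x. D x * D0 x \<noteq> 0}"] conjI ballI allI)
    show "open {x. D x * D0 x \<noteq> 0}" by (rule dense)
    show "{x. D x * D0 x \<noteq> 0} \<subseteq> regular_set \<Omega>" using D0(3) by auto
    show "regular_set \<Omega> \<subseteq> closure {x. D x * D0 x \<noteq> 0}" using dense(2) by simp
    show "(\<forall>v. (\<Sum>i<k. c i * frechet_derivative (I i) (at x) v) = 0) \<longrightarrow> (\<forall>i<k. c i = 0)"
      if "x \<in> {x. D x * D0 x \<noteq> 0}" for x c using D(3)[of x c] that by auto
  qed
  then show ?thesis
    unfolding invariant_counts_def Sp_invariant_def
    using poly inv smooth_on_real_polynomial_function by blast
qed

section \<open>Covariants\<close>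

text \<open>Contraction of a bilinear form with the bivector inverse to \<^term>\<open>\<Omega>\<close>.\<close>

definition contract :: "('a \<Rightarrow> 'a \<Rightarrow> real) \<Rightarrow> real" where
  "contract B = (\<Sum>i<n. B (p i) (q i) - B (q i) (p i))"

text \<open>The vector that represents a linear functional by means of \<^term>\<open>\<Omega>\<close>.\<close>

definition sharp :: "('a \<Rightarrow> real) \<Rightarrow> 'a" where
  "sharp f = (\<Sum>i<n. f (q i) *\<^sub>R p i - f (p i) *\<^sub>R q i)"

lemma Om_sharp:
  assumes "linear f"
  shows "\<Omega> (sharp f) z = f z"
proof -
  have "\<Omega> (sharp f) z = (\<Sum>i<n. \<Omega> z (q i) *\<^sub>R f (p i) - \<Omega> z (p i) *\<^sub>R f (q i))"
    unfolding sharp_def Om_lin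
    by (rule sum.cong) (simp_all add: Om_skew[of z "p _"] Om_skew[of z "q _"])
  then show ?thesis by (simp only: linear_expand[OF assms, of z])
qed

lemma Om_eq_all: "(\<And>z. \<Omega> u z = \<Omega> v z) \<Longrightarrow> u = v"
  by (rule Om_eqI)

lemma contract_Om_right: "linear f \<Longrightarrow> contract (\<lambda>u w. f u * \<Omega> b w) = f b"
  unfolding contract_def using linear_expand[of f b] by (simp add: mult.commute)

lemma contract_Om_left: "linear f \<Longrightarrow> contract (\<lambda>u w. \<Omega> b u * f w) = - f b"
  unfolding contract_def using linear_expand[of f b] by (simp add: sum_subtractf)

lemma contract_add: "contract (\<lambda>u w. B u w + C u w) = contract B + contract C"
  and contract_diff: "contract (\<lambda>u w. B u w - C u w) = contract B - contract C"
  and contract_minus: "contract (\<lambda>u w. - B u w) = - contract B"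
  and contract_cmult: "contract (\<lambda>u w. c * B u w) = c * contract B"
  by (simp_all add: contract_def algebra_simps sum_subtractf sum.distrib sum_distrib_left sum_negf)

lemma contract_sum: "contract (\<lambda>u w. \<Sum>j\<in>X. D j u w) = (\<Sum>j\<in>X. contract (D j))"
  unfolding contract_def sum_subtractf[symmetric] by (rule sum.swap)

text \<open>The contraction does not depend on the symplectic basis: expanding the second argument in the image
  basis turns one contraction into the other.\<close>

lemma contract_invariant:
  assumes B: "\<And>w. linear (\<lambda>u. B u w)" "\<And>u. linear (B u)"
    and g: "linear g" "\<And>u v. \<Omega> (g u) (g v) = \<Omega> u v" "\<And>u. g (h u) = u"
  shows "contract (\<lambda>u w. B (g u) (g w)) = contract B"
proof -
  have gexp: "v = (\<Sum>i<n. \<Omega> v (g (q i)) *\<^sub>R g (p i) - \<Omega> v (g (p i)) *\<^sub>R g (q i))" for v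
  proof -
    have "\<Omega> (h v) u = \<Omega> v (g u)" for u using g(2)[of "h v" u] by (simp only: g(3))
    then show ?thesis using linear_expand[OF g(1), of "h v"] by (simp only: g(3))
  qed
  have "B u w = (\<Sum>i<n. B u (g (q i)) * \<Omega> (g (p i)) w - B u (g (p i)) * \<Omega> (g (q i)) w)" for u w
  proof -
    have "B u w = (\<Sum>i<n. \<Omega> w (g (q i)) * B u (g (p i)) - \<Omega> w (g (p i)) * B u (g (q i)))"
      by (subst gexp[of w]) (simp add: linear_sum[OF B(2)] linear_diff[OF B(2)] linear_scale[OF B(2)])
    also have "\<dots> = (\<Sum>i<n. B u (g (q i)) * \<Omega> (g (p i)) w - B u (g (p i)) * \<Omega> (g (q i)) w)"
      by (rule sum.cong) (simp_all add: Om_skew[of w "g (p _)"] Om_skew[of w "g (q _)"])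
    finally show ?thesis .
  qed
  then have "B = (\<lambda>u w. \<Sum>i<n. B u (g (q i)) * \<Omega> (g (p i)) w - B u (g (p i)) * \<Omega> (g (q i)) w)"
    by (intro ext)
  then have "contract B = contract (\<lambda>u w. \<Sum>i<n. B u (g (q i)) * \<Omega> (g (p i)) w - B u (g (p i)) * \<Omega> (g (q i)) w)"
    by (rule arg_cong)
  also have "\<dots> = (\<Sum>i<n. B (g (p i)) (g (q i)) - B (g (q i)) (g (p i)))"
    by (simp add: contract_sum contract_diff contract_Om_right B(1))
  finally show ?thesis by (simp add: contract_def)
qed

lemma linear_contract:
  assumes "\<And>u w. linear (\<lambda>z. B z u w)"
  shows "linear (\<lambda>z. contract (B z))"
  unfolding contract_def
  by (rule linearI) (simp_all add: linear_add[OF assms] linear_scale[OF assms] sum.distrib sum_distrib_left algebra_simps sum_subtractf)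

definition trace_vector :: "'a alt3 \<Rightarrow> 'a" where
  "trace_vector \<theta> = sharp (\<lambda>z. contract (\<lambda>u w. alt3_apply \<theta> u w z))"

text \<open>Up to sign the trace form of the endomorphisms that represent the 2-forms \<open>\<theta>(x, \<cdot>, \<cdot>)\<close> and
  \<open>\<theta>(y, \<cdot>, \<cdot>)\<close>.\<close>

definition contraction_form :: "'a alt3 \<Rightarrow> 'a \<Rightarrow> 'a \<Rightarrow> real" where
  "contraction_form \<theta> x y = contract (\<lambda>u u'. contract (\<lambda>w w'. alt3_apply \<theta> x u w * alt3_apply \<theta> y u' w'))"

text \<open>The endomorphism \<open>Q\<close> with \<open>\<Omega> (Q x) y\<close> equal to the contraction form.\<close>

definition contraction_map :: "'a alt3 \<Rightarrow> 'a \<Rightarrow> 'a" where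
  "contraction_map \<theta> x = sharp (contraction_form \<theta> x)"

lemma Om_trace_vector: "\<Omega> (trace_vector \<theta>) z = contract (\<lambda>u w. alt3_apply \<theta> u w z)"
  unfolding trace_vector_def by (rule Om_sharp) (intro linear_contract alt3_linear)

lemma linear_contraction_form: "linear (\<lambda>x. contraction_form \<theta> x y)" "linear (contraction_form \<theta> x)"
  unfolding contraction_form_def by (intro linear_contract linear_mult_left linear_mult_right alt3_linear)+

lemma Om_contraction_map: "\<Omega> (contraction_map \<theta> x) y = contraction_form \<theta> x y"
  unfolding contraction_map_def by (rule Om_sharp) (rule linear_contraction_form)

lemma linear_contraction_map: "linear (contraction_map \<theta>)"
  by (rule linearI; rule Om_eq_all)
    (simp_all add: Om_contraction_map linear_add[OF linear_contraction_form(1)] linear_scale[OF linear_contraction_form(1)])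

text \<open>The wedge product of the covectors \<open>\<Omega> a\<close>, \<open>\<Omega> b\<close>, \<open>\<Omega> c\<close>.\<close>

definition decomposable :: "'a \<Rightarrow> 'a \<Rightarrow> 'a \<Rightarrow> 'a alt3" where
  "decomposable a b c = Alt3 (\<lambda>x y z. \<Omega> a x * (\<Omega> b y * \<Omega> c z - \<Omega> b z * \<Omega> c y) +
     \<Omega> b x * (\<Omega> c y * \<Omega> a z - \<Omega> c z * \<Omega> a y) +
     \<Omega> c x * (\<Omega> a y * \<Omega> b z - \<Omega> a z * \<Omega> b y))"

lemma decomposable_apply: "alt3_apply (decomposable a b c) x y z = \<Omega> a x * (\<Omega> b y * \<Omega> c z - \<Omega> b z * \<Omega> c y) +
     \<Omega> b x * (\<Omega> c y * \<Omega> a z - \<Omega> c z * \<Omega> a y) +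
     \<Omega> c x * (\<Omega> a y * \<Omega> b z - \<Omega> a z * \<Omega> b y)"
  unfolding decomposable_def
  by (subst Alt3_inverse) (auto simp: trilinear_def alternating3_def linear_iff algebra_simps)

text \<open>The 3-form \<open>\<Omega> \<and> \<Omega> a\<close>.\<close>

definition omega_wedge :: "'a \<Rightarrow> 'a alt3" where
  "omega_wedge a = Alt3 (\<lambda>x y z. \<Omega> x y * \<Omega> a z + \<Omega> y z * \<Omega> a x + \<Omega> z x * \<Omega> a y)"

lemma omega_wedge_apply: "alt3_apply (omega_wedge a) x y z = \<Omega> x y * \<Omega> a z + \<Omega> y z * \<Omega> a x + \<Omega> z x * \<Omega> a y"
proof -
  have "alternating3 (\<lambda>x y z. \<Omega> x y * \<Omega> a z + \<Omega> y z * \<Omega> a x + \<Omega> z x * \<Omega> a y)"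
  proof (rule alternating3I)
    fix u v w
    show "\<Omega> v u * \<Omega> a w + \<Omega> u w * \<Omega> a v + \<Omega> w v * \<Omega> a u = - (\<Omega> u v * \<Omega> a w + \<Omega> v w * \<Omega> a u + \<Omega> w u * \<Omega> a v)"
      "\<Omega> u w * \<Omega> a v + \<Omega> w v * \<Omega> a u + \<Omega> v u * \<Omega> a w = - (\<Omega> u v * \<Omega> a w + \<Omega> v w * \<Omega> a u + \<Omega> w u * \<Omega> a v)"
      by (simp_all add: Om_skew[of v u] Om_skew[of w v] Om_skew[of u w])
  qed
  moreover have "trilinear (\<lambda>x y z. \<Omega> x y * \<Omega> a z + \<Omega> y z * \<Omega> a x + \<Omega> z x * \<Omega> a y)"
    by (auto simp: trilinear_def linear_iff algebra_simps)
  ultimately show ?thesis unfolding omega_wedge_def by (subst Alt3_inverse) auto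
qed

lemma linear_omega_wedge: "linear omega_wedge"
  by (rule linearI) (auto intro!: alt3_eqI simp: omega_wedge_apply algebra_simps)

lemma linear_trace_vector: "linear trace_vector"
proof -
  have "linear (\<lambda>\<theta>. contract (\<lambda>u w. alt3_apply \<theta> u w z))" for z by (intro linear_contract alt3_apply_linear)
  note l = linear_add[OF this] linear_scale[OF this]
  show ?thesis by (rule linearI; rule Om_eq_all; simp only: Om_trace_vector l Om_lin real_scaleR_def)
qed

lemma trace_vector_omega_wedge: "trace_vector (omega_wedge a) = (2 * real n - 2) *\<^sub>R a"
proof (rule Om_eq_all)
  fix z
  have "contract \<Omega> = 2 * real n" by (simp add: contract_def pq qp)
  moreover have "contract (\<lambda>u w. \<Omega> w z * \<Omega> a u) = - \<Omega> a z"
  proof -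
    have "contract (\<lambda>u w. \<Omega> w z * \<Omega> a u) = - contract (\<lambda>u w. \<Omega> a u * \<Omega> z w)"
      unfolding contract_minus[symmetric] by (simp add: Om_skew[of _ z] mult.commute)
    then show ?thesis by (simp add: contract_Om_right Om_linear)
  qed
  moreover have "contract (\<lambda>u w. \<Omega> z u * \<Omega> a w) = - \<Omega> a z" by (simp add: contract_Om_left Om_linear)
  moreover have "contract (\<lambda>u w. \<Omega> u w * \<Omega> a z) = \<Omega> a z * contract \<Omega>"
    unfolding contract_cmult[symmetric] by (simp add: mult.commute)
  ultimately show "\<Omega> (trace_vector (omega_wedge a)) z = \<Omega> ((2 * real n - 2) *\<^sub>R a) z"
    by (simp add: Om_trace_vector omega_wedge_apply contract_add algebra_simps)
qed

text \<open>The constant makes the contraction of the result with \<^term>\<open>\<Omega>\<close> zero for \<open>n \<ge> 2\<close>; for \<open>n = 1\<close> the quotient is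
  zero by convention, and so are all 3-forms.\<close>

definition primitive_part :: "'a alt3 \<Rightarrow> 'a alt3" where
  "primitive_part \<theta> = \<theta> - omega_wedge ((1 / (2 * real n - 2)) *\<^sub>R trace_vector \<theta>)"

lemma primitive_part_add_omega_wedge: "n \<ge> 2 \<Longrightarrow> trace_vector \<theta> = 0 \<Longrightarrow> primitive_part (\<theta> + omega_wedge a) = \<theta>"
  by (simp add: primitive_part_def linear_add[OF linear_trace_vector] trace_vector_omega_wedge)

text \<open>The iterates use the primitive part so that adding \<open>\<Omega> \<and> \<Omega> a\<close> to a primitive form moves the
  starting vector without changing the endomorphism that is iterated.\<close>

primrec covariant :: "'a alt3 \<Rightarrow> nat \<Rightarrow> 'a" where
  "covariant \<theta> 0 = trace_vector \<theta>"
| "covariant \<theta> (Suc i) = contraction_map (primitive_part \<theta>) (covariant \<theta> i)"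

subsection \<open>Equivariance\<close>

lemma Sp_Om_inv:
  assumes "A \<in> Sp \<Omega>"
  shows "\<Omega> (A u) v = \<Omega> u (inv (blinfun_apply A) v)"
  using assms Sp_inv(3)[OF assms, of v] unfolding Sp_def by (metis (mono_tags, lifting) mem_Collect_eq)

lemma alt3_apply_act_Sp:
  "A \<in> Sp \<Omega> \<Longrightarrow> alt3_apply (act A \<theta>) u v w = alt3_apply \<theta> (inv (blinfun_apply A) u)
     (inv (blinfun_apply A) v) (inv (blinfun_apply A) w)"
  by (rule alt3_apply_act) (simp add: Sp_def)

lemma inv_Sp_inverse: "A \<in> Sp \<Omega> \<Longrightarrow> inv (blinfun_apply A) (A u) = u"
  by (simp add: Sp_def GL_def bij_is_inj)

lemma trace_vector_act:
  assumes A: "A \<in> Sp \<Omega>"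
  shows "trace_vector (act A \<theta>) = A (trace_vector \<theta>)"
proof (rule Om_eq_all)
  fix z
  show "\<Omega> (trace_vector (act A \<theta>)) z = \<Omega> (A (trace_vector \<theta>)) z"
    unfolding Sp_Om_inv[OF A] Om_trace_vector alt3_apply_act_Sp[OF A]
    by (rule contract_invariant[where h = "blinfun_apply A"])
      (rule alt3_linear Sp_inv[OF A] inv_Sp_inverse[OF A])+
qed

lemma contraction_form_act:
  assumes A: "A \<in> Sp \<Omega>"
  shows "contraction_form (act A \<theta>) x y = contraction_form \<theta> (inv (blinfun_apply A) x) (inv (blinfun_apply A) y)"
proof -
  let ?g = "inv (blinfun_apply A)"
  have "contraction_form (act A \<theta>) x y = contract (\<lambda>u u'. contract (\<lambda>w w'. alt3_apply \<theta> (?g x) (?g u) (?g w) * alt3_apply \<theta> (?g y) (?g u') (?g w')))"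
    by (simp only: contraction_form_def alt3_apply_act_Sp[OF A])
  also have "\<dots> = contract (\<lambda>u u'. contract (\<lambda>w w'. alt3_apply \<theta> (?g x) (?g u) w * alt3_apply \<theta> (?g y) (?g u') w'))"
    by (rule arg_cong[where f = contract], intro ext, rule contract_invariant[where h = "blinfun_apply A"])
      (rule linear_mult_left linear_mult_right alt3_linear Sp_inv[OF A] inv_Sp_inverse[OF A])+
  also have "\<dots> = contraction_form \<theta> (?g x) (?g y)"
    unfolding contraction_form_def
    by (rule contract_invariant[where h = "blinfun_apply A" and
          B = "\<lambda>u u'. contract (\<lambda>w w'. alt3_apply \<theta> (?g x) u w * alt3_apply \<theta> (?g y) u' w')"])
      (rule linear_contract linear_mult_left linear_mult_right alt3_linear Sp_inv[OF A] inv_Sp_inverse[OF A])+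
  finally show ?thesis .
qed

lemma contraction_map_act:
  assumes A: "A \<in> Sp \<Omega>"
  shows "contraction_map (act A \<theta>) (A x) = A (contraction_map \<theta> x)"
  by (rule Om_eq_all) (simp add: Sp_Om_inv[OF A] Om_contraction_map contraction_form_act[OF A] inv_Sp_inverse[OF A])

lemma primitive_part_act:
  assumes A: "A \<in> Sp \<Omega>"
  shows "primitive_part (act A \<theta>) = act A (primitive_part \<theta>)"
  by (rule alt3_eqI)
    (simp add: primitive_part_def alt3_apply_act_Sp[OF A] omega_wedge_apply trace_vector_act[OF A] Sp_inv(2)[OF A] Sp_Om_inv[OF A])

lemma covariant_act:
  assumes A: "A \<in> Sp \<Omega>"
  shows "covariant (act A \<theta>) i = A (covariant \<theta> i)"
  by (induction i) (simp_all add: trace_vector_act[OF A] primitive_part_act[OF A] contraction_map_act[OF A])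

subsection \<open>Polynomiality\<close>

lemma real_polynomial_function_Om_left:
  "polynomial_function f \<Longrightarrow> real_polynomial_function (\<lambda>\<theta>. \<Omega> (f \<theta>) v)"
  using bounded_linear_Om(2) unfolding polynomial_function_def o_def by blast

lemma real_polynomial_function_Om:
  assumes "polynomial_function f" "polynomial_function g"
  shows "real_polynomial_function (\<lambda>\<theta>. \<Omega> (f \<theta>) (g \<theta>))"
proof -
  have "\<Omega> u v = (\<Sum>i<n. \<Omega> v (q i) * \<Omega> u (p i) - \<Omega> v (p i) * \<Omega> u (q i))" for u v
    using linear_expand[OF Om_linear(2), of u v] by simp
  then have eq: "(\<lambda>\<theta>. \<Omega> (f \<theta>) (g \<theta>)) = (\<lambda>\<theta>. \<Sum>i<n. \<Omega> (g \<theta>) (q i) * \<Omega> (f \<theta>) (p i) - \<Omega> (g \<theta>) (p i) * \<Omega> (f \<theta>) (q i))"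
    by (intro ext)
  show ?thesis
    unfolding eq
    by (intro real_polynomial_function_sum finite_lessThan real_polynomial_function_diff
        real_polynomial_function.intros(4) real_polynomial_function_Om_left assms)
qed

lemma real_polynomial_function_contract:
  "(\<And>u w. real_polynomial_function (\<lambda>\<theta>. B \<theta> u w)) \<Longrightarrow> real_polynomial_function (\<lambda>\<theta>. contract (B \<theta>))"
  unfolding contract_def by (intro real_polynomial_function_sum finite_lessThan real_polynomial_function_diff)

lemma polynomial_function_sharp:
  "(\<And>u. real_polynomial_function (\<lambda>\<theta>. f \<theta> u)) \<Longrightarrow> polynomial_function (\<lambda>\<theta>. sharp (f \<theta>))"
  unfolding sharp_def real_polynomial_function_eq
  by (intro polynomial_function_sum finite_lessThan polynomial_function_diff polynomial_function_mult polynomial_function_const)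

lemma polynomial_function_trace_vector: "polynomial_function trace_vector"
  unfolding trace_vector_def
  by (intro polynomial_function_sharp real_polynomial_function_contract real_polynomial_function_alt3_apply
      polynomial_function_id polynomial_function_const)

lemma real_polynomial_function_primitive_part_apply:
  assumes "polynomial_function f" "polynomial_function g" "polynomial_function h"
  shows "real_polynomial_function (\<lambda>\<theta>. alt3_apply (primitive_part \<theta>) (f \<theta>) (g \<theta>) (h \<theta>))"
  unfolding primitive_part_def alt3_apply_lin omega_wedge_apply
  by (intro real_polynomial_function_diff real_polynomial_function.intros(3) real_polynomial_function.intros(4)
      real_polynomial_function_Om real_polynomial_function_alt3_apply polynomial_function_id polynomial_function_cmul
      polynomial_function_trace_vector assms)

lemma polynomial_function_covariant: "polynomial_function (\<lambda>\<theta>. covariant \<theta> i)"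
proof (induction i)
  case 0
  then show ?case by (simp add: polynomial_function_trace_vector)
next
  case (Suc i)
  then show ?case
    unfolding covariant.simps contraction_map_def contraction_form_def
    by (intro polynomial_function_sharp real_polynomial_function_contract real_polynomial_function.intros(4)
        real_polynomial_function_primitive_part_apply polynomial_function_const)
qed

lemma covariant_has_derivative:
  "((\<lambda>\<theta>. covariant \<theta> i) has_derivative frechet_derivative (\<lambda>\<theta>. covariant \<theta> i) (at \<theta>)) (at \<theta>)"
  using differentiable_at_polynomial_function[OF polynomial_function_covariant] frechet_derivative_works by blast

text \<open>Equivariance under the group, differentiated along transvections and then polarised.\<close>

lemma covariant_derivative_infinitesimal_act:
  "frechet_derivative (\<lambda>\<theta>. covariant \<theta> i) (at \<theta>) (infinitesimal_act (sym2 a b) \<theta>) = sym2 a b (covariant \<theta> i)"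
proof -
  let ?D = "frechet_derivative (\<lambda>\<theta>. covariant \<theta> i) (at \<theta>)"
  have sq: "?D (infinitesimal_act (sym2 a a) \<theta>) = sym2 a a (covariant \<theta> i)" for a
  proof -
    let ?c = "\<lambda>t. act (id_blinfun + t *\<^sub>R sym2 a a) \<theta>"
    have "((\<lambda>t. covariant (?c t) i) has_derivative (\<lambda>t. ?D (t *\<^sub>R infinitesimal_act (sym2 a a) \<theta>))) (at 0)"
      by (rule derivative_along_transvection) (rule covariant_has_derivative)
    moreover have "covariant (?c t) i = covariant \<theta> i + t *\<^sub>R sym2 a a (covariant \<theta> i)" for t
      by (simp add: covariant_act[OF transvection_Sp] blinfun.add_left blinfun.scaleR_left)
    ultimately have "((\<lambda>t. covariant \<theta> i + t *\<^sub>R sym2 a a (covariant \<theta> i)) has_derivative (\<lambda>t. ?D (t *\<^sub>R infinitesimal_act (sym2 a a) \<theta>))) (at 0)"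
      by simp
    moreover have "((\<lambda>t. covariant \<theta> i + t *\<^sub>R sym2 a a (covariant \<theta> i)) has_derivative (\<lambda>t. t *\<^sub>R sym2 a a (covariant \<theta> i))) (at 0)"
      by (auto intro!: derivative_eq_intros)
    ultimately have "(\<lambda>t. ?D (t *\<^sub>R infinitesimal_act (sym2 a a) \<theta>)) = (\<lambda>t. t *\<^sub>R sym2 a a (covariant \<theta> i))"
      by (rule has_derivative_unique)
    then have "?D (1 *\<^sub>R infinitesimal_act (sym2 a a) \<theta>) = 1 *\<^sub>R sym2 a a (covariant \<theta> i)" by (rule fun_cong)
    then show ?thesis by simp
  qed
  have lin: "linear ?D" using covariant_has_derivative by (rule has_derivative_linear)
  have "?D (infinitesimal_act (sym2 a b) \<theta>) =
      (1 / 2) *\<^sub>R (sym2 (a + b) (a + b) (covariant \<theta> i) - sym2 a a (covariant \<theta> i) - sym2 b b (covariant \<theta> i))"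
    unfolding infinitesimal_act_sym2_polarize[of a b] linear_scale[OF lin] linear_diff[OF lin] sq ..
  also have "\<dots> = sym2 a b (covariant \<theta> i)"
    by (subst (4) sym2_polarize) (simp only: blinfun.scaleR_left blinfun.diff_left)
  finally show ?thesis .
qed

section \<open>Coordinates on the symplectic Lie algebra\<close>

text \<open>A general element of the Lie algebra in the coordinates given by the products of basis vectors, with
  the coefficients outside \<open>R\<close> set to zero.\<close>

definition sp_combination :: "(nat \<times> nat) set \<Rightarrow> (nat \<times> nat \<Rightarrow> real) \<Rightarrow> 'a \<Rightarrow>\<^sub>L 'a" where
  "sp_combination R c = (\<Sum>z\<in>R. c z *\<^sub>R sym2 (e (fst z)) (e (snd z)))"

abbreviation pairs :: "(nat \<times> nat) set" where
  "pairs \<equiv> {(x, y). x \<le> y \<and> y < 2 * n}"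

lemma finite_pairs: "finite pairs"
  by (rule finite_subset[of _ "{..<2 * n} \<times> {..<2 * n}"]) auto

lemma card_pairs: "card pairs = n * (2 * n + 1)"
proof -
  have "finite {(x, y). x \<le> y \<and> y < (d::nat)} \<and> 2 * card {(x, y). x \<le> y \<and> y < d} = d * (d + 1)" for d
  proof (induction d)
    case (Suc d)
    have "{(x, y). x \<le> y \<and> y < Suc d} = {(x, y). x \<le> y \<and> y < d} \<union> (\<lambda>x. (x, d)) ` {..d}"
      by auto
    moreover have "card ((\<lambda>x. (x, d)) ` {..d}) = Suc d" by (subst card_image) (auto simp: inj_on_def)
    moreover have "{(x, y). x \<le> y \<and> y < d} \<inter> (\<lambda>x. (x, d)) ` {..d} = {}" by auto
    ultimately show ?case using Suc by (simp add: card_Un_disjoint)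
  qed auto
  from this[of "2 * n"] show ?thesis by simp
qed

lemma sp_combination_coefficient:
  assumes R: "R \<subseteq> pairs" and xy: "x \<le> y" "y < 2 * n"
  shows "\<Omega> (sp_combination R c (e (dual_index x))) (e (dual_index y)) =
    (if (x, y) \<in> R then orientation x * orientation y * (if x = y then 2 else 1) * c (x, y) else 0)"
proof -
  have fin: "finite R" using R finite_pairs finite_subset by blast
  have Oe: "\<Omega> (e a) (e (dual_index b)) = (if a = b then orientation b else 0)" if "a < 2 * n" "b < 2 * n" for a b
    using that dual_index_dual_index[of a] dual_index_dual_index[of b] by (auto simp: Om_e dual_index_less)
  have "\<Omega> (sp_combination R c (e (dual_index x))) (e (dual_index y)) = (\<Sum>z\<in>R. c z * \<Omega> (sym2 (e (fst z)) (e (snd z)) (e (dual_index x))) (e (dual_index y)))"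
    by (simp add: sp_combination_def blinfun.sum_left blinfun.scaleR_left)
  also have "\<dots> = (\<Sum>z\<in>R. if z = (x, y) then orientation x * orientation y * (if x = y then 2 else 1) * c z else 0)"
  proof (rule sum.cong)
    fix z assume "z \<in> R"
    then obtain a b where z: "z = (a, b)" "a \<le> b" "b < 2 * n" using R by auto
    show "c z * \<Omega> (sym2 (e (fst z)) (e (snd z)) (e (dual_index x))) (e (dual_index y)) =
        (if z = (x, y) then orientation x * orientation y * (if x = y then 2 else 1) * c z else 0)"
      using z xy by (auto simp: sym2_apply Oe)
  qed simp
  finally show ?thesis using fin by simp
qed

lemma sp_combination_symmetric: "\<Omega> (sp_combination R c u) v = \<Omega> (sp_combination R c v) u"
  unfolding sp_combination_def blinfun.sum_left Om_lin
  by (rule sum.cong) (simp_all add: blinfun.scaleR_left sym2_apply algebra_simps)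

text \<open>Each summand pairs a basis vector with the image of its partner; each half of the symmetric products
  adds up to \<open>- A\<close>, which accounts for the factor.\<close>

lemma sp_spanned_by_sym2:
  assumes "A \<in> sp \<Omega>"
  shows "A = (- 1 / 2) *\<^sub>R (\<Sum>i<n. sym2 (q i) (A (p i)) - sym2 (p i) (A (q i)))"
proof (rule blinfun_eqI)
  fix x
  have sk: "\<Omega> (A u) v = \<Omega> (A v) u" for u v
    using assms Om_skew[of "A v" u] by (simp add: sp_def)
  have "(\<Sum>i<n. sym2 (q i) (A (p i)) - sym2 (p i) (A (q i))) x =
    (\<Sum>i<n. (\<Omega> (q i) x *\<^sub>R A (p i) - \<Omega> (p i) x *\<^sub>R A (q i)) - (\<Omega> (A x) (q i) *\<^sub>R p i - \<Omega> (A x) (p i) *\<^sub>R q i))"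
    unfolding blinfun.sum_left
    by (rule sum.cong) (simp_all add: blinfun.diff_left sym2_apply sk[of "p _" x] sk[of "q _" x])
  also have "\<dots> = (\<Sum>i<n. \<Omega> (q i) x *\<^sub>R A (p i) - \<Omega> (p i) x *\<^sub>R A (q i)) - A x"
    unfolding sum_subtractf[of _ "\<lambda>i. \<Omega> (A x) (q i) *\<^sub>R p i - \<Omega> (A x) (p i) *\<^sub>R q i"] by (simp only: expand[of "A x", symmetric])
  also have "(\<Sum>i<n. \<Omega> (q i) x *\<^sub>R A (p i) - \<Omega> (p i) x *\<^sub>R A (q i)) = - (\<Sum>i<n. \<Omega> x (q i) *\<^sub>R A (p i) - \<Omega> x (p i) *\<^sub>R A (q i))"
    unfolding sum_negf[symmetric] by (rule sum.cong) (simp_all add: Om_skew[of x "q _"] Om_skew[of x "p _"])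
  also have "(\<Sum>i<n. \<Omega> x (q i) *\<^sub>R A (p i) - \<Omega> x (p i) *\<^sub>R A (q i)) = A x"
    by (rule linear_expand[symmetric]) (rule bounded_linear.linear[OF blinfun.bounded_linear_right])
  also have "- A x - A x = (- 2) *\<^sub>R A x" by (metis (no_types) diff_minus_eq_add minus_diff_eq scaleR_2 scaleR_minus_left)
  finally show "A x = ((- 1 / 2) *\<^sub>R (\<Sum>i<n. sym2 (q i) (A (p i)) - sym2 (p i) (A (q i)))) x"
    by (simp only: blinfun.scaleR_left) simp
qed

definition orbit_directions :: "'a alt3 \<Rightarrow> 'a alt3 set" where
  "orbit_directions \<theta> = (\<lambda>(x, y). infinitesimal_act (sym2 (e x) (e y)) \<theta>) ` pairs"

text \<open>By bilinearity of the symmetric product, the images \<open>A (p i)\<close> and \<open>A (q i)\<close> can be replaced by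
  basis vectors.\<close>

lemma infinitesimal_act_sp_in_span:
  assumes "A \<in> sp \<Omega>"
  shows "infinitesimal_act A \<theta> \<in> span (orbit_directions \<theta>)"
proof -
  let ?S = "span (orbit_directions \<theta>)"
  have lin: "linear (\<lambda>b. infinitesimal_act (sym2 a b) \<theta>)" for a
  proof -
    have "sym2 a (b + b') = sym2 a b + sym2 a b'" "sym2 a (c *\<^sub>R b) = c *\<^sub>R sym2 a b" for b b' c
      by (rule blinfun_eqI; simp add: sym2_apply blinfun.add_left blinfun.scaleR_left algebra_simps)+
    then show ?thesis
      by (intro linearI) (simp_all only: linear_add[OF infinitesimal_act_linear_left] linear_scale[OF infinitesimal_act_linear_left])
  qed
  have 0: "infinitesimal_act (sym2 (e x) (e y)) \<theta> \<in> ?S" if "x < 2 * n" "y < 2 * n" for x y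
  proof -
    have "(x, y) \<in> pairs \<or> (y, x) \<in> pairs" using that by auto
    then have "infinitesimal_act (sym2 (e x) (e y)) \<theta> \<in> orbit_directions \<theta> \<or> infinitesimal_act (sym2 (e y) (e x)) \<theta> \<in> orbit_directions \<theta>"
      unfolding orbit_directions_def by force
    then show ?thesis using span_base sym2_commute by metis
  qed
  have ext: "f b \<in> ?S" if "linear f" "\<And>x. x < 2 * n \<Longrightarrow> f (e x) \<in> ?S" for f b
  proof -
    have "span (e ` {..<2 * n}) \<subseteq> f -` ?S"
      by (rule span_minimal) (use that linear_subspace_vimage[OF _ subspace_span] in auto)
    then show ?thesis using span_e by auto
  qed
  have 1: "infinitesimal_act (sym2 (e x) b) \<theta> \<in> ?S" if "x < 2 * n" for x b
    by (rule ext[OF lin]) (rule 0[OF that])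
  have 2: "infinitesimal_act (sym2 a b) \<theta> \<in> ?S" for a b
    unfolding sym2_commute[of a b] by (rule ext[OF lin]) (subst sym2_commute, rule 1)
  have "infinitesimal_act A \<theta> = (- 1 / 2) *\<^sub>R (\<Sum>i<n. infinitesimal_act (sym2 (q i) (A (p i))) \<theta> - infinitesimal_act (sym2 (p i) (A (q i))) \<theta>)"
    by (subst sp_spanned_by_sym2[OF assms])
      (simp only: linear_scale[OF infinitesimal_act_linear_left] linear_sum[OF infinitesimal_act_linear_left] linear_diff[OF infinitesimal_act_linear_left])
  then show ?thesis by (simp only:) (intro span_scale span_sum span_diff 2)
qed

text \<open>If an element of the Lie algebra stabilises the form, then by equivariance it annihilates every
  covariant vector. This is the tool for bounding stabilisers.\<close>

lemma sp_combination_annihilates_covariant: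
  assumes "infinitesimal_act (sp_combination R c) \<theta> = 0"
  shows "sp_combination R c (covariant \<theta> i) = 0"
proof -
  let ?D = "frechet_derivative (\<lambda>\<theta>. covariant \<theta> i) (at \<theta>)"
  have lin: "linear ?D" using covariant_has_derivative by (rule has_derivative_linear)
  have "infinitesimal_act (sp_combination R c) \<theta> = (\<Sum>z\<in>R. c z *\<^sub>R infinitesimal_act (sym2 (e (fst z)) (e (snd z))) \<theta>)"
    unfolding sp_combination_def linear_sum[OF infinitesimal_act_linear_left] linear_scale[OF infinitesimal_act_linear_left] ..
  then have "?D (infinitesimal_act (sp_combination R c) \<theta>) = (\<Sum>z\<in>R. c z *\<^sub>R sym2 (e (fst z)) (e (snd z)) (covariant \<theta> i))"
    by (simp only: linear_sum[OF lin] linear_scale[OF lin] covariant_derivative_infinitesimal_act)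
  also have "\<dots> = sp_combination R c (covariant \<theta> i)"
    by (simp only: sp_combination_def blinfun.sum_left blinfun.scaleR_left)
  finally show ?thesis using linear_0[OF lin] by (simp only: assms)
qed

text \<open>The hypothesis says that the span of the products indexed by \<open>R\<close> meets the stabiliser of
  \<open>\<theta>\<close> trivially, so the cardinality of \<open>R\<close> bounds the dimension of the orbit from below.\<close>

lemma invariant_counts_upper_pairs:
  assumes R: "R \<subseteq> pairs" and k: "k \<in> invariant_counts \<Omega>"
    and inj: "\<And>c z. infinitesimal_act (sp_combination R c) \<theta> = 0 \<Longrightarrow> z \<in> R \<Longrightarrow> c z = 0"
  shows "k + card R \<le> DIM('a) choose 3"
proof -
  have fin: "finite R" using R finite_pairs finite_subset by blast
  obtain r where r: "bij_betw r {..<card R} R"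
    using ex_bij_betw_nat_finite[OF fin] unfolding atLeast0LessThan by blast
  show ?thesis
  proof (rule invariant_counts_upper[OF k, where a = "\<lambda>j. e (fst (r j))" and b = "\<lambda>j. e (snd (r j))"])
    show "independent_family (card R) (\<lambda>j. infinitesimal_act (sym2 (e (fst (r j))) (e (snd (r j)))) \<theta>)"
      unfolding independent_family_def
    proof (intro allI impI)
      fix c :: "nat \<Rightarrow> real" and i
      assume s: "(\<Sum>j<card R. c j *\<^sub>R infinitesimal_act (sym2 (e (fst (r j))) (e (snd (r j)))) \<theta>) = 0" and i: "i < card R"
      \<comment> \<open>The same coefficients, indexed by the pairs themselves.\<close>
      define c' where "c' z = c (inv_into {..<card R} r z)" for z
      have c': "c' (r j) = c j" if "j < card R" for j
        using r that by (simp add: c'_def bij_betw_def inv_into_f_f)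
      have "infinitesimal_act (sp_combination R c') \<theta> = (\<Sum>z\<in>R. c' z *\<^sub>R infinitesimal_act (sym2 (e (fst z)) (e (snd z))) \<theta>)"
        unfolding sp_combination_def linear_sum[OF infinitesimal_act_linear_left] linear_scale[OF infinitesimal_act_linear_left] ..
      also have "\<dots> = (\<Sum>j<card R. c' (r j) *\<^sub>R infinitesimal_act (sym2 (e (fst (r j))) (e (snd (r j)))) \<theta>)"
        by (rule sum.reindex_bij_betw[OF r, symmetric])
      also have "\<dots> = 0" unfolding s[symmetric] by (rule sum.cong) (simp_all add: c')
      finally have "c' (r i) = 0" by (rule inj) (use r i in \<open>auto simp: bij_betw_def\<close>)
      then show "c i = 0" by (simp only: c'[OF i])
    qed
  qed
qed

section \<open>Covariant frames\<close>

lemma span_frame: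
  assumes "independent_family (2 * n) f"
  shows "span (f ` {..<2 * n}) = (UNIV :: 'a set)"
  using card_ge_dim_independent[of "f ` {..<2 * n}" UNIV] independent_family_image[OF assms]
  by (auto simp: dim2n card_image)

lemma linear_on_frame_eq_0:
  fixes h :: "'a \<Rightarrow> real"
  assumes f: "independent_family (2 * n) f" and "linear h" "\<And>i. i < 2 * n \<Longrightarrow> h (f i) = 0"
  shows "h v = 0"
  by (rule linear_eq_0_on_span[OF assms(2), of "f ` {..<2 * n}"]) (use assms(3) span_frame[OF f] in auto)

definition pair_invariant :: "nat \<Rightarrow> nat \<Rightarrow> 'a alt3 \<Rightarrow> real" where
  "pair_invariant i j \<theta> = \<Omega> (covariant \<theta> i) (covariant \<theta> j)"

definition triple_invariant :: "nat \<Rightarrow> nat \<Rightarrow> nat \<Rightarrow> 'a alt3 \<Rightarrow> real" where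
  "triple_invariant i j k \<theta> = alt3_apply \<theta> (covariant \<theta> i) (covariant \<theta> j) (covariant \<theta> k)"

lemma pair_invariant_act: "A \<in> Sp \<Omega> \<Longrightarrow> pair_invariant i j (act A \<theta>) = pair_invariant i j \<theta>"
  by (simp add: pair_invariant_def covariant_act Sp_def)

lemma triple_invariant_act: "A \<in> Sp \<Omega> \<Longrightarrow> triple_invariant i j k (act A \<theta>) = triple_invariant i j k \<theta>"
  by (simp add: triple_invariant_def covariant_act alt3_apply_act_Sp inv_Sp_inverse)

lemma real_polynomial_function_pair_invariant: "real_polynomial_function (pair_invariant i j)"
  unfolding pair_invariant_def by (intro real_polynomial_function_Om polynomial_function_covariant)

lemma real_polynomial_function_triple_invariant: "real_polynomial_function (triple_invariant i j k)"
  unfolding triple_invariant_def by (intro real_polynomial_function_alt3_apply polynomial_function_covariant polynomial_function_id)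

definition covariant_differential :: "'a alt3 \<Rightarrow> nat \<Rightarrow> 'a alt3 \<Rightarrow> 'a" where
  "covariant_differential \<theta> i = frechet_derivative (\<lambda>\<theta>. covariant \<theta> i) (at \<theta>)"

lemma covariant_has_covariant_differential: "((\<lambda>\<theta>. covariant \<theta> i) has_derivative covariant_differential \<theta> i) (at \<theta>)"
  unfolding covariant_differential_def by (rule covariant_has_derivative)

lemma frechet_pair_invariant:
  "frechet_derivative (pair_invariant i j) (at \<theta>) \<eta> = \<Omega> (covariant \<theta> i) (covariant_differential \<theta> j \<eta>) + \<Omega> (covariant_differential \<theta> i \<eta>) (covariant \<theta> j)"
proof -
  have "(pair_invariant i j has_derivative (\<lambda>\<eta>. \<Omega> (covariant \<theta> i) (covariant_differential \<theta> j \<eta>) + \<Omega> (covariant_differential \<theta> i \<eta>) (covariant \<theta> j))) (at \<theta>)"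
    unfolding pair_invariant_def covariant_differential_def
    by (rule bounded_bilinear.FDERIV[OF bounded_bilinear_Om covariant_has_derivative covariant_has_derivative])
  from fun_cong[OF frechet_derivative_at[OF this], of \<eta>] show ?thesis by (rule sym)
qed

lemma frechet_triple_invariant:
  "frechet_derivative (triple_invariant i j k) (at \<theta>) \<eta> =
    alt3_apply \<eta> (covariant \<theta> i) (covariant \<theta> j) (covariant \<theta> k) + alt3_apply \<theta> (covariant_differential \<theta> i \<eta>) (covariant \<theta> j) (covariant \<theta> k) +
    alt3_apply \<theta> (covariant \<theta> i) (covariant_differential \<theta> j \<eta>) (covariant \<theta> k) + alt3_apply \<theta> (covariant \<theta> i) (covariant \<theta> j) (covariant_differential \<theta> k \<eta>)"
proof -
  have "(triple_invariant i j k has_derivative (\<lambda>\<eta>.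
    alt3_apply \<eta> (covariant \<theta> i) (covariant \<theta> j) (covariant \<theta> k) + alt3_apply \<theta> (covariant_differential \<theta> i \<eta>) (covariant \<theta> j) (covariant \<theta> k) +
    alt3_apply \<theta> (covariant \<theta> i) (covariant_differential \<theta> j \<eta>) (covariant \<theta> k) + alt3_apply \<theta> (covariant \<theta> i) (covariant \<theta> j) (covariant_differential \<theta> k \<eta>))) (at \<theta>)"
  proof -
    note product = has_derivative_alt3_apply[of "\<lambda>\<theta>. \<theta>" "\<lambda>\<theta>. \<theta>" \<theta> "\<lambda>\<theta>. covariant \<theta> i" "covariant_differential \<theta> i"
        "\<lambda>\<theta>. covariant \<theta> j" "covariant_differential \<theta> j" "\<lambda>\<theta>. covariant \<theta> k" "covariant_differential \<theta> k"]
    have eq: "triple_invariant i j k = (\<lambda>\<theta>. alt3_apply \<theta> (covariant \<theta> i) (covariant \<theta> j) (covariant \<theta> k))"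
      by (rule ext) (rule triple_invariant_def)
    show ?thesis
      by (subst eq, rule product, rule has_derivative_ident) (rule covariant_has_covariant_differential)+
  qed
  from fun_cong[OF frechet_derivative_at[OF this], of \<eta>] show ?thesis by (rule sym)
qed

text \<open>Let \<open>A\<close> send each frame vector to its derivative in the direction \<open>\<eta>\<close>. The pairings put
  \<open>A\<close> into the Lie algebra, and then the triple products say that \<open>\<eta>\<close> and the infinitesimal action
  of \<open>A\<close> agree on the frame.\<close>

lemma frame_invariants_kernel:
  assumes ind: "independent_family (2 * n) (covariant \<theta>)"
    and 2: "\<And>i j. i < 2 * n \<Longrightarrow> j < 2 * n \<Longrightarrow> frechet_derivative (pair_invariant i j) (at \<theta>) \<eta> = 0"
    and 3: "\<And>i j k. i < 2 * n \<Longrightarrow> j < 2 * n \<Longrightarrow> k < 2 * n \<Longrightarrow> frechet_derivative (triple_invariant i j k) (at \<theta>) \<eta> = 0"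
  shows "\<eta> \<in> span (orbit_directions \<theta>)"
proof -
  let ?f = "covariant \<theta>"
  note im = independent_family_image[OF ind] and ext = linear_on_frame_eq_0[OF ind]
  obtain g where g: "linear g" "\<forall>x\<in>?f ` {..<2 * n}. g x = covariant_differential \<theta> (inv_into {..<2 * n} ?f x) \<eta>"
    using linear_independent_extend[OF im(2), of "\<lambda>x. covariant_differential \<theta> (inv_into {..<2 * n} ?f x) \<eta>"] by blast
  define A where "A = Blinfun g"
  have A: "blinfun_apply A = g"
    unfolding A_def by (rule bounded_linear_Blinfun_apply) (use g(1) in \<open>simp add: linear_conv_bounded_linear\<close>)
  have Af: "A (?f i) = covariant_differential \<theta> i \<eta>" if "i < 2 * n" for i
    using g(2) that im(1) by (simp add: A inv_into_f_f)
  have linA: "linear (\<lambda>u. A u)" using g(1) by (simp add: A)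
  have "\<Omega> (A u) v + \<Omega> u (A v) = 0" for u v
  proof -
    have 0: "\<Omega> (A (?f i)) (?f j) + \<Omega> (?f i) (A (?f j)) = 0" if "i < 2 * n" "j < 2 * n" for i j
      using 2[OF that] that by (simp add: frechet_pair_invariant Af add.commute)
    have 1: "\<Omega> (A (?f i)) v + \<Omega> (?f i) (A v) = 0" if "i < 2 * n" for i v
      by (rule ext[where h = "\<lambda>v. \<Omega> (A (?f i)) v + \<Omega> (?f i) (A v)"])
        (use 0 that in \<open>simp_all add: linear_iff blinfun.add_right blinfun.scaleR_right algebra_simps\<close>)
    show ?thesis
      by (rule ext[where h = "\<lambda>u. \<Omega> (A u) v + \<Omega> u (A v)"])
        (use 1 in \<open>simp_all add: linear_iff blinfun.add_right blinfun.scaleR_right algebra_simps\<close>)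
  qed
  then have sp: "A \<in> sp \<Omega>" by (simp add: sp_def eq_neg_iff_add_eq_0)
  \<comment> \<open>The difference vanishes on triples of frame vectors, hence everywhere.\<close>
  define \<zeta> where "\<zeta> = \<eta> - infinitesimal_act A \<theta>"
  have z0: "alt3_apply \<zeta> (?f i) (?f j) (?f k) = 0" if "i < 2 * n" "j < 2 * n" "k < 2 * n" for i j k
    using 3[OF that] that by (simp add: frechet_triple_invariant \<zeta>_def infinitesimal_act.rep_eq Af)
  have z1: "alt3_apply \<zeta> (?f i) (?f j) w = 0" if "i < 2 * n" "j < 2 * n" for i j w
    by (rule ext[OF alt3_linear(3)]) (rule z0[OF that])
  have z2: "alt3_apply \<zeta> (?f i) v w = 0" if "i < 2 * n" for i v w
    by (rule ext[OF alt3_linear(2)]) (rule z1[OF that])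
  have "alt3_apply \<zeta> u v w = 0" for u v w
    by (rule ext[OF alt3_linear(1)]) (rule z2)
  then have "\<zeta> = 0" by (intro alt3_eqI) simp
  then have "\<eta> = infinitesimal_act A \<theta>" by (simp add: \<zeta>_def)
  then show ?thesis using infinitesimal_act_sp_in_span[OF sp] by simp
qed

text \<open>An element that stabilises the form annihilates the frame, hence is zero.\<close>

lemma frame_upper:
  assumes ind: "independent_family (2 * n) (covariant \<theta>)" and k: "k \<in> invariant_counts \<Omega>"
  shows "k + n * (2 * n + 1) \<le> DIM('a) choose 3"
  unfolding card_pairs[symmetric]
proof (rule invariant_counts_upper_pairs[OF order_refl k, where \<theta> = \<theta>])
  fix c z assume z: "infinitesimal_act (sp_combination pairs c) \<theta> = 0" "z \<in> pairs"
  obtain x y where xy: "z = (x, y)" "x \<le> y" "y < 2 * n" using z(2) by auto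
  have "\<Omega> (sp_combination pairs c u) v = 0" for u v
  proof (rule linear_on_frame_eq_0[OF ind, where h = "\<lambda>u. \<Omega> (sp_combination pairs c u) v"])
    show "linear (\<lambda>u. \<Omega> (sp_combination pairs c u) v)"
      by (simp add: linear_iff blinfun.add_right blinfun.scaleR_right)
  qed (simp add: sp_combination_annihilates_covariant[OF z(1)])
  then have "orientation x * orientation y * (if x = y then 2 else 1) * c (x, y) = 0"
    using sp_combination_coefficient[OF order_refl xy(2,3), of c] xy by simp
  then show "c z = 0" using xy(1) orientation_nonzero by (simp split: if_splits)
qed

text \<open>A maximal independent subfamily of the differentials has the same common kernel as all of them. Its
  dual vectors and the orbit directions therefore span all 3-forms, which bounds its size from below.\<close>

lemma frame_lower:
  assumes ind: "independent_family (2 * n) (covariant \<theta>)"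
  shows "(DIM('a) choose 3) - n * (2 * n + 1) \<in> invariant_counts \<Omega>"
proof -
  define Inv where "Inv = case_sum (\<lambda>(i, j). pair_invariant i j) (\<lambda>(i, j, k). triple_invariant i j k)"
  define F :: "(nat \<times> nat + nat \<times> nat \<times> nat) set" where
    "F = ({..<2 * n} \<times> {..<2 * n}) <+> ({..<2 * n} \<times> {..<2 * n} \<times> {..<2 * n})"
  define \<phi> where "\<phi> \<tau> = frechet_derivative (Inv \<tau>) (at \<theta>)" for \<tau>
  have poly: "real_polynomial_function (Inv \<tau>)" for \<tau>
    by (auto simp: Inv_def real_polynomial_function_pair_invariant real_polynomial_function_triple_invariant split: sum.split)
  have inv: "Inv \<tau> (act A \<theta>) = Inv \<tau> \<theta>" if "A \<in> Sp \<Omega>" for \<tau> A \<theta>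
    by (auto simp: Inv_def pair_invariant_act[OF that] triple_invariant_act[OF that] split: sum.split)
  have lin: "linear (\<phi> \<tau>)" for \<tau>
    unfolding \<phi>_def
    using real_polynomial_function_differentiable[OF poly] frechet_derivative_works has_derivative_linear by blast
  have "\<exists>B \<psi>. B \<subseteq> F \<and> (\<forall>i\<in>B. \<forall>j\<in>B. \<phi> i (\<psi> j) = (if i = j then 1 else 0)) \<and>
     (\<forall>x. (\<forall>i\<in>B. \<phi> i x = 0) \<longrightarrow> (\<forall>i\<in>F. \<phi> i x = 0))"
    by (rule dual_vectors) (simp_all add: F_def lin)
  then obtain B \<psi> where B: "B \<subseteq> F" "\<forall>i\<in>B. \<forall>j\<in>B. \<phi> i (\<psi> j) = (if i = j then 1 else 0)"
     "\<forall>x. (\<forall>i\<in>B. \<phi> i x = 0) \<longrightarrow> (\<forall>i\<in>F. \<phi> i x = 0)" by (elim exE conjE)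
  have finF: "finite F" by (simp add: F_def)
  then have finB: "finite B" using B(1) finite_subset by blast
  have ker: "\<eta> \<in> span (orbit_directions \<theta>)" if "\<forall>i\<in>B. \<phi> i \<eta> = 0" for \<eta>
  proof -
    have F0: "\<forall>i\<in>F. \<phi> i \<eta> = 0" using B(3) that by blast
    show ?thesis
    proof (rule frame_invariants_kernel[OF ind])
      show "frechet_derivative (pair_invariant i j) (at \<theta>) \<eta> = 0" if "i < 2 * n" "j < 2 * n" for i j
      proof -
        have "Inl (i, j) \<in> F" unfolding F_def by (rule InlI) (simp add: that)
        then show ?thesis using F0 by (auto simp: \<phi>_def Inv_def)
      qed
      show "frechet_derivative (triple_invariant i j k) (at \<theta>) \<eta> = 0" if "i < 2 * n" "j < 2 * n" "k < 2 * n" for i j k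
      proof -
        have "Inr (i, j, k) \<in> F" unfolding F_def by (rule InrI) (simp add: that)
        then show ?thesis using F0 by (auto simp: \<phi>_def Inv_def)
      qed
    qed
  qed
  have span: "\<eta> \<in> span (\<psi> ` B \<union> orbit_directions \<theta>)" for \<eta>
  proof -
    \<comment> \<open>The projection to the span of the dual vectors along the common kernel.\<close>
    define \<xi> where "\<xi> = (\<Sum>j\<in>B. \<phi> j \<eta> *\<^sub>R \<psi> j)"
    have "\<phi> i (\<eta> - \<xi>) = 0" if "i \<in> B" for i
    proof -
      have "(\<Sum>j\<in>B. \<phi> j \<eta> * \<phi> i (\<psi> j)) = (\<Sum>j\<in>B. if i = j then \<phi> j \<eta> else 0)"
        by (rule sum.cong) (use B(2) that in auto)
      then show ?thesis
        using that finB by (simp add: \<xi>_def linear_diff[OF lin] linear_sum[OF lin] linear_scale[OF lin])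
    qed
    then have "\<eta> - \<xi> \<in> span (orbit_directions \<theta>)" using ker by blast
    then have 1: "\<eta> - \<xi> \<in> span (\<psi> ` B \<union> orbit_directions \<theta>)" using span_mono[of "orbit_directions \<theta>"] by blast
    have "\<xi> \<in> span (\<psi> ` B \<union> orbit_directions \<theta>)"
      unfolding \<xi>_def by (intro span_sum span_scale span_base) auto
    from span_add[OF 1 this] show ?thesis by simp
  qed
  obtain T :: "'a alt3 set" where T: "finite T" "span T = UNIV" "independent T" "card T = DIM('a) choose 3"
    by (rule alt3_basis)
  have finO: "finite (orbit_directions \<theta>)" and cardO: "card (orbit_directions \<theta>) \<le> n * (2 * n + 1)"
    unfolding orbit_directions_def card_pairs[symmetric] using finite_pairs by (auto intro: card_image_le)
  have "card T \<le> card (\<psi> ` B \<union> orbit_directions \<theta>)"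
    using independent_span_bound[of "\<psi> ` B \<union> orbit_directions \<theta>" T] finB finO T(3) span by blast
  also have "\<dots> \<le> card (\<psi> ` B) + card (orbit_directions \<theta>)" by (rule card_Un_le)
  also have "\<dots> \<le> card B + n * (2 * n + 1)" using card_image_le[OF finB] cardO by (intro add_mono)
  finally have kB: "(DIM('a) choose 3) - n * (2 * n + 1) \<le> card B" (is "?k \<le> _") by (simp add: T(4))
  obtain b where b: "bij_betw b {..<card B} B"
    using ex_bij_betw_nat_finite[OF finB] unfolding atLeast0LessThan by blast
  have bB: "b i \<in> B" if "i < ?k" for i
  proof -
    have "i < card B" using that kB by (rule less_le_trans)
    then show ?thesis using b by (auto simp: bij_betw_def)
  qed
  have binj: "b i = b j \<longleftrightarrow> i = j" if "i < ?k" "j < ?k" for i j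
  proof -
    have "i < card B" "j < card B" using that kB less_le_trans by blast+
    then show ?thesis using b by (auto simp: bij_betw_def inj_on_def)
  qed
  show ?thesis
  proof (rule invariant_counts_lower[where I = "\<lambda>i. Inv (b i)" and ?x0.0 = \<theta>])
    fix c :: "nat \<Rightarrow> real"
    assume c: "\<forall>v. (\<Sum>i<?k. c i * frechet_derivative (Inv (b i)) (at \<theta>) v) = 0"
    show "\<forall>i<?k. c i = 0"
    proof (intro allI impI)
      fix l assume l: "l < ?k"
      have "0 = (\<Sum>i<?k. c i * \<phi> (b i) (\<psi> (b l)))" using c by (simp add: \<phi>_def)
      also have "\<dots> = (\<Sum>i<?k. if i = l then c i else 0)"
        by (rule sum.cong) (use B(2) bB l binj in auto)
      also have "\<dots> = c l" using l by (simp only: sum_if_eq_less if_True)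
      finally show "c l = 0" by simp
    qed
  qed (rule poly inv; assumption)+
qed

section \<open>A chain of decomposable forms\<close>

lemma contract_Om_Om: "contract (\<lambda>u w. \<Omega> a u * \<Omega> b w) = \<Omega> a b"
  by (rule contract_Om_right) (rule Om_linear)

lemma trace_vector_decomposable:
  assumes "\<Omega> a b = 0" "\<Omega> b c = 0" "\<Omega> c a = 0"
  shows "trace_vector (decomposable a b c) = 0"
proof (rule Om_eq_all)
  fix z
  have "\<Omega> b a = 0" "\<Omega> c b = 0" "\<Omega> a c = 0" using assms Om_skew[of b a] Om_skew[of c b] Om_skew[of a c] by simp_all
  moreover have "alt3_apply (decomposable a b c) u w z = \<Omega> c z * (\<Omega> a u * \<Omega> b w) - \<Omega> b z * (\<Omega> a u * \<Omega> c w) +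
      (\<Omega> a z * (\<Omega> b u * \<Omega> c w) - \<Omega> c z * (\<Omega> b u * \<Omega> a w)) +
      (\<Omega> b z * (\<Omega> c u * \<Omega> a w) - \<Omega> a z * (\<Omega> c u * \<Omega> b w))" for u w
    by (simp add: decomposable_apply algebra_simps)
  ultimately show "\<Omega> (trace_vector (decomposable a b c)) z = \<Omega> 0 z"
    by (simp add: Om_trace_vector contract_add contract_diff contract_cmult contract_Om_Om assms)
qed

text \<open>Contraction against a covector \<open>\<Omega> b\<close> substitutes \<open>b\<close>, so each of the three expansions of
  the decomposable form contributes twice.\<close>

lemma double_contraction_decomposable:
  "contract (\<lambda>u u'. contract (\<lambda>w w'. alt3_apply \<theta> x u w * alt3_apply (decomposable a b c) y u' w')) =
    2 * (\<Omega> a y * alt3_apply \<theta> x b c + \<Omega> b y * alt3_apply \<theta> x c a + \<Omega> c y * alt3_apply \<theta> x a b)"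
proof -
  have 1: "contract (\<lambda>w w'. alt3_apply \<theta> x u w * alt3_apply (decomposable a b c) y u' w') =
     \<Omega> a y * (alt3_apply \<theta> x u c * \<Omega> b u') - \<Omega> a y * (alt3_apply \<theta> x u b * \<Omega> c u') +
     (\<Omega> b y * (alt3_apply \<theta> x u a * \<Omega> c u') - \<Omega> b y * (alt3_apply \<theta> x u c * \<Omega> a u')) +
     (\<Omega> c y * (alt3_apply \<theta> x u b * \<Omega> a u') - \<Omega> c y * (alt3_apply \<theta> x u a * \<Omega> b u'))" for u u'
  proof -
    have "alt3_apply \<theta> x u w * alt3_apply (decomposable a b c) y u' w' =
     (\<Omega> a y * \<Omega> b u') * (alt3_apply \<theta> x u w * \<Omega> c w') - (\<Omega> a y * \<Omega> c u') * (alt3_apply \<theta> x u w * \<Omega> b w') +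
     ((\<Omega> b y * \<Omega> c u') * (alt3_apply \<theta> x u w * \<Omega> a w') - (\<Omega> b y * \<Omega> a u') * (alt3_apply \<theta> x u w * \<Omega> c w')) +
     ((\<Omega> c y * \<Omega> a u') * (alt3_apply \<theta> x u w * \<Omega> b w') - (\<Omega> c y * \<Omega> b u') * (alt3_apply \<theta> x u w * \<Omega> a w'))" for w w'
      by (simp add: decomposable_apply algebra_simps)
    then show ?thesis
      by (simp only: contract_add contract_diff contract_cmult contract_Om_right[OF alt3_linear(3)]) (simp add: algebra_simps)
  qed
  show ?thesis
    unfolding 1 contract_add contract_diff contract_cmult contract_Om_right[OF alt3_linear(2)]
    using alt3_swap(2)[of \<theta> x c b] alt3_swap(2)[of \<theta> x a c] alt3_swap(2)[of \<theta> x b a] by (simp add: algebra_simps)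
qed

text \<open>Consecutive triples overlap in at most two indices, and the pattern \<open>p p q\<close>, \<open>q q p\<close> is chosen such that the
  positions \<open>i + 1\<close>, \<open>i + 2\<close> carry opposite types in the \<open>i\<close>-th triples but equal types in the
  next ones. Hence different triples do not interact in the double contraction.\<close>

definition chain :: "(nat \<Rightarrow> real) \<Rightarrow> 'a alt3" where
  "chain \<mu> = (\<Sum>i<n - 2. \<mu> i *\<^sub>R decomposable (p i) (p (i + 1)) (q (i + 2)) + decomposable (q i) (q (i + 1)) (p (i + 2)))"

lemma trace_vector_chain: "trace_vector (chain \<mu>) = 0"
proof -
  have "trace_vector (decomposable (p i) (p (i + 1)) (q (i + 2))) = 0" "trace_vector (decomposable (q i) (q (i + 1)) (p (i + 2))) = 0" if "i < n - 2" for i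
    using that by (auto intro!: trace_vector_decomposable simp: pp qq pq qp)
  then show ?thesis
    by (simp add: chain_def linear_sum[OF linear_trace_vector] linear_add[OF linear_trace_vector] linear_scale[OF linear_trace_vector])
qed

lemma chain_apply:
  "alt3_apply (chain \<mu>) x y z = (\<Sum>j<n - 2. \<mu> j * alt3_apply (decomposable (p j) (p (j + 1)) (q (j + 2))) x y z +
     alt3_apply (decomposable (q j) (q (j + 1)) (p (j + 2))) x y z)"
  by (simp add: chain_def alt3_apply_sum)

text \<open>At most one summand of the chain survives after inserting the two given basis vectors.\<close>

lemma chain_values:
  assumes i: "i < n - 2"
  shows "alt3_apply (chain \<mu>) x (p (i + 1)) (q (i + 2)) = - \<Omega> (q i) x"
    "alt3_apply (chain \<mu>) x (q (i + 2)) (p i) = - \<Omega> (q (i + 1)) x"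
    "alt3_apply (chain \<mu>) x (p i) (p (i + 1)) = \<Omega> (p (i + 2)) x"
    "alt3_apply (chain \<mu>) x (q (i + 1)) (p (i + 2)) = - \<mu> i * \<Omega> (p i) x"
    "alt3_apply (chain \<mu>) x (p (i + 2)) (q i) = - \<mu> i * \<Omega> (p (i + 1)) x"
    "alt3_apply (chain \<mu>) x (q i) (q (i + 1)) = \<mu> i * \<Omega> (q (i + 2)) x"
proof -
  have collapse: "alt3_apply (chain \<mu>) x y z = r"
    if "\<And>j. j < n - 2 \<Longrightarrow> \<mu> j * alt3_apply (decomposable (p j) (p (j + 1)) (q (j + 2))) x y z +
     alt3_apply (decomposable (q j) (q (j + 1)) (p (j + 2))) x y z = (if j = i then r else 0)" for y z r
  proof -
    have "alt3_apply (chain \<mu>) x y z = (\<Sum>j<n - 2. if j = i then r else 0)"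
      unfolding chain_apply by (rule sum.cong) (simp_all only: that lessThan_iff)
    then show ?thesis using i by simp
  qed
  show "alt3_apply (chain \<mu>) x (p (i + 1)) (q (i + 2)) = - \<Omega> (q i) x"
    "alt3_apply (chain \<mu>) x (q (i + 2)) (p i) = - \<Omega> (q (i + 1)) x"
    "alt3_apply (chain \<mu>) x (p i) (p (i + 1)) = \<Omega> (p (i + 2)) x"
    "alt3_apply (chain \<mu>) x (q (i + 1)) (p (i + 2)) = - \<mu> i * \<Omega> (p i) x"
    "alt3_apply (chain \<mu>) x (p (i + 2)) (q i) = - \<mu> i * \<Omega> (p (i + 1)) x"
    "alt3_apply (chain \<mu>) x (q i) (q (i + 1)) = \<mu> i * \<Omega> (q (i + 2)) x"
    by (rule collapse, use i in \<open>auto simp: decomposable_apply pp qq pq qp\<close>)+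
qed

lemma contraction_map_chain:
  "contraction_map (chain \<mu>) x = (\<Sum>i<n - 2. (2 * \<mu> i) *\<^sub>R
    (\<Omega> (p (i + 2)) x *\<^sub>R q (i + 2) + \<Omega> (q (i + 2)) x *\<^sub>R p (i + 2)
     - \<Omega> (q i) x *\<^sub>R p i - \<Omega> (p i) x *\<^sub>R q i - \<Omega> (q (i + 1)) x *\<^sub>R p (i + 1) - \<Omega> (p (i + 1)) x *\<^sub>R q (i + 1)))"
proof (rule Om_eq_all)
  fix y
  let ?\<theta> = "chain \<mu>"
  have "\<Omega> (contraction_map ?\<theta> x) y = contract (\<lambda>u u'. contract (\<lambda>w w'. \<Sum>i<n - 2.
     \<mu> i * (alt3_apply ?\<theta> x u w * alt3_apply (decomposable (p i) (p (i + 1)) (q (i + 2))) y u' w') +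
     alt3_apply ?\<theta> x u w * alt3_apply (decomposable (q i) (q (i + 1)) (p (i + 2))) y u' w'))"
    unfolding Om_contraction_map contraction_form_def chain_apply[of _ y] by (simp add: sum_distrib_left algebra_simps)
  also have "\<dots> = (\<Sum>i<n - 2. \<mu> i * (2 * (\<Omega> (p i) y * alt3_apply ?\<theta> x (p (i + 1)) (q (i + 2)) +
       \<Omega> (p (i + 1)) y * alt3_apply ?\<theta> x (q (i + 2)) (p i) + \<Omega> (q (i + 2)) y * alt3_apply ?\<theta> x (p i) (p (i + 1)))) +
     2 * (\<Omega> (q i) y * alt3_apply ?\<theta> x (q (i + 1)) (p (i + 2)) +
       \<Omega> (q (i + 1)) y * alt3_apply ?\<theta> x (p (i + 2)) (q i) + \<Omega> (p (i + 2)) y * alt3_apply ?\<theta> x (q i) (q (i + 1))))"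
    unfolding contract_sum contract_add contract_cmult double_contraction_decomposable ..
  also have "\<dots> = (\<Sum>i<n - 2. \<Omega> ((2 * \<mu> i) *\<^sub>R
    (\<Omega> (p (i + 2)) x *\<^sub>R q (i + 2) + \<Omega> (q (i + 2)) x *\<^sub>R p (i + 2)
     - \<Omega> (q i) x *\<^sub>R p i - \<Omega> (p i) x *\<^sub>R q i - \<Omega> (q (i + 1)) x *\<^sub>R p (i + 1) - \<Omega> (p (i + 1)) x *\<^sub>R q (i + 1))) y)"
    by (rule sum.cong) (simp_all only: lessThan_iff chain_values Om_lin, simp_all add: algebra_simps)
  finally show "\<Omega> (contraction_map ?\<theta> x) y = \<Omega> (\<Sum>i<n - 2. (2 * \<mu> i) *\<^sub>R
    (\<Omega> (p (i + 2)) x *\<^sub>R q (i + 2) + \<Omega> (q (i + 2)) x *\<^sub>R p (i + 2)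
     - \<Omega> (q i) x *\<^sub>R p i - \<Omega> (p i) x *\<^sub>R q i - \<Omega> (q (i + 1)) x *\<^sub>R p (i + 1) - \<Omega> (p (i + 1)) x *\<^sub>R q (i + 1))) y"
    by (simp only: Om_lin(11))
qed

text \<open>The eigenvalues on the \<open>p\<close>'s: the index \<open>j\<close> occurs in first, second and third position of the
  triples starting at \<open>j\<close>, \<open>j - 1\<close> and \<open>j - 2\<close>, when these exist.\<close>

definition half_spectrum :: "(nat \<Rightarrow> real) \<Rightarrow> nat \<Rightarrow> real" where
  "half_spectrum \<mu> j = 2 * ((if j < n - 2 then \<mu> j else 0) + (if 1 \<le> j \<and> j < n - 1 then \<mu> (j - 1) else 0)
     - (if 2 \<le> j then \<mu> (j - 2) else 0))"

lemma half_spectrum_sum: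
  assumes "j < n"
  shows "half_spectrum \<mu> j = (\<Sum>i<n - 2. 2 * \<mu> i * ((if i = j then 1 else 0) + (if i + 1 = j then 1 else 0) - (if i + 2 = j then 1 else 0)))"
proof -
  have "(\<Sum>i<n - 2. 2 * \<mu> i * ((if i = j then 1 else 0) + (if i + 1 = j then 1 else 0) - (if i + 2 = j then 1 else 0))) =
    (\<Sum>i<n - 2. if i = j then 2 * \<mu> i else 0) + (\<Sum>i<n - 2. if i + 1 = j then 2 * \<mu> i else 0)
      - (\<Sum>i<n - 2. if i + 2 = j then 2 * \<mu> i else 0)"
    unfolding sum.distrib[symmetric] sum_subtractf[symmetric] by (rule sum.cong) auto
  moreover have "(\<Sum>i<n - 2. if i = j then 2 * \<mu> i else 0) = (if j < n - 2 then 2 * \<mu> j else 0)" by simp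
  moreover have "(\<Sum>i<n - 2. if i + 1 = j then 2 * \<mu> i else 0) = (if 1 \<le> j \<and> j < n - 1 then 2 * \<mu> (j - 1) else 0)"
  proof (cases j)
    case (Suc k)
    then show ?thesis using assms by auto
  qed simp
  moreover have "(\<Sum>i<n - 2. if i + 2 = j then 2 * \<mu> i else 0) = (if 2 \<le> j then 2 * \<mu> (j - 2) else 0)"
  proof (cases "2 \<le> j")
    case True
    then obtain k where "j = k + 2" by (metis add.commute le_Suc_ex)
    then show ?thesis using assms by auto
  qed auto
  ultimately show ?thesis by (auto simp: half_spectrum_def)
qed

lemma contraction_map_chain_p:
  assumes "j < n"
  shows "contraction_map (chain \<mu>) (p j) = half_spectrum \<mu> j *\<^sub>R p j"
  unfolding contraction_map_chain half_spectrum_sum[OF assms] scaleR_sum_left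
  by (rule sum.cong) (use assms in \<open>auto simp: pp qp\<close>)

lemma contraction_map_chain_q:
  assumes "j < n"
  shows "contraction_map (chain \<mu>) (q j) = (- half_spectrum \<mu> j) *\<^sub>R q j"
  unfolding contraction_map_chain half_spectrum_sum[OF assms] sum_negf[symmetric] scaleR_sum_left
  by (rule sum.cong) (use assms in \<open>auto simp: qq pq\<close>)

section \<open>Dimension at least eight\<close>

lemma covariant_chain_0: "n \<ge> 2 \<Longrightarrow> covariant (chain \<mu> + omega_wedge a) 0 = (2 * real n - 2) *\<^sub>R a"
  by (simp add: linear_add[OF linear_trace_vector] trace_vector_chain trace_vector_omega_wedge)

lemma covariant_chain_Suc: "n \<ge> 2 \<Longrightarrow> covariant (chain \<mu> + omega_wedge a) (Suc i) = contraction_map (chain \<mu>) (covariant (chain \<mu> + omega_wedge a) i)"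
  by (simp add: primitive_part_add_omega_wedge trace_vector_chain del: One_nat_def)

definition spectrum :: "(nat \<Rightarrow> real) \<Rightarrow> nat \<Rightarrow> real" where
  "spectrum \<mu> x = (if x < n then half_spectrum \<mu> x else - half_spectrum \<mu> (x - n))"

lemma contraction_map_chain_e: "x < 2 * n \<Longrightarrow> contraction_map (chain \<mu>) (e x) = spectrum \<mu> x *\<^sub>R e x"
  by (simp add: e_def spectrum_def contraction_map_chain_p contraction_map_chain_q)

lemma covariant_chain:
  assumes "n \<ge> 2"
  shows "covariant (chain \<mu> + omega_wedge (\<Sum>x<2 * n. e x)) i = (2 * real n - 2) *\<^sub>R (\<Sum>x<2 * n. spectrum \<mu> x ^ i *\<^sub>R e x)"
proof (induction i)
  case 0
  show ?case unfolding covariant_chain_0[OF assms] by simp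
next
  case (Suc i)
  show ?case
    unfolding covariant_chain_Suc[OF assms] Suc linear_scale[OF linear_contraction_map] linear_sum[OF linear_contraction_map]
    by (intro arg_cong[where f = "(*\<^sub>R) _"] sum.cong) (simp_all add: contraction_map_chain_e mult.commute)
qed

text \<open>A linear relation between the iterates is a polynomial of degree less than \<open>2n\<close> that vanishes at
  the \<open>2n\<close> distinct eigenvalues.\<close>

lemma independent_covariant_chain:
  assumes n: "n \<ge> 2" and inj: "inj_on (spectrum \<mu>) {..<2 * n}"
  shows "independent_family (2 * n) (covariant (chain \<mu> + omega_wedge (\<Sum>x<2 * n. e x)))"
  unfolding independent_family_def
proof (intro allI impI)
  fix c :: "nat \<Rightarrow> real" and l
  assume s: "(\<Sum>i<2 * n. c i *\<^sub>R covariant (chain \<mu> + omega_wedge (\<Sum>x<2 * n. e x)) i) = 0" and l: "l < 2 * n"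
  have "(\<Sum>i<2 * n. c i *\<^sub>R covariant (chain \<mu> + omega_wedge (\<Sum>x<2 * n. e x)) i) =
    (2 * real n - 2) *\<^sub>R (\<Sum>i<2 * n. \<Sum>x<2 * n. (c i * spectrum \<mu> x ^ i) *\<^sub>R e x)"
    unfolding covariant_chain[OF n] scaleR_sum_right by (simp add: mult_ac)
  also have "(\<Sum>i<2 * n. \<Sum>x<2 * n. (c i * spectrum \<mu> x ^ i) *\<^sub>R e x) = (\<Sum>x<2 * n. (\<Sum>i<2 * n. c i * spectrum \<mu> x ^ i) *\<^sub>R e x)"
    unfolding scaleR_sum_left by (rule sum.swap)
  finally have "(\<Sum>x<2 * n. (\<Sum>i<2 * n. c i * spectrum \<mu> x ^ i) *\<^sub>R e x) = 0" using s n by simp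
  from independent_familyD[OF independent_e this]
  have root: "(\<Sum>i<2 * n. c i * spectrum \<mu> x ^ i) = 0" if "x < 2 * n" for x using that by blast
  have eq: "{..<2 * n} = {..2 * n - 1}" using n by auto
  show "c l = 0"
  proof (rule ccontr)
    assume "c l \<noteq> 0"
    then have "\<exists>k\<le>2 * n - 1. c k \<noteq> 0" using l by (intro exI[of _ l]) auto
    from polyfun_rootbound[OF this]
    have fin: "finite {z. (\<Sum>i\<le>2 * n - 1. c i * z ^ i) = 0}"
      and card: "card {z. (\<Sum>i\<le>2 * n - 1. c i * z ^ i) = 0} \<le> 2 * n - 1" by blast+
    have "spectrum \<mu> ` {..<2 * n} \<subseteq> {z. (\<Sum>i\<le>2 * n - 1. c i * z ^ i) = 0}"
      unfolding eq[symmetric] using root by auto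
    then have "card (spectrum \<mu> ` {..<2 * n}) \<le> 2 * n - 1" using card_mono[OF fin] card le_trans by blast
    then show False using card_image[OF inj] n by simp
  qed
qed

text \<open>With weights \<open>4\<^sup>i\<close> the leading weight dominates. The absolute values increase up to index
  \<open>n - 3\<close>; the last two are three quarters of \<open>2 \<cdot> 4\<^sup>n\<^sup>-\<^sup>3\<close> and exactly that number, which separates
  them from each other and from the rest.\<close>

lemma half_spectrum_four_powers:
  assumes "4 \<le> n" "i < j" "j < n"
  shows "\<bar>half_spectrum (\<lambda>i. 4 ^ i) i\<bar> \<noteq> \<bar>half_spectrum (\<lambda>i. 4 ^ i) j\<bar>"
    and "half_spectrum (\<lambda>i. 4 ^ i) i \<noteq> 0" "half_spectrum (\<lambda>i. 4 ^ i) j \<noteq> 0"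
proof -
  \<comment> \<open>In terms of \<open>m\<close> the exceptional indices are \<open>m + 2\<close> and \<open>m + 3\<close>.\<close>
  define m where "m = n - 4"
  have n: "n = m + 4" using assms by (simp add: m_def)
  let ?l = "half_spectrum (\<lambda>i. 4 ^ i)"
  define P :: real where "P = 4 ^ m"
  have P: "P > 0" by (simp add: P_def)
  have "n - 2 = m + 2" "n - 1 = m + 3" using n by simp_all
  then have l: "?l j = 2 * ((if j < m + 2 then 4 ^ j else 0) + (if 1 \<le> j \<and> j < m + 3 then 4 ^ (j - 1) else 0)
     - (if 2 \<le> j then 4 ^ (j - 2) else 0))" for j
    by (simp only: half_spectrum_def)
  have bounds: "2 * 4 ^ k \<le> ?l k \<and> ?l k \<le> 5 / 2 * 4 ^ k \<and> (k \<ge> 1 \<longrightarrow> 2 * 4 ^ k < ?l k)" if "k < m + 2" for k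
  proof -
    consider "k = 0" | "k = 1" | r where "k = Suc (Suc r)" by (metis One_nat_def not0_implies_Suc)
    then show ?thesis using that by cases (auto simp: l)
  qed
  have l2: "?l (m + 2) = 6 * P" and l3: "?l (m + 3) = - 8 * P"
    by (simp_all add: l P_def numeral_eq_Suc)
  have pow: "(4::real) ^ a \<le> 4 ^ b" if "a \<le> b" for a b :: nat using that by (simp add: power_increasing)
  have small: "?l k > 0 \<and> ?l k \<le> 5 / 2 * P" if "k \<le> m" for k
  proof -
    have "2 * 4 ^ k \<le> ?l k" "?l k \<le> 5 / 2 * 4 ^ k" using bounds[of k] that by simp_all
    moreover have "(4::real) ^ k \<le> P" unfolding P_def by (rule pow[OF that])
    moreover have "(0::real) < 4 ^ k" by simp
    ultimately show ?thesis by linarith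
  qed
  have m1: "?l (m + 1) > 8 * P" using bounds[of "m + 1"] by (simp add: P_def)
  consider "j < m + 2" | "j = m + 2" "i \<le> m" | "j = m + 2" "i = m + 1" | "j = m + 3" "i \<le> m" | "j = m + 3" "i = m + 1"
    | "j = m + 3" "i = m + 2" using assms unfolding n by linarith
  then have "\<bar>?l i\<bar> \<noteq> \<bar>?l j\<bar> \<and> ?l i \<noteq> 0 \<and> ?l j \<noteq> 0"
  proof cases
    case 1
    have "(4::real) ^ Suc i \<le> 4 ^ j" using assms(2) by (intro pow) simp
    then have "4 * (4::real) ^ i \<le> 4 ^ j" by simp
    moreover have "2 * 4 ^ i \<le> ?l i" "?l i \<le> 5 / 2 * 4 ^ i" "2 * 4 ^ j \<le> ?l j"
      using bounds[of i] bounds[of j] 1 assms(2) by simp_all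
    moreover have "(0::real) < 4 ^ i" by simp
    ultimately have "0 < ?l i" "?l i < ?l j" by linarith+
    then show ?thesis by simp
  next
    case 2
    then show ?thesis using small[of i] l2 P by auto
  next
    case 3
    then show ?thesis using m1 l2 P by auto
  next
    case 4
    then show ?thesis using small[of i] l3 P by auto
  next
    case 5
    then show ?thesis using m1 l3 P by auto
  next
    case 6
    then show ?thesis using l2 l3 P by auto
  qed
  then show "\<bar>?l i\<bar> \<noteq> \<bar>?l j\<bar>" "?l i \<noteq> 0" "?l j \<noteq> 0" by auto
qed

lemma inj_spectrum:
  assumes n: "4 \<le> n"
  shows "inj_on (spectrum (\<lambda>i. 4 ^ i)) {..<2 * n}"
proof (rule inj_onI)
  let ?l = "half_spectrum (\<lambda>i. 4 ^ i)"
  fix x y assume xy: "x \<in> {..<2 * n}" "y \<in> {..<2 * n}" "spectrum (\<lambda>i. 4 ^ i) x = spectrum (\<lambda>i. 4 ^ i) y"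
  define pos where "pos z = (if z < n then z else z - n)" for z
  have pos: "pos x < n" "pos y < n" using xy by (auto simp: pos_def)
  have abs: "\<bar>?l (pos x)\<bar> = \<bar>?l (pos y)\<bar>"
    using arg_cong[OF xy(3), of abs] by (auto simp: spectrum_def pos_def split: if_splits)
  have eq: "pos x = pos y"
    using half_spectrum_four_powers(1)[OF n, of "pos x" "pos y"] half_spectrum_four_powers(1)[OF n, of "pos y" "pos x"] abs pos
    by (cases "pos x" "pos y" rule: linorder_cases) auto
  have nz: "?l z \<noteq> 0" if "z < n" for z
  proof (cases "z = 0")
    case True
    then show ?thesis using half_spectrum_four_powers(2)[OF n, of 0 1] n by simp
  next
    case False
    then show ?thesis using half_spectrum_four_powers(3)[OF n, of 0 z] that by simp
  qed
  show "x = y"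
  proof (cases "x < n \<longleftrightarrow> y < n")
    case True
    then show ?thesis using eq xy by (auto simp: pos_def split: if_splits)
  next
    case False
    then have "?l (pos x) = - ?l (pos x)"
      using xy(3) eq by (auto simp: spectrum_def pos_def split: if_splits)
    then show ?thesis using nz[OF pos(1)] by simp
  qed
qed

lemma counts_large:
  assumes "4 \<le> n"
  shows "(2 * n choose 3) - n * (2 * n + 1) \<in> invariant_counts \<Omega>"
    and "k \<in> invariant_counts \<Omega> \<Longrightarrow> k + n * (2 * n + 1) \<le> 2 * n choose 3"
proof -
  have ind: "independent_family (2 * n) (covariant (chain (\<lambda>i. 4 ^ i) + omega_wedge (\<Sum>x<2 * n. e x)))"
    by (rule independent_covariant_chain) (use assms inj_spectrum in auto)
  show "(2 * n choose 3) - n * (2 * n + 1) \<in> invariant_counts \<Omega>"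
    using frame_lower[OF ind] by (simp only: dim2n)
  show "k \<in> invariant_counts \<Omega> \<Longrightarrow> k + n * (2 * n + 1) \<le> 2 * n choose 3"
    using frame_upper[OF ind] by (simp only: dim2n)
qed

section \<open>Dimension two and four\<close>

lemma zero_in_counts: "0 \<in> invariant_counts \<Omega>"
  by (rule invariant_counts_lower) auto

lemma counts_one: "n = 1 \<Longrightarrow> k \<in> invariant_counts \<Omega> \<Longrightarrow> k = 0"
  using invariant_counts_upper_pairs[of "{}" k] by (simp add: dim2n binomial_eq_0)

text \<open>The contraction of \<open>\<Omega> \<and> \<Omega> (p 0)\<close> is a multiple of \<open>p 0\<close>, so its stabiliser annihilates
  \<open>p 0\<close>. The four products that involve \<open>q 0\<close> are complementary to the annihilator of \<open>p 0\<close>,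
  hence the orbit is open.\<close>

lemma counts_two:
  assumes n: "n = 2" and k: "k \<in> invariant_counts \<Omega>"
  shows "k = 0"
proof -
  \<comment> \<open>For \<open>n = 2\<close> the basis vector with index \<open>2\<close> is \<open>q 0\<close>.\<close>
  define R :: "(nat \<times> nat) set" where "R = {(0, 2), (1, 2), (2, 2), (2, 3)}"
  have R: "R \<subseteq> pairs" "card R = 4" by (auto simp: R_def n)
  have "k + card R \<le> DIM('a) choose 3"
  proof (rule invariant_counts_upper_pairs[OF R(1) k, where \<theta> = "omega_wedge (p 0)"])
    fix c z assume c: "infinitesimal_act (sp_combination R c) (omega_wedge (p 0)) = 0" and z: "z \<in> R"
    have "covariant (omega_wedge (p 0)) 0 = 2 *\<^sub>R p 0" unfolding covariant.simps trace_vector_omega_wedge by (simp add: n)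
    then have "sp_combination R c (p 0) = 0"
      using sp_combination_annihilates_covariant[OF c, of 0] by (simp add: blinfun.scaleR_right)
    then have A0: "sp_combination R c (e 0) = 0" unfolding e_def by (simp add: n)
    obtain x y where xy: "z = (x, y)" "x \<le> y" "y < 2 * n" "x = 2 \<or> y = 2" using z by (auto simp: R_def n)
    have "dual_index 2 = 0" unfolding dual_index_def by (simp add: n)
    then have "\<Omega> (sp_combination R c (e (dual_index x))) (e (dual_index y)) = 0"
      using xy(4) A0 sp_combination_symmetric[of R c "e (dual_index x)" "e (dual_index y)"] by auto
    then show "c z = 0"
      using sp_combination_coefficient[OF R(1) xy(2,3), of c] z xy(1) orientation_nonzero by (auto split: if_splits)
  qed
  then show ?thesis by (simp add: R(2) dim2n n eval_nat_numeral)
qed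

section \<open>Dimension six\<close>

lemma infinitesimal_act_omega_wedge_zero:
  assumes S: "\<And>u v. \<Omega> (blinfun_apply A u) v = \<Omega> (blinfun_apply A v) u" and a: "A a = 0"
  shows "infinitesimal_act A (omega_wedge a) = 0"
proof (rule alt3_eqI)
  fix u v w
  have r: "\<Omega> x (A y) = - \<Omega> (A y) x" for x y by (rule Om_skew)
  have "\<Omega> a (A x) = 0" for x using S[of x a] a r[of a x] by simp
  then show "alt3_apply (infinitesimal_act A (omega_wedge a)) u v w = alt3_apply 0 u v w"
    using S[of u v] S[of v w] S[of w u] by (simp add: infinitesimal_act.rep_eq omega_wedge_apply r[of v] r[of w] r[of u])
qed

text \<open>The first two covariants show that an element of the stabiliser annihilates \<open>p 0\<close> and \<open>q 0\<close>. It then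
  acts on the span of the other four basis vectors and preserves the two 2-forms obtained by inserting
  \<open>p 0\<close> and \<open>q 0\<close> into the chain; this leaves a copy of \<open>sl(2)\<close>, which the three excluded
  coordinates detect.\<close>

lemma counts_three_upper:
  assumes n: "n = 3" and k: "k \<in> invariant_counts \<Omega>"
  shows "k \<le> 2"
proof -
  \<comment> \<open>The omitted products are \<open>q 1 q 2\<close>, \<open>p 1 p 2\<close> and \<open>p 1 q 1\<close>.\<close>
  define R where "R = pairs - {(4, 5), (1, 2), (1, 4)}"
  have R: "R \<subseteq> pairs" by (auto simp: R_def)
  have "card R = card pairs - card {(4, 5), (1, 2), (1::nat, 4::nat)}"
    unfolding R_def by (rule card_Diff_subset) (auto simp: n)
  then have cR: "card R = 18" unfolding card_pairs by (simp add: n)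
  define \<theta> where "\<theta> = chain (\<lambda>_. 1) + omega_wedge (p 0 + q 0)"
  have "k + card R \<le> DIM('a) choose 3"
  proof (rule invariant_counts_upper_pairs[OF R k, where \<theta> = \<theta>])
    fix c z assume c: "infinitesimal_act (sp_combination R c) \<theta> = 0" and z: "z \<in> R"
    define A where "A = sp_combination R c"
    have Sy: "\<Omega> (A u) v = \<Omega> (A v) u" for u v unfolding A_def by (rule sp_combination_symmetric)
    have n2: "2 \<le> n" by (simp add: n)
    have c0: "covariant \<theta> 0 = 4 *\<^sub>R (p 0 + q 0)" unfolding \<theta>_def covariant_chain_0[OF n2] by (simp add: n)
    have lam0: "half_spectrum (\<lambda>_. 1) 0 = 2" unfolding half_spectrum_def by (simp add: n)
    have c1: "covariant \<theta> 1 = 8 *\<^sub>R (p 0 - q 0)"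
    proof -
      have "covariant \<theta> 1 = contraction_map (chain (\<lambda>_. 1)) (covariant \<theta> 0)"
        unfolding One_nat_def \<theta>_def by (rule covariant_chain_Suc[OF n2])
      moreover have "contraction_map (chain (\<lambda>_. 1)) (p 0) = 2 *\<^sub>R p 0" "contraction_map (chain (\<lambda>_. 1)) (q 0) = (- 2) *\<^sub>R q 0"
        using contraction_map_chain_p[of 0 "\<lambda>_. 1"] contraction_map_chain_q[of 0 "\<lambda>_. 1"] lam0 n2 by simp_all
      ultimately show ?thesis
        unfolding c0 linear_scale[OF linear_contraction_map] linear_add[OF linear_contraction_map] by (simp add: algebra_simps)
    qed
    have "A (p 0) + A (q 0) = 0" "A (p 0) - A (q 0) = 0"
      using sp_combination_annihilates_covariant[OF c, of 0] sp_combination_annihilates_covariant[OF c, of 1]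
      unfolding c0 c1 A_def[symmetric] by (simp_all add: blinfun.scaleR_right blinfun.add_right blinfun.diff_right)
    then have "2 *\<^sub>R A (p 0) = 0" "A (q 0) = A (p 0)" by (simp_all add: scaleR_2)
    then have Ap: "A (p 0) = 0" and Aq: "A (q 0) = 0" by simp_all
    have "infinitesimal_act A (omega_wedge (p 0 + q 0)) = 0"
      by (rule infinitesimal_act_omega_wedge_zero[OF Sy]) (simp add: blinfun.add_right Ap Aq)
    then have ch: "infinitesimal_act A (chain (\<lambda>_. 1)) = 0"
      using c unfolding \<theta>_def A_def[symmetric] by (simp add: linear_add[OF infinitesimal_act_linear_right])
    have chain: "chain (\<lambda>_. 1) = decomposable (p 0) (p 1) (q 2) + decomposable (q 0) (q 1) (p 2)"
      unfolding chain_def by (simp add: n numeral_2_eq_2)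
    note val = pp[unfolded n] qq[unfolded n] pq[unfolded n] qp[unfolded n]
    have r: "\<Omega> x (A y) = - \<Omega> (A y) x" for x y by (rule Om_skew)
    have A0: "\<Omega> (A x) (p 0) = 0" "\<Omega> (A x) (q 0) = 0" for x
      using Sy[of x "p 0"] Sy[of x "q 0"] Ap Aq by simp_all
    \<comment> \<open>Inserting \<open>p 0\<close> and \<open>q 0\<close>, which \<open>A\<close> annihilates, into the infinitesimal action on the chain.\<close>
    have E1: "\<Omega> (A v) (q 1) * \<Omega> (p 2) w - \<Omega> (q 1) w * \<Omega> (A v) (p 2) +
        (\<Omega> (q 1) v * \<Omega> (A w) (p 2) - \<Omega> (A w) (q 1) * \<Omega> (p 2) v) = 0" for v w
    proof -
      have "alt3_apply (infinitesimal_act A (chain (\<lambda>_. 1))) (p 0) v w = 0" by (simp add: ch)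
      then show ?thesis
        by (simp add: chain infinitesimal_act.rep_eq decomposable_apply val Ap r algebra_simps)
    qed
    have E2: "\<Omega> (A v) (p 1) * \<Omega> (q 2) w - \<Omega> (p 1) w * \<Omega> (A v) (q 2) +
        (\<Omega> (p 1) v * \<Omega> (A w) (q 2) - \<Omega> (A w) (p 1) * \<Omega> (q 2) v) = 0" for v w
    proof -
      have "alt3_apply (infinitesimal_act A (chain (\<lambda>_. 1))) (q 0) v w = 0" by (simp add: ch)
      then show ?thesis
        by (simp add: chain infinitesimal_act.rep_eq decomposable_apply val Aq r algebra_simps)
    qed
    have coeff0: "\<Omega> (A (e (dual_index x))) (e (dual_index y)) = 0" if "x \<le> y" "y < 2 * n" "(x, y) \<notin> R" for x y
      unfolding A_def sp_combination_coefficient[OF R that(1,2)] using that(3) by simp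
    have ev: "e 0 = p 0" "e 1 = p 1" "e 2 = p 2" "e 3 = q 0" "e 4 = q 1" "e 5 = q 2" unfolding e_def by (simp_all add: n)
    have sv: "dual_index 4 = 1" "dual_index 5 = 2" "dual_index 1 = 4" "dual_index 2 = 5" unfolding dual_index_def by (simp_all add: n)
    have lt: "2 < 2 * n" "4 < 2 * n" "5 < 2 * n" by (simp_all add: n)
    have f1: "\<Omega> (A (p 1)) (p 2) = 0" using coeff0[of 4 5] lt by (simp add: R_def sv ev del: One_nat_def)
    have f2: "\<Omega> (A (q 1)) (q 2) = 0" using coeff0[of 1 2] lt by (simp add: R_def sv ev del: One_nat_def)
    have f3: "\<Omega> (A (q 1)) (p 1) = 0" using coeff0[of 1 4] lt by (simp add: R_def sv ev del: One_nat_def)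
    have g: "\<Omega> (A (p 2)) (p 2) = 0" "\<Omega> (A (q 1)) (p 2) = 0" "\<Omega> (A (q 1)) (q 1) = 0"
      using E1[of "p 1" "p 2"] E1[of "p 1" "q 1"] E1[of "q 2" "q 1"] by (simp_all add: val)
    have h: "\<Omega> (A (q 2)) (q 2) = 0" "\<Omega> (A (p 1)) (q 2) = 0" "\<Omega> (A (p 1)) (p 1) = 0"
      using E2[of "q 1" "q 2"] E2[of "q 1" "p 1"] E2[of "p 2" "p 1"] by (simp_all add: val)
    have t: "\<Omega> (A (q 2)) (p 2) = 0"
      using E1[of "p 1" "q 2"] f3 Sy[of "p 1" "q 1"] by (simp add: val)
    have all: "\<Omega> (A (e x)) (e y) = 0" if "x < 6" "y < 6" for x y
    proof -
      have "x \<in> {0, 1, 2, 3, 4, 5}" "y \<in> {0, 1, 2, 3, 4, 5}" using that by auto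
      then show ?thesis
        using f1 f2 f3 g h t Sy[of "p 2" "p 1"] Sy[of "q 2" "q 1"] Sy[of "p 1" "q 1"] Sy[of "p 2" "q 1"]
          Sy[of "q 2" "p 1"] Sy[of "p 2" "q 2"] Ap Aq A0
        by (elim insertE emptyE) (simp_all add: ev del: One_nat_def)
    qed
    obtain x y where xy: "z = (x, y)" "x \<le> y" "y < 2 * n" using z R by auto
    have "dual_index x < 6" "dual_index y < 6" using dual_index_less[of x] dual_index_less[of y] xy by (simp_all add: n)
    then have "\<Omega> (A (e (dual_index x))) (e (dual_index y)) = 0" by (rule all)
    then show "c z = 0"
      using sp_combination_coefficient[OF R xy(2,3), of c] z xy(1) orientation_nonzero unfolding A_def by (auto split: if_splits)
  qed
  then show ?thesis by (simp add: cR dim2n n eval_nat_numeral)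
qed

text \<open>On the plane of forms \<open>t w1 + w2 + s (\<Omega> \<and> \<Omega> a)\<close> the two invariants are multiples of
  \<open>s\<^sup>2 t\<close> and \<open>s\<^sup>2 t\<^sup>3\<close>, whose Jacobian at \<open>s = t = 1\<close> does not vanish.\<close>

lemma counts_three_lower:
  assumes n: "n = 3"
  shows "2 \<in> invariant_counts \<Omega>"
proof -
  have n2: "2 \<le> n" by (simp add: n)
  define w1 where "w1 = decomposable (p 0) (p 1) (q 2)"
  define w2 where "w2 = decomposable (q 0) (q 1) (p 2)"
  define a where "a = p 0 + q 0"
  have chain: "chain (\<lambda>_. t) = t *\<^sub>R w1 + w2" for t
    unfolding chain_def w1_def w2_def by (simp add: n numeral_2_eq_2)
  have val: "pair_invariant 0 1 (t *\<^sub>R w1 + w2 + s *\<^sub>R omega_wedge a) = - 64 * s\<^sup>2 * t"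
    "pair_invariant 0 3 (t *\<^sub>R w1 + w2 + s *\<^sub>R omega_wedge a) = - 256 * s\<^sup>2 * t ^ 3" for s t
  proof -
    define \<theta> where "\<theta> = chain (\<lambda>_. t) + omega_wedge (s *\<^sub>R a)"
    have eq: "t *\<^sub>R w1 + w2 + s *\<^sub>R omega_wedge a = \<theta>" by (simp add: \<theta>_def chain linear_scale[OF linear_omega_wedge])
    have half_spectrum: "half_spectrum (\<lambda>_. t) 0 = 2 * t" unfolding half_spectrum_def by (simp add: n)
    have Suc: "covariant \<theta> (Suc i) = contraction_map (chain (\<lambda>_. t)) (covariant \<theta> i)" for i
      unfolding \<theta>_def by (rule covariant_chain_Suc[OF n2])
    have Qp: "contraction_map (chain (\<lambda>_. t)) (p 0) = (2 * t) *\<^sub>R p 0" and Qq: "contraction_map (chain (\<lambda>_. t)) (q 0) = (- 2 * t) *\<^sub>R q 0"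
      using contraction_map_chain_p[of 0 "\<lambda>_. t"] contraction_map_chain_q[of 0 "\<lambda>_. t"] half_spectrum n2 by simp_all
    note Ql = linear_scale[OF linear_contraction_map] linear_add[OF linear_contraction_map] linear_diff[OF linear_contraction_map]
    have c0: "covariant \<theta> 0 = (4 * s) *\<^sub>R (p 0 + q 0)" unfolding \<theta>_def covariant_chain_0[OF n2] a_def by (simp add: n)
    have c1: "covariant \<theta> (Suc 0) = (8 * s * t) *\<^sub>R (p 0 - q 0)" unfolding Suc c0 by (simp add: Ql Qp Qq algebra_simps)
    have c2: "covariant \<theta> (Suc (Suc 0)) = (16 * s * t\<^sup>2) *\<^sub>R (p 0 + q 0)"
      unfolding Suc[of "Suc 0"] c1 by (simp add: Ql Qp Qq algebra_simps power2_eq_square)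
    have c3: "covariant \<theta> (Suc (Suc (Suc 0))) = (32 * s * t ^ 3) *\<^sub>R (p 0 - q 0)"
      unfolding Suc[of "Suc (Suc 0)"] c2 by (simp add: Ql Qp Qq algebra_simps power2_eq_square power3_eq_cube)
    have pq0: "\<Omega> (p 0) (q 0) = 1" "\<Omega> (q 0) (p 0) = - 1" using n2 by (simp_all add: pq qp)
    show "pair_invariant 0 1 (t *\<^sub>R w1 + w2 + s *\<^sub>R omega_wedge a) = - 64 * s\<^sup>2 * t"
      unfolding eq pair_invariant_def One_nat_def c0 c1 by (simp add: pq0 power2_eq_square)
    show "pair_invariant 0 3 (t *\<^sub>R w1 + w2 + s *\<^sub>R omega_wedge a) = - 256 * s\<^sup>2 * t ^ 3"
      unfolding eq pair_invariant_def numeral_3_eq_3 c0 c3 by (simp add: pq0 power2_eq_square)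
  qed
  define \<theta> where "\<theta> = w1 + w2 + omega_wedge a"
  have \<theta>s: "\<theta> = (w1 + w2) + 1 *\<^sub>R omega_wedge a" and \<theta>t: "\<theta> = (w2 + omega_wedge a) + 1 *\<^sub>R w1" by (simp_all add: \<theta>_def)
  note diff = real_polynomial_function_differentiable[OF real_polynomial_function_pair_invariant]
  have s1: "frechet_derivative (pair_invariant 0 1) (at \<theta>) (omega_wedge a) = - 128"
    unfolding \<theta>s
  proof (rule frechet_along_line[OF diff])
    have "pair_invariant 0 1 (w1 + w2 + s *\<^sub>R omega_wedge a) = - 64 * s\<^sup>2" for s using val(1)[of 1 s] by simp
    then show "((\<lambda>s. pair_invariant 0 1 (w1 + w2 + s *\<^sub>R omega_wedge a)) has_real_derivative - 128) (at 1)"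
      by (auto intro!: derivative_eq_intros)
  qed
  have s3: "frechet_derivative (pair_invariant 0 3) (at \<theta>) (omega_wedge a) = - 512"
    unfolding \<theta>s
  proof (rule frechet_along_line[OF diff])
    have "pair_invariant 0 3 (w1 + w2 + s *\<^sub>R omega_wedge a) = - 256 * s\<^sup>2" for s using val(2)[of 1 s] by simp
    then show "((\<lambda>s. pair_invariant 0 3 (w1 + w2 + s *\<^sub>R omega_wedge a)) has_real_derivative - 512) (at 1)"
      by (auto intro!: derivative_eq_intros)
  qed
  have t1: "frechet_derivative (pair_invariant 0 1) (at \<theta>) w1 = - 64"
    unfolding \<theta>t
  proof (rule frechet_along_line[OF diff])
    have "pair_invariant 0 1 (w2 + omega_wedge a + t *\<^sub>R w1) = - 64 * t" for t using val(1)[of t 1] by (simp add: algebra_simps)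
    then show "((\<lambda>t. pair_invariant 0 1 (w2 + omega_wedge a + t *\<^sub>R w1)) has_real_derivative - 64) (at 1)"
      by (auto intro!: derivative_eq_intros)
  qed
  have t3: "frechet_derivative (pair_invariant 0 3) (at \<theta>) w1 = - 768"
    unfolding \<theta>t
  proof (rule frechet_along_line[OF diff])
    have "pair_invariant 0 3 (w2 + omega_wedge a + t *\<^sub>R w1) = - 256 * t ^ 3" for t using val(2)[of t 1] by (simp add: algebra_simps)
    then show "((\<lambda>t. pair_invariant 0 3 (w2 + omega_wedge a + t *\<^sub>R w1)) has_real_derivative - 768) (at 1)"
      by (auto intro!: derivative_eq_intros)
  qed
  define I where "I = (\<lambda>i::nat. if i = 0 then pair_invariant 0 1 else pair_invariant 0 3)"
  show ?thesis
  proof (rule invariant_counts_lower[where I = I and ?x0.0 = \<theta>])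
    show "real_polynomial_function (I i)" for i by (simp add: I_def real_polynomial_function_pair_invariant)
    show "I i (act A \<theta>) = I i \<theta>" if "A \<in> Sp \<Omega>" for i A \<theta> by (simp add: I_def pair_invariant_act that)
    fix c :: "nat \<Rightarrow> real"
    assume c: "\<forall>v. (\<Sum>i<2. c i * frechet_derivative (I i) (at \<theta>) v) = 0"
    have "c 0 * - 128 + c 1 * - 512 = 0" "c 0 * - 64 + c 1 * - 768 = 0"
      using c[rule_format, of "omega_wedge a"] c[rule_format, of w1]
      by (simp_all add: numeral_2_eq_2 I_def s1[unfolded One_nat_def] s3 t1[unfolded One_nat_def] t3)
    then have "c 0 = 0" "c 1 = 0" by linarith+
    then show "\<forall>i<2. c i = 0" by (auto simp: less_2_cases_iff)
  qed
qed

end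

section \<open>The number of invariants\<close>

lemma six_times_choose_three: "6 * (m + 2 choose 3) = (m + 2) * (m + 1) * m"
proof (induction m)
  case (Suc m)
  have "2 * (m + 2 choose 2) = (m + 2) * (m + 1)" by (simp add: choose_two)
  moreover have "(Suc m + 2 choose 3) = (m + 2 choose 2) + (m + 2 choose 3)"
    by (simp add: numeral_3_eq_3 numeral_2_eq_2)
  ultimately show ?case using Suc by (simp add: algebra_simps)
qed simp

theorem theorem6:
  fixes \<Omega> :: "'a::euclidean_space \<Rightarrow> 'a \<Rightarrow> real" and n :: nat
  assumes "n \<ge> 1" and "DIM('a) = 2 * n" and "symplectic_form \<Omega>"
  shows "finite (invariant_counts \<Omega>) \<and>
    real (num_invariants \<Omega>) =
      (if n \<le> 2 then 0
       else if n = 3 then 2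
       else real n * (4 * (real n)\<^sup>2 - 12 * real n - 1) / 3)"
proof -
  obtain p q where "symplectic_basis \<Omega> n p q"
    using symplectic_basis_exists[OF assms(3,2)] by blast
  then interpret symplectic_basis \<Omega> n p q .
  have max: "finite (invariant_counts \<Omega>) \<and> num_invariants \<Omega> = K"
    if "K \<in> invariant_counts \<Omega>" "\<And>k. k \<in> invariant_counts \<Omega> \<Longrightarrow> k \<le> K" for K
  proof -
    have "finite (invariant_counts \<Omega>)" by (rule finite_subset[of _ "{..K}"]) (use that(2) in auto)
    moreover from this have "num_invariants \<Omega> = K"
      unfolding num_invariants_def by (rule Max_eqI) (use that in auto)
    ultimately show ?thesis by blast
  qed
  consider "n = 1" | "n = 2" | "n = 3" | "4 \<le> n" using assms(1) by linarith
  then show ?thesis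
  proof cases
    case 1
    then show ?thesis using max[of 0] zero_in_counts counts_one by auto
  next
    case 2
    then show ?thesis using max[of 0] zero_in_counts counts_two by auto
  next
    case 3
    then show ?thesis using max[of 2] counts_three_lower counts_three_upper by auto
  next
    case 4
    note large = counts_large[OF 4]
    have le: "n * (2 * n + 1) \<le> 2 * n choose 3" using large(2)[OF zero_in_counts] by simp
    have "finite (invariant_counts \<Omega>) \<and> num_invariants \<Omega> = (2 * n choose 3) - n * (2 * n + 1)"
    proof (rule max[OF large(1)])
      show "k \<le> (2 * n choose 3) - n * (2 * n + 1)" if "k \<in> invariant_counts \<Omega>" for k
        using large(2)[OF that] by linarith
    qed
    moreover have "real ((2 * n choose 3) - n * (2 * n + 1)) = real n * (4 * (real n)\<^sup>2 - 12 * real n - 1) / 3"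
    proof -
      obtain m where m: "2 * n = m + 2" using 4 le_Suc_ex[of 2 "2 * n"] by (auto simp: add.commute)
      have "6 * real (2 * n choose 3) = real (2 * n) * (real (2 * n) - 1) * (real (2 * n) - 2)"
        using arg_cong[OF six_times_choose_three[of m], of real] unfolding m by (simp add: algebra_simps)
      moreover have "real ((2 * n choose 3) - n * (2 * n + 1)) = real (2 * n choose 3) - real n * (2 * real n + 1)"
        unfolding of_nat_diff[OF le] by (simp add: algebra_simps)
      ultimately show ?thesis by (simp add: field_simps power2_eq_square)
    qed
    ultimately show ?thesis using 4 by auto
  qed
qed

end
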